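(* There exist positive constants $c_1, c_2, c_3$ such that the following hold. (a) Let $G = (V,E)$ be an $n$-vertex graph satisfying $\alpha(G)\delta(G) = O(n)$ and $\delta(G) > c_1 (\alpha(G) \log n)^2$. Then $G \cup \mathbb{G}(n,p)$ is a.a.s. pancyclic whenever $p := p(n) \geq \frac{c_2 \log n \,\log(\alpha(G) \log n)}{n \delta(G)}$. (b) For all integers $d := d(n) \geq 1$ and $k := k(n)$ with $k \to \infty$ as $n \to \infty$ and $k(d+1) \leq n$, there exists an $n$-vertex graph $H$ with $\alpha(H) = k$ and $\delta(H) = d$ such that a.a.s. $H \cup \mathbb{G}(n,p)$ is not Hamiltonian whenever $p := p(n) \leq \frac{c_3 \log k}{d n}$.
   Context: For an $n$-vertex graph $G$, $G \cup \mathbb{G}(n,p)$ denotes the union $G \cup R$ where $R$ is the binomial random graph on the vertex set $V(G)$ in which each pair of vertices is an edge independently with probability $p$. "A.a.s." means with probability tending to $1$ as $n \to \infty$. $\alpha(G)$ is the independence number and $\delta(G)$ the minimum degree. A graph on $n$ vertices is Hamiltonian if it has a cycle through all vertices, and pancyclic if it contains a cycle of length $\ell$ for every $3 \leq \ell \leq n$. Asymptotic notation is with respect to $n \to \infty$. *)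

theory Defs
  imports "HOL-Probability.Probability"
begin

definition all_pairs :: "nat \<Rightarrow> nat set set" where
  "all_pairs n = {e. e \<subseteq> {0..<n} \<and> card e = 2}"

definition is_graph :: "nat \<Rightarrow> nat set set \<Rightarrow> bool" where
  "is_graph n E \<longleftrightarrow> E \<subseteq> all_pairs n"

definition degree :: "nat set set \<Rightarrow> nat \<Rightarrow> nat" where
  "degree E v = card {u. {u, v} \<in> E}"

definition min_degree :: "nat \<Rightarrow> nat set set \<Rightarrow> nat" where
  "min_degree n E = Min (degree E ` {0..<n})"

definition independent_set :: "nat \<Rightarrow> nat set set \<Rightarrow> nat set \<Rightarrow> bool" where
  "independent_set n E S \<longleftrightarrow> S \<subseteq> {0..<n} \<and> (\<forall>u\<in>S. \<forall>v\<in>S. {u, v} \<notin> E)"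

definition independence_number :: "nat \<Rightarrow> nat set set \<Rightarrow> nat" where
  "independence_number n E = Max (card ` {S. independent_set n E S})"

definition has_cycle_of_length :: "nat \<Rightarrow> nat set set \<Rightarrow> nat \<Rightarrow> bool" where
  "has_cycle_of_length n E l \<longleftrightarrow> 3 \<le> l \<and>
     (\<exists>vs. length vs = l \<and> distinct vs \<and> set vs \<subseteq> {0..<n} \<and>
        (\<forall>i<l. {vs ! i, vs ! ((i + 1) mod l)} \<in> E))"

definition hamiltonian :: "nat \<Rightarrow> nat set set \<Rightarrow> bool" where
  "hamiltonian n E \<longleftrightarrow> has_cycle_of_length n E n"

definition pancyclic :: "nat \<Rightarrow> nat set set \<Rightarrow> bool" where
  "pancyclic n E \<longleftrightarrow> (\<forall>l. 3 \<le> l \<and> l \<le> n \<longrightarrow> has_cycle_of_length n E l)"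

definition random_graph :: "nat \<Rightarrow> real \<Rightarrow> nat set set pmf" where
  "random_graph n p =
     map_pmf (\<lambda>f. {e \<in> all_pairs n. f e}) (Pi_pmf (all_pairs n) False (\<lambda>_. bernoulli_pmf p))"

end

theory Submission
  imports Defs "HOL-Real_Asymp.Real_Asymp"
begin

text \<open>
  Part (a). Let \<open>a\<close> be the independence number and \<open>\<delta>\<close> the minimum degree of \<open>G\<close>. Splitting \<open>V\<close> along
  separators of size \<open>O(a)\<close> yields at most \<open>a\<close> highly connected pieces of size at least \<open>\<delta> / 2\<close>. Inside
  them, region growing (with the independence number as volume) refines the partition to at most \<open>2 a\<close>
  classes that keep diameter \<open>O(log\<^sup>2 n)\<close> after the deletion of any \<open>O(a log\<^sup>2 n)\<close> vertices; this is where
  \<open>\<delta> > c (a log n)\<^sup>2\<close> is used. Already for \<open>p = C log (a log n) / (n \<delta>)\<close> the random edges at a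
  suitable set of \<open>O(\<delta>)\<close> vertices per piece a.a.s. form a matching, and they connect the pieces in two
  edge-disjoint ways. Completing both systems by edges of \<open>G\<close> gives two disjoint matchings, each connecting
  all classes after contraction; the first together with a parity-correcting part of the second is Eulerian.
  Linking up consecutive edges of an Euler tour inside the classes yields a short cycle through all classes.
  It is extended by few vertices at a time, up to a Hamilton cycle, by the fan argument of Chvatal and Erdos;
  the rim of a wheel through which the cycle passes fills in the lengths in between.

  Part (b). In a disjoint union of \<open>k - 1\<close> cliques of order \<open>d + 1\<close> and one larger clique, one of
  \<open>k\<^sup>1\<^sup>/\<^sup>4\<close> of the small cliques a.a.s. receives no random edge.
\<close>

section \<open>Independence numbers, paths and region growing\<close>

text \<open>The threshold for \<open>p\<close> contains \<open>log (a log n)\<close> instead of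
  \<open>log n\<close> because random edges only have to join the at most \<open>a\<close> coarse
  pieces: \<open>r\<close> pieces offer about \<open>r \<delta> n\<close> pairs, and a union bound
  over sets of pieces suffices. Fine classes can be far smaller than \<delta>, too small for random
  edges to reach all of them; edges of \<open>G\<close> have to join the classes within a piece,
  which is the purpose of the high connectivity of the pieces. The joining edges must form matchings
  because a cycle passes each of their ends only once. Two systems are needed for parity: the first
  connects the classes but leaves odd degrees, and part of a second connecting system can correct
  any even number of them. Cherries (two random edges at one vertex) would spoil the matchings.
  Their expected number, about \<open>p^2 (a \<delta> n^2 + a^2 \<delta>^2 n)\<close>, is small only
  for the reduced \<open>p\<close> of the overview, and there because of both hypotheses on
  \<delta>; larger \<open>p\<close> follow by monotonicity of pancyclicity. The number of classes
  has to stay O(a), so region growing is charged to the independence number and not to the number of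
  vertices.\<close>

definition nonadj :: "('a \<Rightarrow> 'a \<Rightarrow> bool) \<Rightarrow> 'a set \<Rightarrow> 'a set \<Rightarrow> bool" where
  "nonadj A S T \<longleftrightarrow> (\<forall>u\<in>S. \<forall>v\<in>T. \<not> A u v)"

definition path_in :: "('a \<Rightarrow> 'a \<Rightarrow> bool) \<Rightarrow> 'a set \<Rightarrow> 'a \<Rightarrow> 'a list \<Rightarrow> 'a \<Rightarrow> bool" where
  "path_in A S x xs y \<longleftrightarrow>
     xs \<noteq> [] \<and> hd xs = x \<and> last xs = y \<and> distinct xs \<and> successively A xs \<and> set xs \<subseteq> S"

definition ind :: "('a \<Rightarrow> 'a \<Rightarrow> bool) \<Rightarrow> 'a set \<Rightarrow> nat" where
  "ind A S = Max (card ` {I. I \<subseteq> S \<and> nonadj A I I})"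

text \<open>Paths are measured by their number of vertices. The deleted set \<open>U\<close> may lie
  partly outside \<open>Z\<close>, so that one set of forbidden vertices serves all classes.\<close>

definition robust :: "('a \<Rightarrow> 'a \<Rightarrow> bool) \<Rightarrow> nat \<Rightarrow> nat \<Rightarrow> 'a set \<Rightarrow> bool" where
  "robust A s l Z \<longleftrightarrow> (\<forall>U x y. finite U \<and> card U \<le> s \<and> x \<in> Z - U \<and> y \<in> Z - U \<longrightarrow>
     (\<exists>xs. path_in A (Z - U) x xs y \<and> length xs \<le> l))"

lemma ind_ge:
  assumes "finite S" "I \<subseteq> S" "nonadj A I I" shows "card I \<le> ind A S"
  unfolding ind_def by (rule Max_ge) (use assms in auto)

lemma ind_witness:
  assumes "finite S" obtains I where "I \<subseteq> S" "nonadj A I I" "card I = ind A S"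
proof -
  have "ind A S \<in> card ` {I. I \<subseteq> S \<and> nonadj A I I}"
    unfolding ind_def
  proof (rule Max_in)
    have "{} \<in> {I. I \<subseteq> S \<and> nonadj A I I}" by (auto simp: nonadj_def)
    then show "card ` {I. I \<subseteq> S \<and> nonadj A I I} \<noteq> {}" by blast
  qed (use assms in auto)
  then show ?thesis using that by auto
qed

lemma ind_mono:
  assumes "finite T" "S \<subseteq> T" shows "ind A S \<le> ind A T"
proof -
  obtain I where "I \<subseteq> S" "nonadj A I I" "card I = ind A S"
    using ind_witness assms finite_subset by metis
  then show ?thesis using ind_ge[of T I A] assms by auto
qed

text \<open>A union of independent sets from two non-adjacent parts is independent. This additivity
  is what makes the independence number usable as a volume.\<close>

lemma ind_add:
  assumes "finite S" "S1 \<subseteq> S" "S2 \<subseteq> S" "S1 \<inter> S2 = {}" "nonadj A S1 S2" "symp A"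
  shows "ind A S1 + ind A S2 \<le> ind A S"
proof -
  obtain I1 where 1: "I1 \<subseteq> S1" "nonadj A I1 I1" "card I1 = ind A S1"
    using ind_witness assms finite_subset by metis
  obtain I2 where 2: "I2 \<subseteq> S2" "nonadj A I2 I2" "card I2 = ind A S2"
    using ind_witness assms finite_subset by metis
  have "nonadj A (I1 \<union> I2) (I1 \<union> I2)"
    using 1 2 assms(5,6) unfolding nonadj_def symp_def by blast
  then have "card (I1 \<union> I2) \<le> ind A S"
    using ind_ge[of S "I1 \<union> I2" A] 1 2 assms by blast
  moreover have "card (I1 \<union> I2) = card I1 + card I2"
  proof (rule card_Un_disjoint)
    show "finite I1" "finite I2" using 1(1) 2(1) assms(1-3) by (meson finite_subset)+
  qed (use 1(1) 2(1) assms(4) in blast)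
  ultimately show ?thesis using 1 2 by simp
qed

lemma ind_sum:
  assumes "symp A" "finite F" "\<And>P. P \<in> F \<Longrightarrow> finite P"
    "\<And>P P'. P \<in> F \<Longrightarrow> P' \<in> F \<Longrightarrow> P \<noteq> P' \<Longrightarrow> P \<inter> P' = {} \<and> nonadj A P P'"
  shows "(\<Sum>P\<in>F. ind A P) \<le> ind A (\<Union>F)"
  using assms(2-4)
proof (induction F rule: finite_induct)
  case (insert P F)
  have "ind A P + ind A (\<Union>F) \<le> ind A (\<Union>(insert P F))"
  proof (rule ind_add)
    show "nonadj A P (\<Union>F)" unfolding nonadj_def
    proof (intro ballI)
      fix u v assume "u \<in> P" "v \<in> \<Union>F"
      then obtain P' where "P' \<in> F" "v \<in> P'" by blast
      moreover have "P \<noteq> P'" using insert.hyps(2) \<open>P' \<in> F\<close> by blast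
      ultimately show "\<not> A u v"
        using insert.prems(2)[of P P'] \<open>u \<in> P\<close> unfolding nonadj_def by auto
    qed
    show "P \<inter> \<Union>F = {}" using insert.prems(2)[of P] insert.hyps(2) by blast
    show "finite (\<Union>(insert P F))" using insert by auto
  qed (use assms(1) in auto)
  moreover have "(\<Sum>P\<in>F. ind A P) \<le> ind A (\<Union>F)" by (rule insert.IH) (use insert.prems in auto)
  ultimately show ?case using insert.hyps by simp
qed simp

lemma ind_pos:
  assumes "finite S" "S \<noteq> {}" "irreflp A" shows "1 \<le> ind A S"
proof -
  obtain x where "x \<in> S" using assms by blast
  then have "card {x} \<le> ind A S"
    by (intro ind_ge) (use assms in \<open>auto simp: nonadj_def irreflp_def\<close>)
  then show ?thesis by simp
qed

section \<open>Paths and balls in induced subgraphs\<close>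

lemma path_in_extend:
  assumes "path_in A S x xs u" "A u w" "w \<in> S"
  shows "\<exists>ys. path_in A S x ys w \<and> length ys \<le> length xs + 1"
proof (cases "w \<in> set xs")
  case False
  then have "path_in A S x (xs @ [w]) w"
    using assms unfolding path_in_def by (auto simp: successively_append_iff)
  then show ?thesis by fastforce
next
  case True
  then obtain ys zs where "xs = ys @ w # zs" by (metis split_list)
  moreover from this have "path_in A S x (ys @ [w]) w"
    using assms(1) unfolding path_in_def
    by (auto simp: successively_append_iff hd_append successively_Cons)
  ultimately show ?thesis by fastforce
qed

lemma path_in_of_walk:
  assumes "ws \<noteq> []" "successively A ws" "set ws \<subseteq> S"
  shows "\<exists>xs. path_in A S (hd ws) xs (last ws) \<and> length xs \<le> length ws"
  using assms
proof (induction ws rule: rev_nonempty_induct)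
  case (single x)
  then have "path_in A S x [x] x" by (simp add: path_in_def)
  then show ?case by fastforce
next
  case (snoc w ws)
  then have "A (last ws) w" and ws: "successively A ws"
    by (auto simp: successively_append_iff)
  moreover obtain xs where xs: "path_in A S (hd ws) xs (last ws)" "length xs \<le> length ws"
    using snoc ws by auto
  ultimately obtain ys where "path_in A S (hd ws) ys w" "length ys \<le> length xs + 1"
    using path_in_extend[OF xs(1), of w] snoc.prems by auto
  then show ?case using snoc.hyps xs by auto
qed

lemma path_in_rev:
  assumes "symp A" "path_in A S x xs y" shows "path_in A S y (rev xs) x"
proof -
  have "successively (\<lambda>x y. A y x) xs"
    by (rule successively_mono[of A]) (use assms in \<open>auto simp: path_in_def symp_def\<close>)
  then show ?thesis using assms(2) unfolding path_in_def by (auto simp: hd_rev last_rev)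
qed

lemma path_in_append_walk:
  assumes "path_in A S x xs y" "path_in A S y' ys z" "A y y'"
  shows "\<exists>zs. path_in A S x zs z \<and> length zs \<le> length xs + length ys"
  using path_in_of_walk[of "xs @ ys" A S] assms unfolding path_in_def
  by (auto simp: successively_append_iff)

lemma path_in_concat_walk:
  assumes "path_in A S x xs y" "path_in A S y ys z"
  shows "\<exists>zs. path_in A S x zs z \<and> length zs \<le> length xs + length ys"
proof (cases "tl ys = []")
  case True
  then have "y = z" using assms(2) unfolding path_in_def by (cases ys) auto
  then show ?thesis using assms by auto
next
  case False
  then obtain a b us where ys: "ys = a # b # us" by (cases ys; cases "tl ys") auto
  then have "path_in A S b (b # us) z" "A y b" using assms(2) unfolding path_in_def by auto
  then show ?thesis using path_in_append_walk[OF assms(1)] ys by fastforce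
qed

fun reach :: "('a \<Rightarrow> 'a \<Rightarrow> bool) \<Rightarrow> 'a set \<Rightarrow> 'a \<Rightarrow> nat \<Rightarrow> 'a set" where
  "reach A S x 0 = {x}"
| "reach A S x (Suc r) = reach A S x r \<union> {w \<in> S. \<exists>u\<in>reach A S x r. A u w}"

lemma reach_subset: "x \<in> S \<Longrightarrow> reach A S x r \<subseteq> S"
  by (induction r) auto

lemma reach_self: "x \<in> reach A S x r"
  by (induction r) auto

lemma reach_mono: "r \<le> r' \<Longrightarrow> reach A S x r \<subseteq> reach A S x r'"
  by (induction r' rule: dec_induct) auto

lemma reach_path:
  assumes "x \<in> S" "w \<in> reach A S x r"
  shows "\<exists>xs. path_in A S x xs w \<and> length xs \<le> r + 1"
  using assms(2)
proof (induction r arbitrary: w)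
  case 0
  then have "path_in A S x [x] w" using assms(1) by (simp add: path_in_def)
  then show ?case by fastforce
next
  case (Suc r)
  show ?case
  proof (cases "w \<in> reach A S x r")
    case True
    then show ?thesis using Suc.IH by fastforce
  next
    case False
    then obtain u where u: "u \<in> reach A S x r" "A u w" "w \<in> S" using Suc.prems by auto
    obtain xs where "path_in A S x xs u" "length xs \<le> r + 1" using Suc.IH u(1) by blast
    then show ?thesis using path_in_extend[of A S x xs u w] u(2,3) by fastforce
  qed
qed

section \<open>Region growing with a superadditive potential\<close>

text \<open>Potential for repeated splitting into parts that may be adjacent, for which the
  independence number alone is not superadditive. For \<open>1 \<le> x \<le> 2 ^ Q\<close> it lies
  between \<open>x\<close> and \<open>2 x\<close>; hence a family of total weight at most
  \<open>2 a\<close> has at most \<open>2 a\<close> members.\<close>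

definition split_weight :: "nat \<Rightarrow> nat \<Rightarrow> real" where
  "split_weight Q x = real x * (1 + log 2 (real x) / real Q)"

text \<open>The part \<open>a1\<close> has at most half the volume, so its logarithm drops by at
  least 1, a gain of \<open>a1 / Q\<close>. The excess \<open>a1 / (2 Q)\<close> in the volume costs
  \<open>a1 / (2 Q)\<close> in the linear term and, as \<open>log a \<le> Q\<close>, at most the
  same in the logarithmic term.\<close>

lemma split_weight_superadd:
  assumes "1 \<le> a1" "1 \<le> a2" "2 * a1 \<le> a" "1 \<le> Q"
    "real a1 + real a2 \<le> real a + real a1 / (2 * real Q)" "a \<le> 2 ^ Q"
  shows "split_weight Q a1 + split_weight Q a2 \<le> split_weight Q a"
proof -
  define lg where "lg = log 2 (real a)"
  have Q: "real Q \<ge> 1" using assms by simp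
  have "real a1 / (2 * real Q) \<le> real a1" using Q mult_mono[of 1 "real Q * 2" "real a1" "real a1"] by (simp add: field_simps)
  then have a2a: "real a2 \<le> real a" using assms by linarith
  have lg: "lg \<le> real Q"
  proof -
    have "real a \<le> 2 powr (real Q)" using assms(6) by (simp add: powr_realpow)
    then show ?thesis unfolding lg_def using assms by (subst log_le_iff) auto
  qed
  have "log 2 (real a1) \<le> log 2 (real a / 2)" using assms by (subst log_le_cancel_iff) auto
  then have 1: "log 2 (real a1) \<le> lg - 1"
    unfolding lg_def using assms by (subst (asm) log_divide) auto
  have 2: "log 2 (real a2) \<le> lg" unfolding lg_def using assms a2a by (subst log_le_cancel_iff) auto
  have lg0: "lg \<ge> 0" unfolding lg_def using assms by auto
  have "real a1 * log 2 (real a1) + real a2 * log 2 (real a2) \<le> real a1 * (lg - 1) + real a2 * lg"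
    using 1 2 by (intro add_mono mult_left_mono) auto
  also have "\<dots> = (real a1 + real a2) * lg - real a1" by (simp add: algebra_simps)
  also have "\<dots> \<le> (real a + real a1 / (2 * real Q)) * lg - real a1"
    using assms(5) lg0 by (simp add: mult_right_mono)
  also have "\<dots> \<le> real a * lg + real a1 / 2 - real a1"
  proof -
    have "real a1 / (2 * real Q) * lg \<le> real a1 / (2 * real Q) * real Q"
      using lg Q by (intro mult_left_mono) auto
    also have "\<dots> = real a1 / 2" using Q by simp
    finally show ?thesis by (simp add: algebra_simps)
  qed
  finally have *: "real a1 * log 2 (real a1) + real a2 * log 2 (real a2) \<le> real a * lg - real a1 / 2"
    by simp
  have "split_weight Q a1 + split_weight Q a2 = real a1 + real a2 +
      (real a1 * log 2 (real a1) + real a2 * log 2 (real a2)) / real Q"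
    unfolding split_weight_def using Q by (simp add: field_simps)
  also have "\<dots> \<le> real a + real a1 / (2 * real Q) + (real a * lg - real a1 / 2) / real Q"
    using * assms(5) Q by (intro add_mono[of "real a1 + real a2"] divide_right_mono) auto
  also have "\<dots> = split_weight Q a" unfolding split_weight_def lg_def using Q by (simp add: field_simps)
  finally show ?thesis .
qed

text \<open>By Bernoulli's inequality \<open>2 Q\<close> steps of fast growth double the value, so
  \<open>2 Q (Q + 1)\<close> of them would exceed the bound \<open>2 ^ Q\<close>.\<close>

lemma slow_growth:
  fixes f :: "nat \<Rightarrow> nat"
  assumes "1 \<le> f 0" "\<And>r. f r \<le> 2 ^ Q" "1 \<le> Q"
  shows "\<exists>r < 2 * Q * (Q + 1). real (f (Suc r)) \<le> (1 + 1 / (2 * real Q)) * real (f r)"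
proof (rule ccontr)
  let ?e = "1 + 1 / (2 * real Q)"
  assume *: "\<not> ?thesis"
  have "?e ^ r \<le> real (f r)" if "r \<le> 2 * Q * (Q + 1)" for r
    using that
  proof (induction r)
    case (Suc r)
    then have "?e * real (f r) \<le> real (f (Suc r))" using * by (auto simp: not_le intro: less_imp_le)
    moreover have "?e * ?e ^ r \<le> ?e * real (f r)" using Suc by (intro mult_left_mono) auto
    ultimately show ?case by simp
  qed (use assms in simp)
  then have "?e ^ (2 * Q * (Q + 1)) \<le> real (f (2 * Q * (Q + 1)))" by blast
  also have "\<dots> \<le> 2 ^ Q" using assms(2) by (metis of_nat_le_iff of_nat_numeral of_nat_power)
  finally have "(?e ^ (2 * Q)) ^ (Q + 1) \<le> 2 ^ Q" by (simp only: power_mult)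
  moreover have "2 \<le> ?e ^ (2 * Q)"
  proof -
    have "0 \<le> 1 / (2 * real Q)" by simp
    then have "- 1 \<le> 1 / (2 * real Q)" by linarith
    then have "1 + real (2 * Q) * (1 / (2 * real Q)) \<le> ?e ^ (2 * Q)" by (rule Bernoulli_inequality)
    moreover have "real (2 * Q) * (1 / (2 * real Q)) = 1" using assms(3) by simp
    ultimately show ?thesis by linarith
  qed
  then have "2 ^ (Q + 1) \<le> (?e ^ (2 * Q)) ^ (Q + 1)" by (intro power_mono) auto
  ultimately have "(2::real) ^ (Q + 1) \<le> 2 ^ Q" by linarith
  then show False by simp
qed

text \<open>Region growing, with the independence number measuring the size of a ball: the first ball
  that grows by a factor less than \<open>1 + 1 / (2Q)\<close> is separated from the rest.\<close>

lemma split_not_robust: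
  assumes "finite Z" "symp A" "irreflp A" "ind A Z \<le> 2 ^ Q" "1 \<le> Q"
    and not_robust: "\<not> robust A s (4 * Q * (Q + 1) + 2) Z"
  shows "\<exists>S T. S \<noteq> {} \<and> T \<noteq> {} \<and> S \<inter> T = {} \<and> S \<union> T \<subseteq> Z \<and> card (Z - (S \<union> T)) \<le> s \<and>
    split_weight Q (ind A S) + split_weight Q (ind A T) \<le> split_weight Q (ind A Z)"
proof -
  \<comment> \<open>Balls of radius \<open>m\<close> that meet or are adjacent would give a path
    with at most \<open>2 m + 2 = 4 Q (Q + 1) + 2\<close> vertices.\<close>
  define m where "m = 2 * Q * (Q + 1)"
  obtain U x y where U: "finite U" "card U \<le> s" and xy: "x \<in> Z - U" "y \<in> Z - U"
    and far: "\<And>xs. path_in A (Z - U) x xs y \<Longrightarrow> length xs > 2 * m + 2"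
    using not_robust unfolding robust_def m_def by (fastforce simp: not_le)
  define W where "W = Z - U"
  have fW: "finite W" and WZ: "W \<subseteq> Z" using assms unfolding W_def by auto
  let ?X = "reach A W x m" and ?Y = "reach A W y m"
  have xW: "x \<in> W" "y \<in> W" using xy W_def by auto
  have XY: "?X \<subseteq> W" "?Y \<subseteq> W" using reach_subset xW by metis+
  have no: False if u: "u \<in> ?X" and v: "v \<in> ?Y" and uv: "u = v \<or> A u v" for u v
  proof -
    obtain xs where xs: "path_in A W x xs u" "length xs \<le> m + 1" using reach_path xW u by metis
    obtain ys where ys: "path_in A W y ys v" "length ys \<le> m + 1" using reach_path xW v by metis
    have "\<exists>zs. path_in A W x zs y \<and> length zs \<le> length xs + length (rev ys)"
      using uv path_in_rev[OF assms(2) ys(1)] path_in_append_walk[OF xs(1)] path_in_concat_walk[OF xs(1)]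
      by blast
    then show False using far xs ys unfolding W_def by fastforce
  qed
  have "nonadj A ?X ?Y" "?X \<inter> ?Y = {}" using no unfolding nonadj_def by blast+
  then have sum: "ind A ?X + ind A ?Y \<le> ind A Z"
    using ind_add[of Z ?X ?Y A] assms XY WZ by auto
  \<comment> \<open>One of two disjoint non-adjacent balls has at most half of the independence
    number. It misses the other centre, which keeps the second part of the split non-empty.\<close>
  obtain z where z: "z \<in> W" "2 * ind A (reach A W z m) \<le> ind A Z" "W - reach A W z m \<noteq> {}"
  proof (cases "ind A ?X \<le> ind A ?Y")
    case True
    then show ?thesis using that[of x] sum xW no reach_self[of y A W m] by fastforce
  next
    case False
    then show ?thesis using that[of y] sum xW no reach_self[of x A W m] by fastforce
  qed
  define B where "B r = reach A W z r" for r
  have B_W: "B r \<subseteq> W" for r unfolding B_def using reach_subset z by metis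
  have fB: "finite (B r)" for r using B_W fW finite_subset by blast
  have "ind A (B r) \<le> 2 ^ Q" for r
    using ind_mono[of Z "B r" A] B_W WZ assms by (meson dual_order.trans)
  moreover have "1 \<le> ind A (B 0)" by (rule ind_pos) (use assms in \<open>auto simp: B_def\<close>)
  ultimately obtain r where r: "r < m"
    "real (ind A (B (Suc r))) \<le> (1 + 1 / (2 * real Q)) * real (ind A (B r))"
    using slow_growth[of "\<lambda>r. ind A (B r)" Q] assms(5) unfolding m_def by auto
  \<comment> \<open>\<open>?S\<close> and \<open>?T\<close> may be adjacent; only \<open>B r\<close>
    is separated from \<open>?T\<close>. By slow growth \<open>ind A ?S\<close> exceeds
    \<open>ind A (B r)\<close> by no more than the potential absorbs.\<close>
  let ?S = "B (Suc r)" and ?T = "W - B (Suc r)"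
  have "B (Suc r) \<subseteq> reach A W z m" unfolding B_def using reach_mono r(1) by (metis Suc_leI)
  then have T: "?T \<noteq> {}" using z(3) by auto
  have S: "?S \<noteq> {}" using reach_self unfolding B_def by fastforce
  have half: "2 * ind A ?S \<le> ind A Z"
    using z(2) ind_mono[of "reach A W z m" ?S A] \<open>B (Suc r) \<subseteq> reach A W z m\<close> fB[of m] unfolding B_def by simp
  have "nonadj A (B r) ?T" unfolding nonadj_def B_def by auto
  moreover have "B r \<inter> ?T = {}" unfolding B_def by auto
  ultimately have "ind A (B r) + ind A ?T \<le> ind A Z"
    using ind_add[of Z "B r" ?T A] B_W WZ assms by auto
  then have 1: "real (ind A (B r)) + real (ind A ?T) \<le> real (ind A Z)" by linarith
  have "real (ind A (B r)) \<le> real (ind A ?S)"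
    using ind_mono[OF fB[of "Suc r"], of "B r" A] reach_mono[of r "Suc r" A W z]
    unfolding B_def by (simp del: reach.simps)
  then have 2: "real (ind A (B r)) / (2 * real Q) \<le> real (ind A ?S) / (2 * real Q)"
    by (intro divide_right_mono) auto
  have le: "real (ind A ?S) + real (ind A ?T) \<le> real (ind A Z) + real (ind A ?S) / (2 * real Q)"
    using r(2) 1 2 unfolding distrib_right by simp
  have "split_weight Q (ind A ?S) + split_weight Q (ind A ?T) \<le> split_weight Q (ind A Z)"
  proof (rule split_weight_superadd[OF _ _ half \<open>1 \<le> Q\<close> le assms(4)])
    show "1 \<le> ind A ?S" by (rule ind_pos[OF fB S assms(3)])
    show "1 \<le> ind A ?T" by (rule ind_pos[OF _ T assms(3)]) (use fW in simp)
  qed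
  moreover have "card (Z - (?S \<union> ?T)) \<le> s"
  proof -
    have "Z - (?S \<union> ?T) \<subseteq> U" using W_def by auto
    then show ?thesis using card_mono U by (meson order_trans)
  qed
  moreover have "?S \<union> ?T \<subseteq> Z" using B_W WZ by blast
  ultimately show ?thesis using S T by (intro exI[of _ ?S] exI[of _ ?T] conjI) (assumption | rule Diff_disjoint)+
qed

section \<open>Two-level partitions\<close>

text \<open>Vertex connectivity in terms of cuts. It puts no lower bound on the size of
  \<open>P\<close>; sizes come from the minimum degree.\<close>

definition unsplittable :: "('a \<Rightarrow> 'a \<Rightarrow> bool) \<Rightarrow> nat \<Rightarrow> 'a set \<Rightarrow> bool" where
  "unsplittable A T P \<longleftrightarrow> (\<forall>U X Y. finite U \<and> card U < T \<and> X \<noteq> {} \<and> Y \<noteq> {} \<and> X \<inter> Y = {} \<and>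
     X \<union> Y = P - U \<longrightarrow> \<not> nonadj A X Y)"

lemma unsplittableD:
  assumes "unsplittable A T P" "finite U" "card U < T" "X \<noteq> {}" "Y \<noteq> {}" "X \<inter> Y = {}" "X \<union> Y = P - U"
  shows "\<not> nonadj A X Y"
  using assms unfolding unsplittable_def by simp

text \<open>One refinement step of either decomposition below; the vertices of \<open>P\<close>
  outside \<open>X\<close> and \<open>Y\<close> are those given up by the split.\<close>

lemma split_family:
  assumes "finite F" "disjoint F" "{} \<notin> F" "P \<in> F" "X \<noteq> {}" "Y \<noteq> {}" "X \<inter> Y = {}" "X \<union> Y \<subseteq> P"
  defines "F' \<equiv> insert X (insert Y (F - {P}))"
  shows "finite F'" "disjoint F'" "{} \<notin> F'" "card F' = card F + 1"
    "\<Union>F' = (\<Union>F - P) \<union> X \<union> Y"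
proof -
  have dj: "S \<inter> P = {}" if "S \<in> F - {P}" for S
    using assms(2,4) that unfolding disjoint_def by auto
  show "finite F'" "{} \<notin> F'" using assms by auto
  show "disjoint F'"
    unfolding disjoint_def
  proof (intro ballI impI)
    fix S S' assume S: "S \<in> F'" "S' \<in> F'" "S \<noteq> S'"
    have "S \<inter> S' = {}" if "S \<in> F - {P}" "S' \<in> F - {P}"
      using that S assms(2) unfolding disjoint_def by auto
    moreover have "S \<inter> S' = {}" if "S \<in> F - {P}" "S' = X \<or> S' = Y" using that dj assms(8) by auto
    moreover have "S \<inter> S' = {}" if "S' \<in> F - {P}" "S = X \<or> S = Y" using that dj assms(8) by auto
    ultimately show "S \<inter> S' = {}" using S assms(7) unfolding F'_def by auto
  qed
  have "X \<notin> F - {P}" using dj[of X] assms(5,8) by blast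
  moreover have "Y \<notin> F - {P}" using dj[of Y] assms(6,8) by blast
  moreover have "X \<noteq> Y" using assms(5,7) by blast
  moreover have "card (F - {P}) + 1 = card F"
    using assms(1,4) by (metis Suc_eq_plus1 card_Suc_Diff1)
  ultimately show "card F' = card F + 1" unfolding F'_def using assms(1) by simp
  show "\<Union>F' = (\<Union>F - P) \<union> X \<union> Y" unfolding F'_def using dj by auto
qed

text \<open>A family with the most members cannot be split further. Independence numbers add up over
  mutually non-adjacent sets and are at least 1, which bounds the number of members by
  \<open>a\<close>; every split gives up fewer than \<open>T\<close> vertices.\<close>

lemma coarse_decomposition:
  assumes "finite V" "V \<noteq> {}" "symp A" "irreflp A" "ind A V \<le> a"
  obtains F where "finite F" "disjoint F" "{} \<notin> F" "\<Union>F \<subseteq> V"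
    "\<And>P P'. P \<in> F \<Longrightarrow> P' \<in> F \<Longrightarrow> P \<noteq> P' \<Longrightarrow> nonadj A P P'"
    "(\<Sum>P\<in>F. ind A P) \<le> a" "card F \<le> a" "card (V - \<Union>F) \<le> a * T" "\<And>P. P \<in> F \<Longrightarrow> unsplittable A T P"
proof -
  define ok where "ok F \<longleftrightarrow> finite F \<and> disjoint F \<and> {} \<notin> F \<and> \<Union>F \<subseteq> V \<and>
    (\<forall>P\<in>F. \<forall>P'\<in>F. P \<noteq> P' \<longrightarrow> nonadj A P P') \<and> card (V - \<Union>F) \<le> card F * T" for F
  have ind: "(\<Sum>P\<in>F. ind A P) \<le> a \<and> card F \<le> a" if "ok F" for F
  proof -
    have fin: "finite F" "\<And>P. P \<in> F \<Longrightarrow> finite P"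
      using that assms(1) unfolding ok_def by (auto intro: finite_subset)
    have "(\<Sum>P\<in>F. ind A P) \<le> ind A (\<Union>F)"
      by (rule ind_sum) (use that fin assms in \<open>auto simp: ok_def disjoint_def\<close>)
    also have "\<dots> \<le> ind A V" by (rule ind_mono) (use that assms in \<open>auto simp: ok_def\<close>)
    finally have 1: "(\<Sum>P\<in>F. ind A P) \<le> a" using assms by simp
    have "1 \<le> ind A P" if "P \<in> F" for P
      by (rule ind_pos) (use that \<open>ok F\<close> fin assms in \<open>auto simp: ok_def\<close>)
    then have "(\<Sum>P\<in>F. 1) \<le> (\<Sum>P\<in>F. ind A P)" by (intro sum_mono) auto
    then show ?thesis using 1 by simp
  qed
  have "ok {V}" using assms by (auto simp: ok_def)
  then obtain F where F: "ok F" and max: "\<And>F'. ok F' \<Longrightarrow> card F' \<le> card F"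
    using ex_has_greatest_nat[of ok "{V}" card "a + 1"] ind by (force simp: less_Suc_eq_le)
  have "unsplittable A T P" if P: "P \<in> F" for P
  proof (rule ccontr)
    assume "\<not> unsplittable A T P"
    then obtain U X Y where U: "finite U" "card U < T" and XY: "X \<noteq> {}" "Y \<noteq> {}" "X \<inter> Y = {}"
      "X \<union> Y = P - U" "nonadj A X Y"
      unfolding unsplittable_def by blast
    define F' where "F' = insert X (insert Y (F - {P}))"
    have sub: "X \<union> Y \<subseteq> P" using XY by auto
    have F0: "finite F" "disjoint F" "{} \<notin> F" using F unfolding ok_def by auto
    note sf = split_family[OF F0 P XY(1-3) sub, folded F'_def]
    have nadjF: "nonadj A S S'" if "S \<in> F" "S' \<in> F" "S \<noteq> S'" for S S'
      using that F unfolding ok_def by auto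
    have sub_nonadj: "nonadj A S' R'" if "nonadj A S R" "S' \<subseteq> S" "R' \<subseteq> R" for S R S' R'
      using that unfolding nonadj_def by blast
    have YX: "nonadj A Y X" using XY(5) assms(3) unfolding nonadj_def symp_def by blast
    have "nonadj A S S'" if "S \<in> F'" "S' \<in> F'" "S \<noteq> S'" for S S'
    proof -
      have "nonadj A S S'" if "S \<in> F - {P}" "S' = X \<or> S' = Y"
        by (rule sub_nonadj[of S P]) (use that nadjF P sub in auto)
      moreover have "nonadj A S S'" if "S' \<in> F - {P}" "S = X \<or> S = Y"
        by (rule sub_nonadj[of P S']) (use that nadjF P sub in auto)
      ultimately show ?thesis using that XY(5) YX nadjF unfolding F'_def by auto
    qed
    moreover have "card (V - \<Union>F') \<le> card F' * T"
    proof -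
      have "P \<subseteq> \<Union>F" using P by auto
      then have "V - \<Union>F' \<subseteq> (V - \<Union>F) \<union> U" using sf(5) XY(4) by auto
      then have "card (V - \<Union>F') \<le> card (V - \<Union>F) + card U"
        using card_mono[of "(V - \<Union>F) \<union> U"] card_Un_le[of "V - \<Union>F" U] assms(1) U(1)
        by (meson finite_Diff finite_UnI le_trans)
      also have "\<dots> \<le> card F * T + T" using F U unfolding ok_def by auto
      finally show ?thesis using sf(4) by simp
    qed
    moreover have "\<Union>F' \<subseteq> V"
    proof -
      have "\<Union>F \<subseteq> V" "P \<subseteq> \<Union>F" using F P unfolding ok_def by auto
      then show ?thesis using sub unfolding sf(5) by blast
    qed
    ultimately have "ok F'" unfolding ok_def using sf(1-3) by (intro conjI ballI impI) auto
    then show False using max sf(4) by fastforce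
  qed
  moreover have "card (V - \<Union>F) \<le> a * T"
    using F ind[OF F] unfolding ok_def by (meson le_trans mult_le_mono1)
  ultimately show ?thesis using F ind[OF F] unfolding ok_def by (intro that[of F]) auto
qed

lemma split_weight_le:
  assumes "x \<le> 2 ^ Q" "1 \<le> Q" shows "split_weight Q x \<le> 2 * real x"
proof (cases "x = 0")
  case False
  have "real x \<le> 2 powr (real Q)" using assms by (simp add: powr_realpow)
  then have "log 2 (real x) \<le> real Q" using False by (subst log_le_iff) auto
  then have "1 + log 2 (real x) / real Q \<le> 2" using assms by (simp add: field_simps)
  then show ?thesis unfolding split_weight_def by (subst mult.commute[of 2]) (rule mult_left_mono, auto)
qed (simp add: split_weight_def)

lemma split_weight_ge:
  assumes "1 \<le> x" shows "1 \<le> split_weight Q x"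
proof -
  have "1 + log 2 (real x) / real Q \<ge> 1" using assms by auto
  then show ?thesis unfolding split_weight_def using assms mult_mono[of 1 "real x" 1] by simp
qed

text \<open>Again a largest admissible family is taken. Its members may be adjacent, so the total
  \<open>split_weight\<close> replaces the sum of independence numbers: it is at most
  \<open>2 a\<close> at the start, never grows, and every member contributes at least 1.\<close>

lemma fine_decomposition:
  assumes "finite F" "disjoint F" "{} \<notin> F" "\<And>P. P \<in> F \<Longrightarrow> finite P" "symp A" "irreflp A"
    "(\<Sum>P\<in>F. ind A P) \<le> a" "a \<le> 2 ^ Q" "1 \<le> Q"
  obtains Z where "finite Z" "disjoint Z" "{} \<notin> Z" "\<And>z. z \<in> Z \<Longrightarrow> \<exists>P\<in>F. z \<subseteq> P" "card Z \<le> 2 * a"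
    "card (\<Union>F - \<Union>Z) \<le> 2 * a * s" "\<And>z. z \<in> Z \<Longrightarrow> robust A s (4 * Q * (Q + 1) + 2) z"
proof -
  define ok where "ok Z \<longleftrightarrow> finite Z \<and> disjoint Z \<and> {} \<notin> Z \<and> (\<forall>z\<in>Z. \<exists>P\<in>F. z \<subseteq> P) \<and>
    (\<Sum>z\<in>Z. split_weight Q (ind A z)) \<le> 2 * real a \<and> card (\<Union>F - \<Union>Z) \<le> card Z * s" for Z
  have indF: "ind A P \<le> 2 ^ Q" if "P \<in> F" for P
  proof -
    have "ind A P \<le> (\<Sum>P\<in>F. ind A P)" using that assms(1) by (intro member_le_sum) auto
    then show ?thesis using assms by linarith
  qed
  have "(\<Sum>P\<in>F. split_weight Q (ind A P)) \<le> (\<Sum>P\<in>F. 2 * real (ind A P))"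
    by (intro sum_mono split_weight_le indF assms)
  also have "\<dots> = 2 * real (\<Sum>P\<in>F. ind A P)" by (simp add: sum_distrib_left)
  also have "\<dots> \<le> 2 * real a" using assms(7) by (simp del: of_nat_sum)
  finally have "ok F" unfolding ok_def using assms by auto
  have card: "card Z \<le> 2 * a" if "ok Z" for Z
  proof -
    have "1 \<le> split_weight Q (ind A z)" if "z \<in> Z" for z
    proof (intro split_weight_ge ind_pos)
      show "finite z" using that \<open>ok Z\<close> assms(4) unfolding ok_def by (meson finite_subset)
    qed (use that \<open>ok Z\<close> assms in \<open>auto simp: ok_def\<close>)
    then have "(\<Sum>z\<in>Z. 1) \<le> (\<Sum>z\<in>Z. split_weight Q (ind A z))" by (intro sum_mono) auto
    then show ?thesis using that unfolding ok_def by simp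
  qed
  then obtain Z where Z: "ok Z" and max: "\<And>Z'. ok Z' \<Longrightarrow> card Z' \<le> card Z"
    using ex_has_greatest_nat[of ok F card "2 * a + 1"] \<open>ok F\<close> by (force simp: less_Suc_eq_le)
  have "robust A s (4 * Q * (Q + 1) + 2) z" if z: "z \<in> Z" for z
  proof (rule ccontr)
    assume nr: "\<not> robust A s (4 * Q * (Q + 1) + 2) z"
    obtain P where P: "P \<in> F" "z \<subseteq> P" using Z z unfolding ok_def by auto
    have fz: "finite z" using P assms(4) finite_subset by blast
    have "ind A z \<le> 2 ^ Q" using ind_mono[of P z A] indF[OF P(1)] P assms(4) by (meson le_trans)
    then obtain X Y where XY: "X \<noteq> {}" "Y \<noteq> {}" "X \<inter> Y = {}" "X \<union> Y \<subseteq> z"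
      "card (z - (X \<union> Y)) \<le> s"
      "split_weight Q (ind A X) + split_weight Q (ind A Y) \<le> split_weight Q (ind A z)"
      using split_not_robust[OF fz assms(5,6) _ assms(9) nr] by blast
    define Z' where "Z' = insert X (insert Y (Z - {z}))"
    have Z0: "finite Z" "disjoint Z" "{} \<notin> Z" using Z unfolding ok_def by auto
    note sf = split_family[OF Z0 z XY(1-4), folded Z'_def]
    have dj: "S \<inter> z = {}" if "S \<in> Z - {z}" for S
      using Z0(2) z that unfolding disjoint_def by auto
    have "X \<notin> Z - {z}" using dj[of X] XY(1,4) by blast
    moreover have "Y \<notin> Z - {z}" using dj[of Y] XY(2,4) by blast
    moreover have "X \<noteq> Y" using XY(1,3) by blast
    ultimately have "(\<Sum>z\<in>Z'. split_weight Q (ind A z)) = split_weight Q (ind A X) + split_weight Q (ind A Y)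
        + (\<Sum>z\<in>Z - {z}. split_weight Q (ind A z))"
      unfolding Z'_def using Z0(1) by simp
    also have "\<dots> \<le> split_weight Q (ind A z) + (\<Sum>z\<in>Z - {z}. split_weight Q (ind A z))"
      using XY(6) by simp
    also have "\<dots> = (\<Sum>z\<in>Z. split_weight Q (ind A z))" using Z0(1) z by (simp add: sum.remove)
    finally have "(\<Sum>z\<in>Z'. split_weight Q (ind A z)) \<le> 2 * real a" using Z unfolding ok_def by simp
    moreover have "card (\<Union>F - \<Union>Z') \<le> card Z' * s"
    proof -
      have "\<Union>F - \<Union>Z' \<subseteq> (\<Union>F - \<Union>Z) \<union> (z - (X \<union> Y))" using sf(5) by auto
      moreover have "finite (\<Union>F)" using assms by auto
      ultimately have "card (\<Union>F - \<Union>Z') \<le> card (\<Union>F - \<Union>Z) + card (z - (X \<union> Y))"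
        using card_mono[of "(\<Union>F - \<Union>Z) \<union> (z - (X \<union> Y))"] card_Un_le[of "\<Union>F - \<Union>Z" "z - (X \<union> Y)"] fz
        by (meson finite_Diff finite_UnI le_trans)
      also have "\<dots> \<le> card Z * s + s" using Z XY(5) unfolding ok_def by auto
      finally show ?thesis using sf(4) by simp
    qed
    moreover have "\<forall>w\<in>Z'. \<exists>P\<in>F. w \<subseteq> P" using Z P XY(4) unfolding Z'_def ok_def by auto
    ultimately have "ok Z'" unfolding ok_def using sf(1-3) by (intro conjI) auto
    then show False using max sf(4) by fastforce
  qed
  moreover have "card (\<Union>F - \<Union>Z) \<le> 2 * a * s"
    using Z card[OF Z] unfolding ok_def by (meson le_trans mult_le_mono1)
  ultimately show ?thesis using Z card[OF Z] unfolding ok_def by (intro that[of Z]) auto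
qed

section \<open>Reattaching the vertices given up\<close>

lemma many_not_in:
  assumes "finite U" "card U < card S" shows "\<exists>x\<in>S. x \<notin> U"
  using assms by (metis card_mono leD subsetI)

text \<open>A new vertex keeps a neighbour in \<open>Z\<close> when \<open>s\<close> vertices are
  deleted, and a path inside \<open>Z\<close> takes over from there; one more vertex at either end
  accounts for \<open>l + 2\<close>.\<close>

lemma robust_attach:
  assumes "robust A s l Z" "Z \<subseteq> Z'" "symp A"
    and nbrs: "\<And>v. v \<in> Z' - Z \<Longrightarrow> s < card {u \<in> Z. A v u}"
  shows "robust A s (l + 2) Z'"
  unfolding robust_def
proof (intro allI impI, elim conjE)
  fix U x y assume U: "finite U" "card U \<le> s" and xy: "x \<in> Z' - U" "y \<in> Z' - U"
  have enter: "\<exists>w pre. w \<in> Z - U \<and> successively A (pre @ [w]) \<and> length pre \<le> 1 \<and> set pre \<subseteq> Z' - U \<and>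
      hd (pre @ [w]) = v" if v: "v \<in> Z' - U" for v
  proof (cases "v \<in> Z")
    case True
    then show ?thesis using v by (intro exI[of _ v] exI[of _ "[]"]) auto
  next
    case False
    then have "card U < card {u \<in> Z. A v u}" using nbrs U v by (meson DiffD1 DiffI le_less_trans)
    then obtain w where "w \<in> Z" "A v w" "w \<notin> U" using many_not_in[OF U(1)] by blast
    then show ?thesis using v by (intro exI[of _ w] exI[of _ "[v]"]) auto
  qed
  obtain x' px where x': "x' \<in> Z - U" "successively A (px @ [x'])" "length px \<le> 1" "set px \<subseteq> Z' - U"
    "hd (px @ [x']) = x" using enter xy(1) by blast
  obtain y' py where y': "y' \<in> Z - U" "successively A (py @ [y'])" "length py \<le> 1" "set py \<subseteq> Z' - U"
    "hd (py @ [y']) = y" using enter xy(2) by blast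
  obtain xs where xs: "path_in A (Z - U) x' xs y'" "length xs \<le> l"
    using assms(1) U x'(1) y'(1) unfolding robust_def by blast
  have "successively (\<lambda>x y. A y x) (py @ [y'])"
    by (rule successively_mono[of A]) (use y'(2) assms(3) in \<open>auto simp: symp_def\<close>)
  then have "successively A (rev (py @ [y']))" by (simp only: successively_rev)
  then have sy: "successively A (y' # rev py)" by simp
  let ?ws = "px @ xs @ rev py"
  have "xs \<noteq> []" "hd xs = x'" "last xs = y'" "successively A xs" using xs(1) unfolding path_in_def by auto
  then have "successively A ?ws" using x'(2) sy
    by (auto simp: successively_append_iff successively_Cons)
  moreover have "set ?ws \<subseteq> Z' - U" using x' y' xs assms(2) unfolding path_in_def by auto
  moreover have "hd ?ws = x" using x'(5) xs(1) unfolding path_in_def by (cases px) auto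
  moreover have "last ?ws = y" using y'(5) xs(1) unfolding path_in_def by (cases py) auto
  moreover have "length ?ws \<le> l + 2" using x' y' xs by simp
  moreover have "?ws \<noteq> []" using xs(1) unfolding path_in_def by simp
  ultimately obtain zs where "path_in A (Z' - U) x zs y" "length zs \<le> length ?ws"
    using path_in_of_walk[of ?ws A "Z' - U"] by auto
  then show "\<exists>xs. path_in A (Z' - U) x xs y \<and> length xs \<le> l + 2"
    using \<open>length ?ws \<le> l + 2\<close> le_trans by blast
qed

text \<open>A side of an edgeless cut that contains a new vertex also contains a surviving neighbour
  of it in \<open>P\<close>. Both sides therefore meet \<open>P\<close>, and the cut would split
  \<open>P\<close> itself.\<close>

lemma unsplittable_attach:
  assumes "unsplittable A T P" "P \<subseteq> P'" "symp A"
    and nbrs: "\<And>v. v \<in> P' - P \<Longrightarrow> T \<le> card {u \<in> P. A v u}"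
  shows "unsplittable A T P'"
  unfolding unsplittable_def
proof (intro allI impI notI, elim conjE)
  fix U X Y assume U: "finite U" "card U < T" and ne: "X \<noteq> {}" "Y \<noteq> {}" and d: "X \<inter> Y = {}"
    and XY: "X \<union> Y = P' - U" and n: "nonadj A X Y"
  have meets: "R \<inter> P \<noteq> {}" if R: "R \<noteq> {}" "R \<subseteq> P' - U"
    and n: "\<And>u v. u \<in> R \<Longrightarrow> v \<in> P' - U - R \<Longrightarrow> \<not> A u v" for R
  proof
    assume e: "R \<inter> P = {}"
    obtain r where r: "r \<in> R" using R by blast
    then have "r \<in> P' - P" using e R by auto
    then have "card U < card {u \<in> P. A r u}" using nbrs U by (meson less_le_trans)
    then obtain u where "u \<in> P" "A r u" "u \<notin> U" using many_not_in[OF U(1)] by blast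
    then show False using n[OF r, of u] e assms(2) by auto
  qed
  have "X \<inter> P \<noteq> {}"
  proof (rule meets)
    show "\<not> A u v" if "u \<in> X" "v \<in> P' - U - X" for u v
    proof -
      have "v \<in> Y" using that XY by blast
      then show ?thesis using that(1) n unfolding nonadj_def by blast
    qed
  qed (use ne XY in auto)
  moreover have "Y \<inter> P \<noteq> {}"
  proof (rule meets)
    show "\<not> A u v" if "u \<in> Y" "v \<in> P' - U - Y" for u v
    proof -
      have "v \<in> X" using that XY by blast
      then show ?thesis using that(1) n assms(3) unfolding nonadj_def symp_def by blast
    qed
  qed (use ne XY in auto)
  moreover have "nonadj A (X \<inter> P) (Y \<inter> P)" using n unfolding nonadj_def by auto
  moreover have "(X \<inter> P) \<union> (Y \<inter> P) = P - U" using XY assms(2) by blast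
  moreover have "(X \<inter> P) \<inter> (Y \<inter> P) = {}" using d by blast
  ultimately show False
    using unsplittableD[OF assms(1) U, of "X \<inter> P" "Y \<inter> P"] by simp
qed

lemma card_Union_le_mult:
  assumes "finite F" "\<And>S. S \<in> F \<Longrightarrow> card S \<le> m" shows "card (\<Union>F) \<le> card F * m"
proof -
  have "card (\<Union>F) \<le> (\<Sum>S\<in>F. card S)" by (rule card_Union_le_sum_card)
  also have "\<dots> \<le> (\<Sum>S\<in>F. m)" using assms by (intro sum_mono) auto
  finally show ?thesis by simp
qed

text \<open>\<open>c\<close> sends a vertex to its fine class, named by the core in
  \<open>Z'\<close> around which it is built, and \<open>g\<close> sends a core to its coarse piece.
  The bound on \<open>dl\<close> makes the vertices outside the cores at most \<open>dl / 2\<close>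
  in number, so every vertex has \<open>s + T + 1\<close> neighbours in one of the at most
  \<open>2 a\<close> cores.\<close>

theorem two_level_partition:
  assumes "finite V" "V \<noteq> {}" "symp A" "irreflp A" "ind A V \<le> a" "a \<le> 2 ^ Q" "1 \<le> Q"
    and deg: "\<And>v. v \<in> V \<Longrightarrow> dl \<le> card {u \<in> V. A v u}"
    and dl: "20 * a * (s + T + 1) \<le> dl"
  obtains c :: "'a \<Rightarrow> 'a set" and g :: "'a set \<Rightarrow> 'a set" where
    "card (c ` V) \<le> 2 * a" "card (g ` c ` V) \<le> a"
    "\<And>k. k \<in> c ` V \<Longrightarrow> robust A s (4 * Q * (Q + 1) + 4) {v \<in> V. c v = k}"
    "\<And>k. k \<in> c ` V \<Longrightarrow> s + 2 \<le> card {v \<in> V. c v = k}"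
    "\<And>j. j \<in> g ` c ` V \<Longrightarrow> unsplittable A T {v \<in> V. g (c v) = j}"
    "\<And>j. j \<in> g ` c ` V \<Longrightarrow> dl \<le> 2 * card {v \<in> V. g (c v) = j}"
proof -
  have a1: "1 \<le> a" using ind_pos[OF assms(1,2,4)] assms(5) by linarith
  obtain F where F: "finite F" "disjoint F" "{} \<notin> F" "\<Union>F \<subseteq> V"
    "\<And>P P'. P \<in> F \<Longrightarrow> P' \<in> F \<Longrightarrow> P \<noteq> P' \<Longrightarrow> nonadj A P P'"
    "(\<Sum>P\<in>F. ind A P) \<le> a" "card F \<le> a" "card (V - \<Union>F) \<le> a * T" "\<And>P. P \<in> F \<Longrightarrow> unsplittable A T P"
    using coarse_decomposition[OF assms(1-5)] by blast
  have fP: "finite P" if "P \<in> F" for P using that F(4) assms(1) by (meson Sup_upper finite_subset)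
  obtain Z where Z: "finite Z" "disjoint Z" "{} \<notin> Z" "\<And>z. z \<in> Z \<Longrightarrow> \<exists>P\<in>F. z \<subseteq> P" "card Z \<le> 2 * a"
    "card (\<Union>F - \<Union>Z) \<le> 2 * a * s" "\<And>z. z \<in> Z \<Longrightarrow> robust A s (4 * Q * (Q + 1) + 2) z"
    using fine_decomposition[OF F(1-3) fP assms(3,4) F(6) assms(6,7)] by metis
  \<comment> \<open>Cores with at most \<open>s + 1\<close> vertices are dissolved, because later
    arguments look for class vertices outside sets of up to \<open>s + 1\<close> vertices.\<close>
  define Z' where "Z' = {z \<in> Z. s + 1 < card z}"
  define W where "W = V - \<Union>Z'"
  define D where "D = s + T + 1"
  have fz: "finite z" "z \<subseteq> V" if "z \<in> Z" for z
    using Z(4)[OF that] fP F(4) by (auto intro: finite_subset)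
  have "W \<subseteq> (V - \<Union>F) \<union> ((\<Union>F - \<Union>Z) \<union> \<Union>(Z - Z'))" unfolding W_def by auto
  then have "card W \<le> card ((V - \<Union>F) \<union> ((\<Union>F - \<Union>Z) \<union> \<Union>(Z - Z')))"
    by (rule card_mono[rotated]) (use assms(1) F(1) fP Z(1) fz in auto)
  also have "\<dots> \<le> card (V - \<Union>F) + (card (\<Union>F - \<Union>Z) + card (\<Union>(Z - Z')))"
    by (meson add_left_mono card_Un_le le_trans)
  also have "card (\<Union>(Z - Z')) \<le> card (Z - Z') * (s + 1)"
    by (rule card_Union_le_mult) (use Z(1) in \<open>auto simp: Z'_def\<close>)
  also have "card (Z - Z') * (s + 1) \<le> 2 * a * (s + 1)"
    by (intro mult_le_mono1) (meson Diff_subset Z(1,5) card_mono le_trans)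
  finally have "card W \<le> a * T + (2 * a * s + 2 * a * (s + 1))" using F(8) Z(6) by linarith
  also have "2 * \<dots> \<le> dl" using dl by (simp add: algebra_simps)
  finally have W: "2 * card W \<le> dl" by simp
  have fW: "finite W" unfolding W_def using assms(1) by simp
  have pick: "\<exists>z\<in>Z'. D \<le> card {u \<in> z. A v u}" if v: "v \<in> V" for v
  proof (rule ccontr)
    assume "\<not> ?thesis"
    then have small: "card {u \<in> z. A v u} \<le> D" if "z \<in> Z'" for z using that by (meson linear)
    have "{u \<in> V. A v u} \<subseteq> W \<union> \<Union>((\<lambda>z. {u \<in> z. A v u}) ` Z')" unfolding W_def by auto
    then have "card {u \<in> V. A v u} \<le> card (W \<union> \<Union>((\<lambda>z. {u \<in> z. A v u}) ` Z'))"
      by (rule card_mono[rotated]) (use fW Z(1) fz in \<open>auto simp: Z'_def\<close>)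
    also have "\<dots> \<le> card W + card (\<Union>((\<lambda>z. {u \<in> z. A v u}) ` Z'))" by (rule card_Un_le)
    also have "card (\<Union>((\<lambda>z. {u \<in> z. A v u}) ` Z')) \<le> card ((\<lambda>z. {u \<in> z. A v u}) ` Z') * D"
      by (rule card_Union_le_mult) (use Z(1) small in \<open>auto simp: Z'_def\<close>)
    also have "\<dots> \<le> 2 * a * D"
    proof (intro mult_le_mono1)
      have "card ((\<lambda>z. {u \<in> z. A v u}) ` Z') \<le> card Z'" by (rule card_image_le) (use Z(1) Z'_def in auto)
      also have "\<dots> \<le> card Z" by (rule card_mono) (use Z(1) Z'_def in auto)
      finally show "card ((\<lambda>z. {u \<in> z. A v u}) ` Z') \<le> 2 * a" using Z(5) by simp
    qed
    finally have "2 * dl \<le> 2 * card W + 4 * (a * D)" using deg[OF v] by simp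
    moreover have "20 * (a * D) \<le> dl" using dl unfolding D_def by (simp only: mult.assoc)
    moreover have "a * D \<ge> 1" using a1 unfolding D_def by simp
    ultimately show False using W by linarith
  qed
  define c where "c v = (if v \<in> \<Union>Z' then SOME z. z \<in> Z' \<and> v \<in> z
      else SOME z. z \<in> Z' \<and> D \<le> card {u \<in> z. A v u})" for v
  define g where "g z = (SOME P. P \<in> F \<and> z \<subseteq> P)" for z
  have c_in: "c v \<in> Z'" "v \<in> c v" if "v \<in> \<Union>Z'" for v
    using that someI_ex[of "\<lambda>z. z \<in> Z' \<and> v \<in> z"] unfolding c_def by auto
  have c_out: "c v \<in> Z'" "D \<le> card {u \<in> c v. A v u}" if "v \<in> V" "v \<notin> \<Union>Z'" for v
    using that someI_ex[of "\<lambda>z. z \<in> Z' \<and> D \<le> card {u \<in> z. A v u}"] pick[OF that(1)]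
    unfolding c_def by auto
  have cZ': "c v \<in> Z'" if "v \<in> V" for v using that c_in c_out by (cases "v \<in> \<Union>Z'") auto
  have Z'Z: "Z' \<subseteq> Z" unfolding Z'_def by auto
  have c_eq: "c v = z" if "z \<in> Z'" "v \<in> z" for v z
  proof -
    have "v \<in> \<Union>Z'" using that by auto
    then have "c v \<in> Z" "v \<in> c v" using c_in[of v] Z'Z by auto
    moreover have "z \<in> Z" using that Z'Z by auto
    ultimately show ?thesis using Z(2) that(2) unfolding disjoint_def by blast
  qed
  have g: "g z \<in> F" "z \<subseteq> g z" if "z \<in> Z'" for z
    using Z(4)[of z] that someI_ex[of "\<lambda>P. P \<in> F \<and> z \<subseteq> P"] unfolding g_def Z'_def by blast+
  have dF: "P = P'" if "P \<in> F" "P' \<in> F" "x \<in> P" "x \<in> P'" for P P' x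
    using F(2) that unfolding disjoint_def by blast
  \<comment> \<open>A reattached vertex of a coarse piece returns to the same piece since it has no
    neighbours in other pieces. Only vertices outside all pieces can end up anywhere.\<close>
  have gP: "g (c v) = P" if v: "v \<in> P" "P \<in> F" for v P
  proof (cases "v \<in> \<Union>Z'")
    case True
    then show ?thesis using c_in[OF True] g[of "c v"] dF v by blast
  next
    case False
    have vV: "v \<in> V" using v F(4) by auto
    have "0 < card {u \<in> c v. A v u}" using c_out[OF vV False] unfolding D_def by linarith
    then obtain u where u: "u \<in> c v" "A v u" by (metis (mono_tags, lifting) card_gt_0_iff ex_in_conv mem_Collect_eq)
    have "u \<in> g (c v)" "g (c v) \<in> F" using g[OF cZ'[OF vV]] u by auto
    then show ?thesis using F(5)[OF v(2), of "g (c v)"] v(1) u(2) unfolding nonadj_def by blast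
  qed
  have clsZ: "k \<subseteq> {v \<in> V. c v = k}" if "k \<in> Z'" for k
    using that c_eq fz Z'Z by blast
  have img: "c ` V \<subseteq> Z'" using cZ' by auto
  have gimg: "g ` c ` V \<subseteq> F" using img g by auto
  show ?thesis
  proof (rule that[of c g])
    show "card (c ` V) \<le> 2 * a"
      using img Z'Z Z(1,5) by (meson card_mono le_trans subset_trans)
    show "card (g ` c ` V) \<le> a" using gimg F(1,7) by (meson card_mono le_trans)
    fix k assume k: "k \<in> c ` V"
    then have kZ: "k \<in> Z'" "k \<in> Z" using img Z'Z by auto
    have "robust A s (4 * Q * (Q + 1) + 2 + 2) {v \<in> V. c v = k}"
    proof (rule robust_attach[OF Z(7)[OF kZ(2)] clsZ[OF kZ(1)] assms(3)])
      fix v assume v: "v \<in> {v \<in> V. c v = k} - k"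
      then have "v \<notin> \<Union>Z'" using c_in by auto
      then show "s < card {u \<in> k. A v u}" using c_out[of v] v unfolding D_def by auto
    qed
    then show "robust A s (4 * Q * (Q + 1) + 4) {v \<in> V. c v = k}" by (simp add: numeral_eq_Suc)
    have "card k \<le> card {v \<in> V. c v = k}" using clsZ[OF kZ(1)] assms(1) by (intro card_mono) auto
    then show "s + 2 \<le> card {v \<in> V. c v = k}" using kZ(1) unfolding Z'_def by auto
  next
    fix j assume "j \<in> g ` c ` V"
    then have j: "j \<in> F" using gimg by auto
    have sub: "j \<subseteq> {v \<in> V. g (c v) = j}" using gP[OF _ j] F(4) j by blast
    show "unsplittable A T {v \<in> V. g (c v) = j}"
    proof (rule unsplittable_attach[OF F(9)[OF j] sub assms(3)])
      fix v assume v: "v \<in> {v \<in> V. g (c v) = j} - j"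
      then have vV: "v \<in> V" "g (c v) = j" by auto
      have "v \<notin> \<Union>Z'" using c_in[of v] g[of "c v"] v by auto
      then have "D \<le> card {u \<in> c v. A v u}" using c_out vV by auto
      also have "\<dots> \<le> card {u \<in> j. A v u}"
        by (rule card_mono) (use g[OF cZ'[OF vV(1)]] vV(2) fP[OF j] in auto)
      finally show "T \<le> card {u \<in> j. A v u}" unfolding D_def by simp
    qed
    obtain v where v: "v \<in> j" using F(3) j by fastforce
    \<comment> \<open>Neighbours of \<open>v\<close> lie in its own piece or among the at most
      \<open>a * T\<close> vertices given up, so the piece is almost as large as the degree.\<close>
    have "{u \<in> V. A v u} \<subseteq> j \<union> (V - \<Union>F)"
    proof
      fix u assume u: "u \<in> {u \<in> V. A v u}"
      show "u \<in> j \<union> (V - \<Union>F)"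
      proof (rule ccontr)
        assume "u \<notin> j \<union> (V - \<Union>F)"
        then obtain P where "P \<in> F" "u \<in> P" "u \<notin> j" using u by auto
        then show False using F(5)[OF j, of P] v u unfolding nonadj_def by auto
      qed
    qed
    then have "card {u \<in> V. A v u} \<le> card (j \<union> (V - \<Union>F))"
      by (rule card_mono[rotated]) (use fP[OF j] assms(1) in auto)
    also have "\<dots> \<le> card j + a * T" using card_Un_le[of j "V - \<Union>F"] F(8) by linarith
    finally have 1: "dl \<le> card j + a * T" using deg[of v] v F(4) j by force
    have "card j \<le> card {v \<in> V. g (c v) = j}" using sub assms(1) by (intro card_mono) auto
    moreover have "2 * (a * T) \<le> dl" using dl by (simp add: algebra_simps)
    ultimately show "dl \<le> 2 * card {v \<in> V. g (c v) = j}" using 1 by linarith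
  qed
qed

section \<open>Matchings that become Eulerian after contraction\<close>

text \<open>A matching, as a fixed-point-free involution on the vertices it covers. When the fibers
  of \<open>c\<close> are contracted, the elements of \<open>X\<close> become the darts (half-edges)
  of a multigraph.\<close>

definition pairing :: "('a \<Rightarrow> 'a \<Rightarrow> bool) \<Rightarrow> 'a set \<Rightarrow> ('a \<Rightarrow> 'a) \<Rightarrow> bool" where
  "pairing E X \<phi> \<longleftrightarrow> finite X \<and> (\<forall>x\<in>X. \<phi> x \<in> X \<and> \<phi> (\<phi> x) = x \<and> \<phi> x \<noteq> x \<and> E x (\<phi> x))"

text \<open>Connectedness of the contracted multigraph, in terms of cuts.\<close>

definition linked :: "('a \<Rightarrow> 'k) \<Rightarrow> 'a set \<Rightarrow> ('a \<Rightarrow> 'a) \<Rightarrow> 'k set \<Rightarrow> bool" where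
  "linked c X \<phi> K \<longleftrightarrow> (\<forall>S. S \<inter> K \<noteq> {} \<and> \<not> K \<subseteq> S \<longrightarrow> (\<exists>x\<in>X. c x \<in> S \<and> c (\<phi> x) \<notin> S))"

lemma spanning_tree_matching:
  fixes c :: "'a \<Rightarrow> 'k" and E :: "'a \<Rightarrow> 'a \<Rightarrow> bool"
  assumes "finite K" "k0 \<in> K" "symp E"
    and step: "\<And>Y U. k0 \<in> Y \<Longrightarrow> Y \<subset> K \<Longrightarrow> finite U \<Longrightarrow> card U \<le> 2 * card K \<Longrightarrow> c ` U \<subseteq> Y \<Longrightarrow>
      (\<forall>x\<in>U. \<exists>z\<in>U. E x z) \<Longrightarrow> \<exists>x y. E x y \<and> c x \<in> Y \<and> c y \<in> K - Y \<and> x \<notin> U"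
  obtains X \<phi> where "pairing E X \<phi>" "card X \<le> 2 * card K" "c ` X \<subseteq> K" "linked c X \<phi> K"
proof -
  have grow: "\<exists>Y X \<phi>. card Y = Suc m \<and> k0 \<in> Y \<and> Y \<subseteq> K \<and> pairing E X \<phi> \<and> card X \<le> 2 * m \<and> c ` X \<subseteq> Y \<and>
      linked c X \<phi> Y" if "Suc m \<le> card K" for m
    using that
  proof (induction m)
    case 0
    have "linked c {} undefined {k0}" unfolding linked_def by auto
    moreover have "pairing E {} undefined" unfolding pairing_def by auto
    ultimately show ?case using assms(2)
      by (intro exI[of _ "{k0}"] exI[of _ "{}"] exI[of _ undefined]) auto
  next
    case (Suc m)
    then obtain Y X \<phi> where Y: "card Y = Suc m" "k0 \<in> Y" "Y \<subseteq> K" and X: "pairing E X \<phi>"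
      "card X \<le> 2 * m" "c ` X \<subseteq> Y" "linked c X \<phi> Y" by auto
    have "Y \<subset> K" using Y Suc.prems by auto
    moreover have "finite X" "\<forall>x\<in>X. \<exists>z\<in>X. E x z" using X(1) unfolding pairing_def by auto
    moreover have "card X \<le> 2 * card K" using X(2) Suc.prems by linarith
    ultimately obtain x y where xy: "E x y" "c x \<in> Y" "c y \<in> K - Y" "x \<notin> X"
      using step[of Y X] Y(2) X(3) by blast
    have "y \<notin> X" "x \<noteq> y" using xy X(3) by auto
    let ?X = "insert x (insert y X)" and ?f = "\<phi>(x := y, y := x)" and ?Y = "insert (c y) Y"
    have fY: "finite Y" using Y assms(1) finite_subset by blast
    have inX: "u \<noteq> x" "u \<noteq> y" "\<phi> u \<noteq> x" "\<phi> u \<noteq> y" if "u \<in> X" for u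
      using that xy(4) \<open>y \<notin> X\<close> X(1) unfolding pairing_def by metis+
    have "pairing E ?X ?f"
      using X(1) inX xy \<open>x \<noteq> y\<close> assms(3) unfolding pairing_def symp_def by auto
    moreover have "linked c ?X ?f ?Y"
      unfolding linked_def
    proof (intro allI impI, elim conjE)
      fix S assume S: "S \<inter> ?Y \<noteq> {}" "\<not> ?Y \<subseteq> S"
      consider "S \<inter> Y \<noteq> {}" "\<not> Y \<subseteq> S" | "Y \<subseteq> S" | "S \<inter> Y = {}" by blast
      then show "\<exists>u\<in>?X. c u \<in> S \<and> c (?f u) \<notin> S"
      proof cases
        case 1
        then obtain u where "u \<in> X" "c u \<in> S" "c (\<phi> u) \<notin> S" using X(4) unfolding linked_def by blast
        then show ?thesis using inX by (intro bexI[of _ u]) auto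
      next
        case 2
        then show ?thesis using S xy \<open>x \<noteq> y\<close> by (intro bexI[of _ x]) auto
      next
        case 3
        then show ?thesis using S xy by (intro bexI[of _ y]) auto
      qed
    qed
    moreover have "card ?X \<le> 2 * Suc m"
      using X(2) \<open>finite X\<close> card_insert_le_m1 by (simp add: card_insert_if)
    moreover have "card ?Y = Suc (Suc m)" using Y xy fY by simp
    moreover have "k0 \<in> ?Y" "?Y \<subseteq> K" "c ` ?X \<subseteq> ?Y" using Y X(3) xy by auto
    ultimately show ?case
      by (intro exI[of _ ?Y] exI[of _ ?X] exI[of _ ?f] conjI)
  qed
  have K1: "card K \<ge> 1" using assms(1,2) by (metis One_nat_def Suc_leI card_gt_0_iff empty_iff)
  then have "Suc (card K - 1) \<le> card K" by simp
  then obtain Y X \<phi> where Y: "card Y = Suc (card K - 1)" "Y \<subseteq> K" and X: "pairing E X \<phi>"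
      "card X \<le> 2 * (card K - 1)" "c ` X \<subseteq> Y" "linked c X \<phi> Y" using grow by metis
  have "Y = K" using K1 Y assms(1) by (intro card_subset_eq) auto
  then show ?thesis using that[of X \<phi>] X by auto
qed

section \<open>Parity correction\<close>

lemma even_card_sym_diff:
  assumes "finite A" "finite B"
  shows "even (card (sym_diff A B)) \<longleftrightarrow> (even (card A) \<longleftrightarrow> even (card B))"
proof -
  have "card (sym_diff A B) = card (A - B) + card (B - A)"
    by (rule card_Un_disjoint) (use assms in auto)
  moreover have "card A = card (A - B) + card (A \<inter> B)"
    by (subst card_Un_disjoint[symmetric]) (use assms in \<open>auto intro: arg_cong[of _ _ card]\<close>)
  moreover have "card B = card (B - A) + card (A \<inter> B)"
    by (subst card_Un_disjoint[symmetric]) (use assms in \<open>auto intro: arg_cong[of _ _ card]\<close>)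
  ultimately show ?thesis by auto
qed

lemma even_card_pairing:
  assumes "pairing E X \<phi>" shows "even (card X)"
  using assms
proof (induction "card X" arbitrary: X rule: less_induct)
  case less
  show ?case
  proof (cases "X = {}")
    case False
    then obtain x where x: "x \<in> X" by blast
    let ?Y = "X - {x, \<phi> x}"
    have fin: "finite X" and sub: "{x, \<phi> x} \<subseteq> X" and ne: "\<phi> x \<noteq> x"
      using less.prems x unfolding pairing_def by auto
    have two: "card {x, \<phi> x} = 2" using ne by auto
    have "card ?Y + 2 = card X"
      using card_Diff_subset[of "{x, \<phi> x}" X] sub fin two card_mono[OF fin sub] by auto
    moreover have "pairing E ?Y \<phi>" using less.prems x unfolding pairing_def by (auto, metis+)
    ultimately have "even (card ?Y)" using less.hyps[of ?Y] by linarith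
    then show ?thesis using \<open>card ?Y + 2 = card X\<close> by (metis even_add even_numeral)
  qed simp
qed

text \<open>\<open>D\<close> is a T-join in the second system for the classes of odd degree in the
  first. As the second system is connected, some union of its edges has odd degree exactly at two
  given classes (\<open>toggle\<close>); adding it by symmetric difference repairs two odd classes.
  By the handshake lemma these come in pairs, so a choice of \<open>D\<close> with fewest odd
  classes has none.\<close>

lemma even_fibers:
  fixes c :: "'a \<Rightarrow> 'k"
  assumes X1: "pairing E1 X1 \<phi>1" "c ` X1 \<subseteq> K" and X2: "pairing E2 X2 \<phi>2" "c ` X2 \<subseteq> K" "linked c X2 \<phi>2 K"
    and dis: "X1 \<inter> X2 = {}" and "finite K"
  obtains D where "D \<subseteq> X2" "\<phi>2 ` D \<subseteq> D" "\<And>k. even (card {x \<in> X1 \<union> D. c x = k})"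
proof -
  define cl where "cl J \<longleftrightarrow> J \<subseteq> X2 \<and> \<phi>2 ` J \<subseteq> J" for J
  define fib where "fib J k = {x \<in> J. c x = k}" for J k
  have f1: "finite X1" and f2: "finite X2" using X1 X2 unfolding pairing_def by auto
  have cl_fin: "finite J" if "cl J" for J using that f2 finite_subset unfolding cl_def by blast
  have fib_sd: "fib (sym_diff J J') k = sym_diff (fib J k) (fib J' k)" for J J' k
    unfolding fib_def by auto
  have inv: "\<phi>2 (\<phi>2 x) = x" "\<phi>2 x \<in> X2" "\<phi>2 x \<noteq> x" if "x \<in> X2" for x
    using that X2(1) unfolding pairing_def by auto
  have cl_sd: "cl (sym_diff J J')" if "cl J" "cl J'" for J J'
  proof -
    have mem: "\<phi>2 x \<in> J \<longleftrightarrow> x \<in> J" if "cl J" "x \<in> X2" for x J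
      using that inv unfolding cl_def by (metis image_subset_iff)
    show ?thesis using that mem[OF that(1)] mem[OF that(2)] inv unfolding cl_def by blast
  qed
  have toggle: "\<exists>J. cl J \<and> (\<forall>j. odd (card (fib J j)) \<longleftrightarrow> ((j = k) \<noteq> (j = k')))"
    if "k \<in> K" "k' \<in> K" for k k'
  proof -
    \<comment> \<open>The classes that can be joined to \<open>k\<close> in this sense. Toggling one
      more edge shows that no edge of the second system leaves \<open>S\<close>, so connectedness
      puts all of \<open>K\<close> inside.\<close>
    define S where "S = {k'. \<exists>J. cl J \<and> (\<forall>j. odd (card (fib J j)) \<longleftrightarrow> ((j = k) \<noteq> (j = k')))}"
    have "k \<in> S" unfolding S_def by (auto simp: cl_def fib_def intro!: exI[of _ "{}"])
    have "K \<subseteq> S"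
    proof (rule ccontr)
      assume "\<not> K \<subseteq> S"
      moreover have "S \<inter> K \<noteq> {}" using \<open>k \<in> S\<close> that by auto
      ultimately obtain x where x: "x \<in> X2" "c x \<in> S" "c (\<phi>2 x) \<notin> S"
        using X2(3) unfolding linked_def by metis
      obtain J where J: "cl J" "\<And>j. odd (card (fib J j)) \<longleftrightarrow> ((j = k) \<noteq> (j = c x))"
        using x(2) unfolding S_def by auto
      let ?e = "{x, \<phi>2 x}"
      have e: "cl ?e" using inv[OF x(1)] x(1) unfolding cl_def by auto
      have "c x \<noteq> c (\<phi>2 x)" using x by auto
      then have "odd (card (fib ?e j)) \<longleftrightarrow> ((j = c x) \<noteq> (j = c (\<phi>2 x)))" for j
      proof -
        have "fib ?e j = (if j = c x then {x} else if j = c (\<phi>2 x) then {\<phi>2 x} else {})"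
          unfolding fib_def using \<open>c x \<noteq> c (\<phi>2 x)\<close> by auto
        then show ?thesis using \<open>c x \<noteq> c (\<phi>2 x)\<close> by auto
      qed
      then have "odd (card (fib (sym_diff J ?e) j)) \<longleftrightarrow> ((j = k) \<noteq> (j = c (\<phi>2 x)))" for j
        unfolding fib_sd using even_card_sym_diff[of "fib J j" "fib ?e j"] J(2)[of j] cl_fin[OF J(1)]
        by (auto simp: fib_def)
      then have "c (\<phi>2 x) \<in> S" unfolding S_def using cl_sd[OF J(1) e] by blast
      then show False using x(3) by blast
    qed
    then show ?thesis using that unfolding S_def by auto
  qed
  define bad where "bad D = {k \<in> K. odd (card (fib (X1 \<union> D) k))}" for D
  have fbad: "finite (bad D)" for D unfolding bad_def using \<open>finite K\<close> by simp
  have "cl {}" unfolding cl_def by auto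
  then obtain D where D: "cl D" and min: "\<And>D'. cl D' \<Longrightarrow> card (bad D) \<le> card (bad D')"
    using ex_has_least_nat[of cl "{}" "\<lambda>D. card (bad D)"] by auto
  have "bad D = {}"
  proof (rule ccontr)
    assume "bad D \<noteq> {}"
    then obtain k where k: "k \<in> bad D" by blast
    have D2: "D \<subseteq> X2" using D cl_def by auto
    have "pairing E2 D \<phi>2" using X2(1) D finite_subset[OF D2] unfolding cl_def pairing_def by auto
    then have "even (card D)" by (rule even_card_pairing)
    moreover have "card (X1 \<union> D) = card X1 + card D"
      by (rule card_Un_disjoint) (use f1 cl_fin[OF D] dis D2 in auto)
    ultimately have ev: "even (card (X1 \<union> D))" using even_card_pairing[OF X1(1)] by simp
    have fu: "finite (X1 \<union> D)" using f1 cl_fin[OF D] by simp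
    have "c x \<in> K" if "x \<in> X1 \<union> D" for x using that X1(2) X2(2) D2 by blast
    then have "X1 \<union> D = (\<Union>k\<in>K. fib (X1 \<union> D) k)" unfolding fib_def by auto
    then have "card (X1 \<union> D) = card (\<Union>k\<in>K. fib (X1 \<union> D) k)" by (rule arg_cong)
    also have "\<dots> = (\<Sum>k\<in>K. card (fib (X1 \<union> D) k))"
      by (rule card_UN_disjoint) (use \<open>finite K\<close> fu in \<open>auto simp: fib_def\<close>)
    finally have "even (\<Sum>k\<in>K. card (fib (X1 \<union> D) k))" using ev by simp
    then have "even (card (bad D))" unfolding bad_def using \<open>finite K\<close> by (simp add: even_sum_iff)
    then have "bad D \<noteq> {k}" by auto
    then obtain k' where k': "k' \<in> bad D" "k' \<noteq> k" using k by blast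
    obtain J where J: "cl J" "\<And>j. odd (card (fib J j)) \<longleftrightarrow> ((j = k) \<noteq> (j = k'))"
      using toggle[of k k'] k k' unfolding bad_def by auto
    have "fib (X1 \<union> sym_diff D J) j = sym_diff (fib (X1 \<union> D) j) (fib J j)" for j
      unfolding fib_def using dis J(1) unfolding cl_def by blast
    then have "odd (card (fib (X1 \<union> sym_diff D J) j)) \<longleftrightarrow> (odd (card (fib (X1 \<union> D) j)) \<noteq> ((j = k) \<noteq> (j = k')))" for j
      using even_card_sym_diff[of "fib (X1 \<union> D) j" "fib J j"] J(2)[of j] fu cl_fin[OF J(1)]
      by (auto simp: fib_def)
    then have "bad (sym_diff D J) = bad D - {k, k'}" using k k' unfolding bad_def by auto
    then have "card (bad (sym_diff D J)) < card (bad D)"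
      using k fbad by (intro psubset_card_mono) auto
    then show False using min[OF cl_sd[OF D J(1)]] by simp
  qed
  moreover have "fib (X1 \<union> D) k = {}" if "k \<notin> K" for k
  proof -
    have "c x \<noteq> k" if "x \<in> X1 \<union> D" for x
      using that \<open>k \<notin> K\<close> X1(2) X2(2) D unfolding cl_def by blast
    then show ?thesis unfolding fib_def by blast
  qed
  ultimately have "even (card (fib (X1 \<union> D) k))" for k
    unfolding bad_def by (cases "k \<in> K") auto
  then have "even (card {x \<in> X1 \<union> D. c x = k})" for k unfolding fib_def by blast
  then show ?thesis using that[of D] D unfolding cl_def by auto
qed

section \<open>Closed trails in the contracted multigraph\<close>

fun darts :: "('a \<times> 'a) list \<Rightarrow> 'a list" where
  "darts [] = []"
| "darts ((a, b) # ps) = a # b # darts ps"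

lemma darts_append [simp]: "darts (ps @ qs) = darts ps @ darts qs"
  by (induction ps rule: darts.induct) auto

lemma set_darts: "set (darts ps) = fst ` set ps \<union> snd ` set ps"
  by (induction ps rule: darts.induct) auto

lemma length_darts: "length (darts ps) = 2 * length ps"
  by (induction ps rule: darts.induct) auto

text \<open>A pair \<open>(a, b)\<close> is one visit to a class, entered at the dart
  \<open>a\<close> and left at the dart \<open>b\<close>; the next visit starts at the other end
  \<open>\<phi> b\<close> of the edge. The trail is closed when its last exit is
  \<open>\<phi> x\<close>. Visits are recorded rather than edges because their two darts are what is
  later linked inside the class.\<close>

definition trail :: "('a \<Rightarrow> 'k) \<Rightarrow> ('a \<Rightarrow> 'a) \<Rightarrow> 'a set \<Rightarrow> 'a \<Rightarrow> ('a \<times> 'a) list \<Rightarrow> bool" where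
  "trail c \<phi> X x ps \<longleftrightarrow> ps \<noteq> [] \<and> fst (hd ps) = x \<and> distinct (darts ps) \<and> set (darts ps) \<subseteq> X \<and>
     (\<forall>p\<in>set ps. c (fst p) = c (snd p)) \<and> successively (\<lambda>p q. fst q = \<phi> (snd p)) ps"

lemma even_card_darts_fiber:
  assumes "distinct (darts ps)" "\<forall>p\<in>set ps. c (fst p) = c (snd p)"
  shows "even (card {x \<in> set (darts ps). c x = k})"
  using assms
proof (induction ps rule: darts.induct)
  case (2 a b ps)
  have "{x \<in> set (darts ((a, b) # ps)). c x = k} =
      (if c a = k then {a, b} else {}) \<union> {x \<in> set (darts ps). c x = k}"
    using 2(3) by auto
  moreover have "card \<dots> = card (if c a = k then {a, b} else {}) + card {x \<in> set (darts ps). c x = k}"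
    by (rule card_Un_disjoint) (use 2(2) in auto)
  ultimately show ?case using 2 by auto
qed simp

lemma trail_extend:
  assumes X: "pairing E X \<phi>" and ev: "\<And>k. even (card {x \<in> X. c x = k})"
    and tr: "trail c \<phi> X x0 ps" and open_end: "snd (last ps) \<noteq> \<phi> x0" and x0: "x0 \<in> X"
  shows "\<exists>p. trail c \<phi> X x0 (ps @ [p])"
proof -
  define b where "b = snd (last ps)"
  have ps: "ps \<noteq> []" "fst (hd ps) = x0" "distinct (darts ps)" "set (darts ps) \<subseteq> X"
    "\<forall>p\<in>set ps. c (fst p) = c (snd p)" "successively (\<lambda>p q. fst q = \<phi> (snd p)) ps"
    using tr unfolding trail_def by auto
  have inv: "\<phi> x \<in> X" "\<phi> (\<phi> x) = x" "\<phi> x \<noteq> x" if "x \<in> X" for x using that X unfolding pairing_def by auto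
  have bX: "b \<in> X" using ps(1,4) unfolding b_def set_darts by auto
  obtain a us where us: "ps = us @ [(a, b)]"
    using ps(1) unfolding b_def by (metis append_butlast_last_id surjective_pairing)
  \<comment> \<open>If \<open>\<phi> b\<close> had served as an entry, the exit before it would be
    \<open>b\<close>; as an exit, the entry after it would be \<open>b\<close>. Either way
    \<open>b\<close> would occur twice. The very first entry has no exit before it and is excluded
    by \<open>open_end\<close>.\<close>
  have new: "\<phi> b \<notin> set (darts ps)"
  proof
    assume "\<phi> b \<in> set (darts ps)"
    then obtain p where p: "p \<in> set ps" "\<phi> b = fst p \<or> \<phi> b = snd p" unfolding set_darts by auto
    then obtain vs ws where vw: "ps = vs @ p # ws" by (metis split_list)
    have pX: "fst p \<in> X" "snd p \<in> X" using p(1) ps(4) unfolding set_darts by auto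
    from p(2) show False
    proof
      assume f: "\<phi> b = fst p"
      then have "vs \<noteq> []" using ps(2) vw open_end inv(2)[OF bX] unfolding b_def by auto
      then obtain vs' q where q: "vs = vs' @ [q]" by (metis rev_exhaust)
      then have "fst p = \<phi> (snd q)" using ps(6) vw by (simp add: successively_append_iff successively_Cons)
      moreover have "snd q \<in> X" using ps(4) vw q unfolding set_darts by auto
      ultimately have "snd q = b" using f inv(2) bX by metis
      moreover have "snd q \<noteq> b"
      proof (cases ws rule: rev_cases)
        case Nil
        then have "p = (a, b)" using us vw by simp
        then show ?thesis using ps(3) vw q by (cases q) auto
      next
        case (snoc ws' r)
        then have "r = (a, b)" using us vw by simp
        then show ?thesis using ps(3) vw q snoc by (cases q; cases p) auto
      qed
      ultimately show False by blast
    next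
      assume f: "\<phi> b = snd p"
      show False
      proof (cases ws)
        case Nil
        then have "p = (a, b)" using us vw by simp
        then show False using f inv(3)[OF bX] by simp
      next
        case (Cons r ws')
        then have "fst r = \<phi> (snd p)" using ps(6) vw by (simp add: successively_append_iff)
        then have "fst r = b" using f inv(2)[OF bX] by simp
        moreover have "fst r \<noteq> b"
        proof (cases ws' rule: rev_cases)
          case Nil
          then have "r = (a, b)" using us vw Cons by simp
          then show ?thesis using ps(3) vw Cons by (cases p) auto
        next
          case (snoc ws'' t)
          then have "t = (a, b)" using us vw Cons by simp
          then show ?thesis using ps(3) vw snoc Cons by (cases r; cases p) auto
        qed
        ultimately show False by blast
      qed
    qed
  qed
  let ?D = "{x \<in> set (darts ps). c x = c (\<phi> b)}" and ?F = "{x \<in> X. c x = c (\<phi> b)}"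
  have "insert (\<phi> b) ?D \<noteq> ?F"
  proof
    assume "insert (\<phi> b) ?D = ?F"
    moreover have "card (insert (\<phi> b) ?D) = Suc (card ?D)" using new by simp
    ultimately have "card ?F = Suc (card ?D)" by simp
    then show False using ev[of "c (\<phi> b)"] even_card_darts_fiber[OF ps(3,5), of "c (\<phi> b)"] by simp
  qed
  moreover have "insert (\<phi> b) ?D \<subseteq> ?F" using ps(4) inv(1)[OF bX] by auto
  ultimately obtain d where d: "d \<in> X" "c d = c (\<phi> b)" "d \<noteq> \<phi> b" "d \<notin> set (darts ps)" by blast
  have "trail c \<phi> X x0 (ps @ [(\<phi> b, d)])"
    unfolding trail_def using ps d new inv(1)[OF bX]
    by (auto simp: successively_append_iff b_def)
  then show ?thesis by blast
qed

lemma trail_exists: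
  assumes "pairing E X \<phi>" "\<And>k. even (card {x \<in> X. c x = k})" "x0 \<in> X"
  shows "\<exists>p. trail c \<phi> X x0 [p]"
proof -
  have "{x0} \<noteq> {x \<in> X. c x = c x0}"
    using assms(2)[of "c x0"] by (metis One_nat_def is_singletonI is_singleton_altdef odd_one)
  then obtain d where "d \<in> X" "c d = c x0" "d \<noteq> x0" using assms(3) by blast
  then have "trail c \<phi> X x0 [(x0, d)]" using assms(3) unfolding trail_def by auto
  then show ?thesis by blast
qed

lemma longest_trail:
  assumes "pairing E X \<phi>" "\<And>k. even (card {x \<in> X. c x = k})" "x0 \<in> X"
  obtains ps where "trail c \<phi> X x0 ps" "snd (last ps) = \<phi> x0"
    "\<And>qs. trail c \<phi> X x0 qs \<Longrightarrow> length qs \<le> length ps"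
proof -
  have fin: "finite X" using assms(1) unfolding pairing_def by auto
  have bound: "length ps < Suc (card X)" if "trail c \<phi> X x0 ps" for ps
  proof -
    have "2 * length ps = card (set (darts ps))"
      using that unfolding trail_def by (simp add: distinct_card length_darts)
    also have "\<dots> \<le> card X" using that fin unfolding trail_def by (intro card_mono) auto
    finally show ?thesis by simp
  qed
  obtain p where "trail c \<phi> X x0 [p]" using trail_exists[where c = c] assms by metis
  then obtain ps where ps: "trail c \<phi> X x0 ps" "\<And>qs. trail c \<phi> X x0 qs \<Longrightarrow> length qs \<le> length ps"
    using ex_has_greatest_nat[of "trail c \<phi> X x0" "[p]" length "Suc (card X)"] bound by blast
  have "snd (last ps) = \<phi> x0"
  proof (rule ccontr)
    assume "\<not> ?thesis"
    then obtain p where "trail c \<phi> X x0 (ps @ [p])" using trail_extend[OF assms(1,2) ps(1) _ assms(3)] by blast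
    then show False using ps(2) by fastforce
  qed
  then show ?thesis using that ps by blast
qed

text \<open>A closed trail consists of whole edges. Its removal therefore leaves a pairing, in which
  a further trail can be found.\<close>

lemma closed_trail_invariant:
  assumes X: "pairing E X \<phi>" and tr: "trail c \<phi> X x0 ps" "snd (last ps) = \<phi> x0" and x: "x \<in> set (darts ps)"
  shows "\<phi> x \<in> set (darts ps)"
proof -
  have ps: "ps \<noteq> []" "fst (hd ps) = x0" "set (darts ps) \<subseteq> X" "successively (\<lambda>p q. fst q = \<phi> (snd p)) ps"
    using tr unfolding trail_def by auto
  obtain p where p: "p \<in> set ps" "x = fst p \<or> x = snd p" using x unfolding set_darts by auto
  then obtain vs ws where vw: "ps = vs @ p # ws" by (metis split_list)
  from p(2) show ?thesis
  proof
    assume f: "x = fst p"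
    show ?thesis
    proof (cases vs rule: rev_cases)
      case Nil
      then have "\<phi> x = snd (last ps)" using f ps(2) vw tr(2) by simp
      then show ?thesis using ps(1) unfolding set_darts by auto
    next
      case (snoc vs' q)
      then have "x = \<phi> (snd q)" using ps(4) vw f by (simp add: successively_append_iff successively_Cons)
      moreover have "snd q \<in> set (darts ps)" using vw snoc unfolding set_darts by auto
      ultimately show ?thesis using X ps(3) unfolding pairing_def by auto
    qed
  next
    assume f: "x = snd p"
    show ?thesis
    proof (cases ws)
      case Nil
      then have "x = \<phi> x0" using f vw tr(2) by simp
      moreover have "x0 \<in> set (darts ps)" using ps(1,2) unfolding set_darts by auto
      ultimately show ?thesis using X ps(3) unfolding pairing_def by auto
    next
      case (Cons r ws')
      then have "fst r = \<phi> x" using ps(4) vw f by (simp add: successively_append_iff)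
      moreover have "fst r \<in> set (darts ps)" using vw Cons unfolding set_darts by auto
      ultimately show ?thesis by simp
    qed
  qed
qed

text \<open>Euler's theorem, for the multigraph obtained from the matching \<open>\<phi>\<close> by contracting the fibers of \<open>c\<close>.\<close>

theorem euler_trail:
  assumes X: "pairing E X \<phi>" and ev: "\<And>k. even (card {x \<in> X. c x = k})"
    and linked: "linked c X \<phi> (c ` X)" and x0: "x0 \<in> X"
  obtains ps where "trail c \<phi> X x0 ps" "snd (last ps) = \<phi> x0" "c ` set (darts ps) = c ` X"
proof -
  obtain ps where tr: "trail c \<phi> X x0 ps" "snd (last ps) = \<phi> x0"
    and longest: "\<And>qs. trail c \<phi> X x0 qs \<Longrightarrow> length qs \<le> length ps"
    using longest_trail[where c = c, OF X ev x0] by metis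
  define D where "D = set (darts ps)"
  have ps: "ps \<noteq> []" "fst (hd ps) = x0" "distinct (darts ps)" "D \<subseteq> X"
    "\<forall>p\<in>set ps. c (fst p) = c (snd p)" "successively (\<lambda>p q. fst q = \<phi> (snd p)) ps"
    using tr unfolding trail_def D_def by auto
  have D_inv: "\<phi> x \<in> D" if "x \<in> D" for x
    using closed_trail_invariant[OF X tr] that unfolding D_def by blast
  have fin: "finite X" using X unfolding pairing_def by auto
  have "c ` X \<subseteq> c ` D"
  proof (rule ccontr)
    assume "\<not> c ` X \<subseteq> c ` D"
    moreover have "x0 \<in> D" using ps(1,2) unfolding D_def set_darts by auto
    then have "c ` D \<inter> c ` X \<noteq> {}" using x0 by blast
    ultimately obtain x where x: "x \<in> X" "c x \<in> c ` D" "c (\<phi> x) \<notin> c ` D"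
      using linked[unfolded linked_def, rule_format, of "c ` D"] by blast
    have invX: "\<phi> x \<in> X" "\<phi> (\<phi> x) = x" if "x \<in> X" for x using X that unfolding pairing_def by auto
    have X': "pairing E (X - D) \<phi>"
      unfolding pairing_def
    proof (intro conjI ballI)
      fix y assume y: "y \<in> X - D"
      then show "\<phi> y \<in> X - D" using D_inv[of "\<phi> y"] invX by auto
    qed (use X in \<open>auto simp: pairing_def\<close>)
    have ev': "even (card {x \<in> X - D. c x = k})" for k
    proof -
      have "{x \<in> X - D. c x = k} = {x \<in> X. c x = k} - {x \<in> D. c x = k}" by auto
      moreover have "card ({x \<in> X. c x = k} - {x \<in> D. c x = k}) = card {x \<in> X. c x = k} - card {x \<in> D. c x = k}"
        by (rule card_Diff_subset) (use fin ps(4) finite_subset[OF ps(4) fin] in auto)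
      moreover have "even (card {x \<in> D. c x = k})"
        unfolding D_def by (rule even_card_darts_fiber[OF ps(3,5)])
      ultimately show ?thesis using ev[of k] by simp
    qed
    have "\<phi> x \<in> X - D" using x(1,3) invX by auto
    then obtain qs where qs: "trail c \<phi> (X - D) (\<phi> x) qs" "snd (last qs) = \<phi> (\<phi> x)"
      using longest_trail[where c = c, OF X' ev'] by metis
    then have "qs \<noteq> []" "snd (last qs) = x" using invX(2)[OF x(1)] unfolding trail_def by auto
    then obtain rs d where rs: "qs = rs @ [(d, x)]"
      by (cases qs rule: rev_cases) auto
    obtain p where p: "p \<in> set ps" "c x = c (fst p)" using x(2) ps(5) unfolding D_def set_darts by auto
    then obtain us vs where uv: "ps = us @ p # vs" by (metis split_list)
    obtain a b where ab: "p = (a, b)" by (cases p)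
    \<comment> \<open>The detour runs from \<open>\<phi> x\<close> back to \<open>x\<close>. It is
      spliced into a visit \<open>(a, b)\<close> of the class of \<open>x\<close>, which is broken
      up into \<open>(a, x)\<close> and \<open>(d, b)\<close>.\<close>
    let ?new = "us @ [(a, x)] @ rs @ [(d, b)] @ vs"
    have cab: "c a = c b" "c x = c a" using p ps(5) ab by auto
    have q: "distinct (darts qs)" "set (darts qs) \<subseteq> X - D" "\<forall>p\<in>set qs. c (fst p) = c (snd p)"
      "successively (\<lambda>p q. fst q = \<phi> (snd p)) qs" "fst (hd qs) = \<phi> x"
      using qs(1) unfolding trail_def by auto
    have D': "D = set (darts us) \<union> {a, b} \<union> set (darts vs)" unfolding D_def uv ab by auto
    have "distinct (darts ?new)"
      using ps(3) q(1,2) unfolding rs uv ab D' by auto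
    moreover have "set (darts ?new) \<subseteq> X" using ps(4) q(2) x(1) unfolding rs D' by auto
    moreover have "\<forall>p\<in>set ?new. c (fst p) = c (snd p)"
      using ps(5) q(3) cab unfolding rs uv by auto
    moreover have "successively (\<lambda>p q. fst q = \<phi> (snd p)) ?new"
    proof -
      have "successively (\<lambda>p q. fst q = \<phi> (snd p)) (rs @ [(d, b)])"
        using q(4) unfolding rs by (auto simp: successively_append_iff)
      moreover have "fst (hd (rs @ [(d, b)])) = \<phi> x" using q(5) unfolding rs by (cases rs) auto
      ultimately show ?thesis using ps(6) unfolding uv ab
        by (auto simp: successively_append_iff successively_Cons hd_append)
    qed
    moreover have "fst (hd ?new) = x0" using ps(2) unfolding uv ab by (cases us) auto
    ultimately have "trail c \<phi> X x0 ?new" unfolding trail_def by simp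
    then show False using longest[of ?new] uv by simp
  qed
  then show ?thesis using that[OF tr] ps(4) unfolding D_def by blast
qed

section \<open>Cycles of all lengths in a robust partition\<close>

definition has_cycle :: "('a \<Rightarrow> 'a \<Rightarrow> bool) \<Rightarrow> 'a set \<Rightarrow> nat \<Rightarrow> bool" where
  "has_cycle E V N \<longleftrightarrow> (\<exists>vs. vs \<noteq> [] \<and> length vs = N \<and> distinct vs \<and> set vs \<subseteq> V \<and> successively E vs \<and>
     E (last vs) (hd vs))"

text \<open>The vertices of \<open>S\<close> without a smaller neighbour in \<open>S\<close> are
  independent, hence at most \<open>a\<close>. A path that avoids them starts at a vertex with a
  smaller neighbour in \<open>S\<close>, by which it is prolonged; \<open>m\<close> rounds of this
  give \<open>m + 1\<close> vertices.\<close>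

lemma increasing_path:
  fixes S :: "'a::linorder set"
  assumes "finite S" "symp A" "irreflp A" "a * m < card S"
    and "\<And>I. I \<subseteq> S \<Longrightarrow> nonadj A I I \<Longrightarrow> card I \<le> a"
  shows "\<exists>xs. length xs = Suc m \<and> set xs \<subseteq> S \<and> sorted_wrt (<) xs \<and> successively A xs"
  using assms(1,4,5)
proof (induction m arbitrary: S)
  case 0
  then obtain x where "x \<in> S" by fastforce
  then show ?case by (intro exI[of _ "[x]"]) auto
next
  case (Suc m)
  define I where "I = {v \<in> S. \<not> (\<exists>u\<in>S. u < v \<and> A u v)}"
  have "nonadj A I I"
    unfolding nonadj_def
  proof (intro ballI notI)
    fix u v assume "u \<in> I" "v \<in> I" "A u v"
    moreover from this have "u \<noteq> v" "A v u" using assms(2,3) by (auto simp: irreflp_def symp_def)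
    ultimately show False unfolding I_def by (metis (mono_tags, lifting) mem_Collect_eq neqE)
  qed
  moreover have IS: "I \<subseteq> S" unfolding I_def by auto
  ultimately have "card I \<le> a" using Suc.prems(3) by blast
  then have "a * m < card (S - I)"
    using Suc.prems(1,2) IS by (simp add: card_Diff_subset finite_subset)
  then obtain xs where xs: "length xs = Suc m" "set xs \<subseteq> S - I" "sorted_wrt (<) xs" "successively A xs"
    using Suc.IH[of "S - I"] Suc.prems(1,3) by (metis Diff_subset finite_Diff order_trans)
  then obtain y ys where y: "xs = y # ys" by (cases xs) auto
  then have "y \<in> S" "y \<notin> I" using xs by auto
  then obtain u where u: "u \<in> S" "u < y" "A u y" unfolding I_def by auto
  then have "sorted_wrt (<) (u # xs)" using xs(3) y by auto
  then show ?case using xs u y by (intro exI[of _ "u # xs"]) auto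
qed

text \<open>The hub \<open>v\<close> closes every initial segment of a path among its neighbours.
  This serves the lengths too short for a cycle through all classes.\<close>

lemma wheel_cycle:
  fixes V :: "'a::linorder set"
  assumes "finite V" "symp A" "irreflp A" "\<And>I. I \<subseteq> V \<Longrightarrow> nonadj A I I \<Longrightarrow> card I \<le> a" "v \<in> V"
    and "a * m < card {u \<in> V. A v u}" "3 \<le> N" "N \<le> m + 2"
  shows "has_cycle A V N"
proof -
  let ?S = "{u \<in> V. A v u}"
  obtain xs where xs: "length xs = Suc m" "set xs \<subseteq> ?S" "sorted_wrt (<) xs" "successively A xs"
    using increasing_path[of ?S A a m] assms by auto
  define ys where "ys = take (N - 1) xs"
  have "distinct xs" using xs(3) by (simp add: strict_sorted_iff)
  then have ys: "length ys = N - 1" "set ys \<subseteq> ?S" "distinct ys" "ys \<noteq> []"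
    using assms xs set_take_subset[of "N - 1" xs] unfolding ys_def by auto
  have "successively A ys" using xs(4) unfolding ys_def
    by (metis append_take_drop_id successively_append_iff)
  moreover have "v \<notin> set ys" using ys assms(3) by (auto simp: irreflp_def)
  moreover have "hd ys \<in> ?S" "last ys \<in> ?S" using ys(2,4) by (meson hd_in_set last_in_set subsetD)+
  then have "A v (hd ys)" "A (last ys) v" using assms(2) by (auto simp: symp_def)
  ultimately show ?thesis unfolding has_cycle_def using ys assms
    by (intro exI[of _ "v # ys"]) (auto simp: successively_Cons)
qed

lemma path_in_detour:
  assumes "path_in E S q (ys @ zs) v" "ys \<noteq> []" "zs \<noteq> []" "M \<noteq> []" "E (last ys) (hd M)" "E (last M) (hd zs)"
    "distinct M" "successively E M" "set M \<inter> set (ys @ zs) = {}" "set M \<subseteq> S"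
  shows "path_in E S q (ys @ M @ zs) v"
  using assms unfolding path_in_def by (auto simp: successively_append_iff)

text \<open>The exchange step of Chvatal and Erdos.\<close>

lemma path_in_reroute:
  assumes "path_in E S q (ys @ zs @ ws) v" "symp E" "ys \<noteq> []" "zs \<noteq> []" "ws \<noteq> []" "M \<noteq> []"
    "E (last ys) (hd M)" "E (last M) (last zs)" "E (hd zs) (hd ws)"
    "distinct M" "successively E M" "set M \<inter> set (ys @ zs @ ws) = {}" "set M \<subseteq> S"
  shows "path_in E S q (ys @ M @ rev zs @ ws) v"
proof -
  have "successively E zs" using assms(1) unfolding path_in_def by (auto simp: successively_append_iff)
  then have "successively (\<lambda>x y. E y x) zs"
    by (rule successively_mono) (use assms(2) in \<open>auto simp: symp_def\<close>)
  then show ?thesis using assms unfolding path_in_def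
    by (auto simp: successively_append_iff hd_rev last_rev)
qed

section \<open>Extending a path in a robust partition\<close>

text \<open>\<open>A\<close> is the given graph, and \<open>E\<close> also has the random edges;
  links inside a class use \<open>A\<close> only. The number \<open>s\<close> is a budget for
  forbidden vertices: it covers \<open>2 l\<close> reserved vertices together with
  \<open>5 a\<close> links of \<open>l + 2\<close> vertices each, or with the paths of a fan to
  \<open>a + 2\<close> vertices.\<close>

locale robust_partition =
  fixes V :: "'a::linorder set" and A E :: "'a \<Rightarrow> 'a \<Rightarrow> bool" and c :: "'a \<Rightarrow> 'k" and a s l :: nat
  assumes fin: "finite V" and symA: "symp A" and irreflA: "irreflp A" and symE: "symp E"
    and AE: "A u v \<Longrightarrow> E u v"
    and indep: "I \<subseteq> V \<Longrightarrow> nonadj A I I \<Longrightarrow> card I \<le> a"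
    and robust: "k \<in> c ` V \<Longrightarrow> robust A s l {v \<in> V. c v = k}"
    and big: "k \<in> c ` V \<Longrightarrow> s + 2 \<le> card {v \<in> V. c v = k}"
    and s: "s = 20 * a * l" and a: "1 \<le> a" and l: "2 \<le> l"
begin

abbreviation cls :: "'k \<Rightarrow> 'a set" where "cls k \<equiv> {v \<in> V. c v = k}"

definition consec :: "'k \<Rightarrow> 'a list \<Rightarrow> bool" where
  "consec k xs \<longleftrightarrow> (\<exists>ys zs. xs = ys @ zs \<and> ys \<noteq> [] \<and> zs \<noteq> [] \<and> c (last ys) = k \<and> c (hd zs) = k)"

text \<open>The invariant under which a path can be extended. A class with \<open>a + 2\<close>
  vertices on the path admits a fan and the exchange argument; a smaller class must have two
  consecutive path vertices, between which a detour fits.\<close>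

definition visits :: "'a list \<Rightarrow> bool" where
  "visits xs \<longleftrightarrow> (\<forall>k\<in>c ` V. a + 2 \<le> card {x \<in> set xs. c x = k} \<or> consec k xs)"

text \<open>Growth is limited to \<open>2 l\<close> vertices at a time, the number of vertices that
  the reserved rim \<open>Res\<close> of a wheel can make up for.\<close>

definition extendable :: "'a set \<Rightarrow> 'a \<Rightarrow> 'a list \<Rightarrow> 'a \<Rightarrow> bool" where
  "extendable Res q xs v \<longleftrightarrow> (\<exists>xs'. path_in E (V - Res) q xs' v \<and> visits xs' \<and>
     length xs < length xs' \<and> length xs' \<le> length xs + 2 * l)"

text \<open>Paths from \<open>w\<close> to the vertices in \<open>X\<close>, disjoint apart from
  \<open>w\<close>. \<open>I x\<close> lists only the inner vertices of the path that ends at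
  \<open>x\<close>.\<close>

definition is_fan :: "'a set \<Rightarrow> 'a set \<Rightarrow> 'a \<Rightarrow> 'a set \<Rightarrow> ('a \<Rightarrow> 'a list) \<Rightarrow> bool" where
  "is_fan Res C w X I \<longleftrightarrow> X \<subseteq> {x \<in> C. c x = c w} \<and>
     (\<forall>x\<in>X. successively A (w # I x @ [x]) \<and> distinct (w # I x) \<and>
        set (I x) \<subseteq> V - Res - C \<and> length (I x) + 2 \<le> l) \<and>
     (\<forall>x\<in>X. \<forall>y\<in>X. x \<noteq> y \<longrightarrow> set (I x) \<inter> set (I y) = {})"

lemma is_fanD:
  assumes "is_fan Res C w X I"
  shows "X \<subseteq> {x \<in> C. c x = c w}"
    "\<And>x. x \<in> X \<Longrightarrow> successively A (w # I x @ [x]) \<and> distinct (w # I x) \<and>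
       set (I x) \<subseteq> V - Res - C \<and> length (I x) + 2 \<le> l"
    "\<And>x y. x \<in> X \<Longrightarrow> y \<in> X \<Longrightarrow> x \<noteq> y \<Longrightarrow> set (I x) \<inter> set (I y) = {}"
  using assms unfolding is_fan_def by simp_all

lemma al: "a \<le> a * l" "l \<le> a * l" "2 * a \<le> a * l" "1 \<le> a * l"
  using a l by auto

text \<open>Deleting at most \<open>s\<close> neighbours would cut \<open>x\<close> off from another
  vertex of its class, of which \<open>s + 2\<close> vertices leave at least one.\<close>

lemma class_degree:
  assumes x: "x \<in> cls k" shows "s < card {u \<in> cls k. A x u}"
proof (rule ccontr)
  let ?U = "{u \<in> cls k. A x u}"
  assume "\<not> s < card ?U"
  then have U: "card ?U \<le> s" "finite ?U" using fin by auto
  have "card (insert x ?U) \<le> s + 1" using U card_insert_le_m1[of "Suc s" ?U x] by (simp add: card_insert_if)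
  then have "card (insert x ?U) < card (cls k)" using big[of k] x by fastforce
  then obtain y where y: "y \<in> cls k" "y \<noteq> x" "y \<notin> ?U" using many_not_in[of "insert x ?U"] U by blast
  have "x \<notin> ?U" using irreflA by (auto simp: irreflp_def)
  then obtain xs where xs: "path_in A (cls k - ?U) x xs y"
    using robust[of k, unfolded robust_def, rule_format, of ?U x y] U x y by blast
  then obtain u us where "xs = x # u # us"
    using y(2) unfolding path_in_def by (cases xs; cases "tl xs") auto
  then have "A x u" "u \<in> cls k - ?U" using xs unfolding path_in_def by auto
  then show False by auto
qed

lemma class_nbr:
  assumes "x \<in> cls k" "finite U" "card U \<le> s" obtains u where "u \<in> cls k" "A x u" "u \<notin> U"
proof -
  have "card U < card {u \<in> cls k. A x u}" using class_degree[OF assms(1)] assms(3) by linarith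
  then show ?thesis using many_not_in[OF assms(2)] that by blast
qed

lemma class_path:
  assumes "x \<in> cls k" "y \<in> cls k" "finite U" "card U \<le> s" "x \<notin> U" "y \<notin> U"
  obtains xs where "path_in A (cls k - U) x xs y" "length xs \<le> l"
  using robust[of k, unfolded robust_def, rule_format, of U x y] assms by blast

lemma consec_append:
  assumes "consec k xs" shows "consec k (xs @ ys)" "consec k (ys @ xs)"
proof -
  obtain us vs where uv: "xs = us @ vs" "us \<noteq> []" "vs \<noteq> []" "c (last us) = k" "c (hd vs) = k"
    using assms unfolding consec_def by blast
  show "consec k (xs @ ys)" unfolding consec_def
    using uv by (intro exI[of _ us] exI[of _ "vs @ ys"]) auto
  show "consec k (ys @ xs)" unfolding consec_def
    using uv by (intro exI[of _ "ys @ us"] exI[of _ vs]) auto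
qed

lemma class_card_mono:
  assumes "set xs \<subseteq> set xs'" shows "card {x \<in> set xs. c x = k} \<le> card {x \<in> set xs'. c x = k}"
  using assms by (intro card_mono) auto

text \<open>A detour inside class \<open>k\<close> has to avoid only \<open>Res\<close> and the few
  path vertices of this class. It is inserted between two vertices of class \<open>k\<close>, so
  consecutive pairs of other classes stay consecutive.\<close>

lemma grow_small_class:
  assumes path: "path_in E (V - Res) q xs v" and vis: "visits xs"
    and Res: "finite Res" "card Res \<le> 2 * l"
    and k: "k \<in> c ` V" "card {x \<in> set xs. c x = k} < a + 2"
  shows "extendable Res q xs v"
proof -
  obtain ys zs where yz: "xs = ys @ zs" "ys \<noteq> []" "zs \<noteq> []" "c (last ys) = k" "c (hd zs) = k"
    using vis k unfolding visits_def consec_def by fastforce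
  define U where "U = {x \<in> set xs. c x = k} \<union> Res"
  have fU: "finite U" using Res U_def by simp
  have "card U \<le> card {x \<in> set xs. c x = k} + card Res" unfolding U_def by (rule card_Un_le)
  also have "\<dots> \<le> a + 1 + 2 * l" using k Res by linarith
  also have "\<dots> \<le> s" using al unfolding s by linarith
  finally have cU: "card U \<le> s" .
  have xsV: "set xs \<subseteq> V - Res" using path unfolding path_in_def by auto
  have "last ys \<in> set xs" "hd zs \<in> set xs" using yz by auto
  then have lh: "last ys \<in> cls k" "hd zs \<in> cls k" using yz(4,5) xsV by auto
  obtain x' where x': "x' \<in> cls k" "A (last ys) x'" "x' \<notin> U" using class_nbr[OF lh(1) fU cU] .
  obtain y' where y': "y' \<in> cls k" "A (hd zs) y'" "y' \<notin> U" using class_nbr[OF lh(2) fU cU] .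
  obtain M where M: "path_in A (cls k - U) x' M y'" "length M \<le> l"
    using class_path[OF x'(1) y'(1) fU cU x'(3) y'(3)] .
  have M': "M \<noteq> []" "hd M = x'" "last M = y'" "distinct M" "successively A M" "set M \<subseteq> cls k - U"
    using M(1) unfolding path_in_def by auto
  have dis: "set M \<inter> set xs = {}" using M'(6) unfolding U_def by auto
  have "path_in E (V - Res) q (ys @ M @ zs) v"
  proof (rule path_in_detour)
    show "path_in E (V - Res) q (ys @ zs) v" using path yz by simp
    show "E (last ys) (hd M)" using AE x' M' by simp
    show "E (last M) (hd zs)" using AE y' M' symE by (auto simp: symp_def)
    show "successively E M" by (rule successively_mono[OF M'(5)]) (rule AE)
    show "set M \<inter> set (ys @ zs) = {}" using dis yz by simp
    show "set M \<subseteq> V - Res" using M'(6) unfolding U_def by auto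
  qed (use yz M' in auto)
  moreover have "visits (ys @ M @ zs)"
    unfolding visits_def
  proof
    fix j assume j: "j \<in> c ` V"
    have "card {x \<in> set xs. c x = j} \<le> card {x \<in> set (ys @ M @ zs). c x = j}"
      by (rule class_card_mono) (use yz in auto)
    moreover have "consec j (ys @ M @ zs)" if con: "consec j xs"
    proof (cases "j = k")
      case True
      have "c (hd M) = k" using M'(6) hd_in_set[OF M'(1)] by auto
      then have "hd (M @ zs) = hd M" "M @ zs \<noteq> []" using M'(1) by auto
      then have "ys @ M @ zs = ys @ (M @ zs) \<and> ys \<noteq> [] \<and> M @ zs \<noteq> [] \<and> c (last ys) = j \<and> c (hd (M @ zs)) = j"
        using yz(2,4) True \<open>c (hd M) = k\<close> by metis
      then show ?thesis unfolding consec_def by (intro exI)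
    next
      case False
      obtain us vs where uv: "xs = us @ vs" "us \<noteq> []" "vs \<noteq> []" "c (last us) = j" "c (hd vs) = j"
        using con unfolding consec_def by blast
      have "ys @ zs = us @ vs" using yz(1) uv(1) by simp
      then consider ts where "ys = us @ ts" "vs = ts @ zs" | ts where "us = ys @ ts" "zs = ts @ vs"
        unfolding append_eq_append_conv2 by metis
      then show ?thesis
      proof cases
        case 1
        then have "ts \<noteq> []" using uv(4,5) yz(4,5) False by auto
        then show ?thesis unfolding consec_def using uv(2-5) 1
          by (intro exI[of _ us] exI[of _ "ts @ M @ zs"] conjI) simp_all
      next
        case 2
        then have "ts \<noteq> []" using uv(4,5) yz(4,5) False by auto
        then show ?thesis unfolding consec_def using uv(2-5) 2
          by (intro exI[of _ "ys @ M @ ts"] exI[of _ vs] conjI) simp_all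
      qed
    qed
    ultimately show "a + 2 \<le> card {x \<in> set (ys @ M @ zs). c x = j} \<or> consec j (ys @ M @ zs)"
      using vis j unfolding visits_def by fastforce
  qed
  moreover have "length xs < length (ys @ M @ zs)" "length (ys @ M @ zs) \<le> length xs + 2 * l"
    using yz M(2) M'(1) by auto
  ultimately show ?thesis unfolding extendable_def by blast
qed

text \<open>The paths are found greedily: those present and \<open>Res\<close> have at most
  \<open>s\<close> vertices, so robustness leads from \<open>w\<close> to another vertex of
  \<open>C\<close> in the same class.\<close>

lemma fan:
  assumes w: "w \<in> V" "w \<notin> C" "w \<notin> Res" and C: "C \<subseteq> V - Res"
    and Res: "finite Res" "card Res \<le> 2 * l"
    and many: "a + 2 \<le> card {x \<in> C. c x = c w}" and m: "m \<le> a + 2"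
  shows "\<exists>X I. card X = m \<and> is_fan Res C w X I"
  using m
proof (induction m)
  case 0
  show ?case by (intro exI[of _ "{}"]) (auto simp: is_fan_def)
next
  case (Suc m)
  then have "m \<le> a + 2" by simp
  from Suc.IH[OF this] obtain X I where X1: "card X = m" and fan: "is_fan Res C w X I" by blast
  note I = is_fanD(2)[OF fan] and dis = is_fanD(3)[OF fan]
  have X: "card X = m" "X \<subseteq> {x \<in> C. c x = c w}" using X1 is_fanD(1)[OF fan] by auto
  have fC: "finite C" using C fin finite_subset by blast
  have fX: "finite X" by (rule finite_subset[OF X(2)]) (use fC in simp)
  define U where "U = Res \<union> (X \<union> (\<Union>x\<in>X. set (I x)))"
  have fU: "finite U" unfolding U_def using Res fX by auto
  have "card (\<Union>x\<in>X. set (I x)) \<le> (\<Sum>x\<in>X. card (set (I x)))" by (rule card_UN_le[OF fX])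
  also have "\<dots> \<le> (\<Sum>x\<in>X. l)"
  proof (rule sum_mono)
    fix x assume "x \<in> X"
    then show "card (set (I x)) \<le> l" using I card_length[of "I x"] by fastforce
  qed
  finally have "card (\<Union>x\<in>X. set (I x)) \<le> m * l" using X(1) by simp
  then have "card U \<le> 2 * l + (m + m * l)"
    unfolding U_def using Res X(1) card_Un_le[of Res "X \<union> (\<Union>x\<in>X. set (I x))"] card_Un_le[of X "\<Union>x\<in>X. set (I x)"]
    by linarith
  also have "\<dots> \<le> 2 * l + ((a + 1) + (a + 1) * l)" using Suc.prems by (intro add_mono mult_mono) auto
  also have "\<dots> = a * l + 3 * l + a + 1" by (simp add: algebra_simps)
  also have "\<dots> \<le> s" using al unfolding s by linarith
  finally have cU: "card U \<le> s" .
  have "X \<noteq> {x \<in> C. c x = c w}" using X(1) many Suc.prems by auto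
  then obtain y where y: "y \<in> C" "c y = c w" "y \<notin> X" using X(2) by blast
  have IC: "set (I x) \<subseteq> V - Res - C" "w \<notin> set (I x)" if "x \<in> X" for x using I[OF that] by auto
  have "y \<notin> Res" "y \<notin> (\<Union>x\<in>X. set (I x))" using y(1) C IC(1) by auto
  then have yU: "y \<notin> U" using y(3) unfolding U_def by simp
  have "w \<notin> X" "w \<notin> (\<Union>x\<in>X. set (I x))" using w(2) X(2) IC(2) by auto
  then have wU: "w \<notin> U" using w(3) unfolding U_def by simp
  have wy: "w \<in> cls (c w)" "y \<in> cls (c w)" using w y C by auto
  obtain P where P: "path_in A (cls (c w) - U) w P y" "length P \<le> l"
    using class_path[OF wy fU cU wU yU] .
  have P': "P \<noteq> []" "hd P = w" "last P = y" "distinct P" "successively A P" "set P \<subseteq> cls (c w) - U"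
    using P(1) unfolding path_in_def by auto
  \<comment> \<open>The path is cut off at its first vertex in \<open>C\<close>, which may come
    before \<open>y\<close>.\<close>
  have "\<exists>x\<in>set P. x \<in> C" using P'(1,3) y(1) last_in_set by blast
  from split_list_first_prop[OF this]
  obtain us x vs where sp: "P = us @ x # vs" "x \<in> C" "\<forall>u\<in>set us. u \<notin> C" by (elim exE conjE bexE)
  have "us \<noteq> []" using sp P'(2) w(2) by auto
  then obtain Ix where us: "us = w # Ix" using P'(2) sp by (cases us) auto
  have Peq: "P = (w # Ix @ [x]) @ vs" using sp us by simp
  have new: "successively A (w # Ix @ [x])" "distinct (w # Ix)"
    using P'(4,5) unfolding Peq by (auto simp: successively_append_iff simp del: append.simps) 
  have Ix: "set Ix \<subseteq> V - Res - C" "set Ix \<inter> U = {}" "x \<in> cls (c w)" "x \<notin> U" "length Ix + 2 \<le> l"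
    using P'(6) P(2) sp us unfolding U_def by auto
  have xX: "x \<notin> X" using Ix(4) unfolding U_def by auto
  let ?I = "I(x := Ix)"
  have "set (?I u) \<inter> set (?I v) = {}" if "u \<in> insert x X" "v \<in> insert x X" "u \<noteq> v" for u v
    using that dis xX Ix(2) unfolding U_def by auto
  moreover have "successively A (w # ?I u @ [u]) \<and> distinct (w # ?I u) \<and> set (?I u) \<subseteq> V - Res - C \<and>
      length (?I u) + 2 \<le> l" if "u \<in> insert x X" for u
    using that I xX new Ix by auto
  moreover have "card (insert x X) = Suc m" using X(1) xX fX by simp
  moreover have "insert x X \<subseteq> {x \<in> C. c x = c w}" using X(2) Ix(3) sp(2) by auto
  ultimately have "card (insert x X) = Suc m \<and> is_fan Res C w (insert x X) ?I"
    unfolding is_fan_def by (intro conjI ballI impI) simp_all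
  then show ?case by blast
qed

text \<open>At most one vertex of \<open>X\<close> is the last on the path, so at least
  \<open>a + 1\<close> have successors, and these cannot be independent. This is the origin of
  \<open>a + 2\<close>.\<close>

lemma adjacent_successors:
  assumes xs: "distinct xs" "set xs \<subseteq> V" and X: "X \<subseteq> set xs" "a + 2 \<le> card X"
  obtains i j where "i < j" "Suc j < length xs" "xs ! i \<in> X" "xs ! j \<in> X" "A (xs ! Suc i) (xs ! Suc j)"
proof -
  define J where "J = {i. Suc i < length xs \<and> xs ! i \<in> X}"
  have fJ: "finite J" unfolding J_def by (rule finite_subset[of _ "{..<length xs}"]) auto
  have "X \<subseteq> insert (last xs) ((\<lambda>i. xs ! i) ` J)"
  proof
    fix x assume x: "x \<in> X"
    then obtain i where i: "i < length xs" "xs ! i = x" using X(1) by (metis in_set_conv_nth subsetD)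
    show "x \<in> insert (last xs) ((\<lambda>i. xs ! i) ` J)"
    proof (cases "Suc i < length xs")
      case False
      then have "i = length xs - 1" using i by simp
      moreover have "xs \<noteq> []" using i by auto
      ultimately show ?thesis using i by (simp add: last_conv_nth)
    qed (use i x in \<open>auto simp: J_def\<close>)
  qed
  then have "card X \<le> card (insert (last xs) ((\<lambda>i. xs ! i) ` J))" by (rule card_mono[rotated]) (use fJ in auto)
  also have "\<dots> \<le> Suc (card ((\<lambda>i. xs ! i) ` J))" by (simp add: card_insert_if fJ)
  also have "\<dots> \<le> Suc (card J)" using card_image_le[OF fJ] by simp
  finally have cJ: "a < card J" using X(2) by simp
  define S where "S = (\<lambda>i. xs ! Suc i) ` J"
  have "inj_on (\<lambda>i. xs ! Suc i) J"
    using xs(1) unfolding inj_on_def J_def by (auto simp: nth_eq_iff_index_eq)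
  then have "card S = card J" unfolding S_def by (rule card_image)
  moreover have "S \<subseteq> V" using xs(2) unfolding S_def J_def by auto
  ultimately have "\<not> nonadj A S S" using indep[of S] cJ by fastforce
  then obtain i j where ij: "i \<in> J" "j \<in> J" "A (xs ! Suc i) (xs ! Suc j)" unfolding nonadj_def S_def by auto
  then have "i \<noteq> j" using irreflA by (auto simp: irreflp_def)
  then consider "i < j" | "j < i" by linarith
  then show ?thesis
  proof cases
    case 1 then show ?thesis using that[of i j] ij unfolding J_def by auto
  next
    case 2 then show ?thesis using that[of j i] ij symA unfolding J_def by (auto simp: symp_def)
  qed
qed

lemma grow_large_classes:
  assumes path: "path_in E (V - Res) q xs v"
    and Res: "finite Res" "card Res \<le> 2 * l"
    and large: "\<And>k. k \<in> c ` V \<Longrightarrow> a + 2 \<le> card {x \<in> set xs. c x = k}"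
    and w: "w \<in> V" "w \<notin> set xs" "w \<notin> Res"
  shows "extendable Res q xs v"
proof -
  have xs: "distinct xs" "set xs \<subseteq> V - Res" using path unfolding path_in_def by auto
  obtain X I where X1: "card X = a + 2" and fan: "is_fan Res (set xs) w X I"
    using fan[OF w xs(2) Res large[OF imageI[OF w(1)]] order_refl] by blast
  note I = is_fanD(2)[OF fan] and dis = is_fanD(3)[OF fan]
  have X: "card X = a + 2" "X \<subseteq> {x \<in> set xs. c x = c w}" using X1 is_fanD(1)[OF fan] by auto
  have "set xs \<subseteq> V" "X \<subseteq> set xs" using xs X(2) by auto
  then obtain i j where ij: "i < j" "Suc j < length xs" "xs ! i \<in> X" "xs ! j \<in> X" "A (xs ! Suc i) (xs ! Suc j)"
    using adjacent_successors[OF xs(1)] X(1) by (metis order_refl)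
  \<comment> \<open>The new path follows \<open>ys\<close> to \<open>xs ! i\<close>, passes through
    the fan by way of \<open>w\<close> to \<open>xs ! j\<close>, runs back along \<open>zs\<close>,
    and continues by the edge between the two successors with \<open>ws\<close>.\<close>
  define ys where "ys = take (Suc i) xs"
  define zs where "zs = take (j - i) (drop (Suc i) xs)"
  define ws where "ws = drop (Suc j) xs"
  have ne: "ys \<noteq> []" "zs \<noteq> []" "ws \<noteq> []" using ij unfolding ys_def zs_def ws_def by auto
  have ends: "last ys = xs ! i" "hd zs = xs ! Suc i" "last zs = xs ! j" "hd ws = xs ! Suc j"
    using ij unfolding ys_def zs_def ws_def
    by (auto simp: take_Suc_conv_app_nth last_conv_nth hd_drop_conv_nth min_def)
  have xs_eq: "xs = ys @ zs @ ws"
  proof -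
    have "drop (Suc i) xs = take (j - i) (drop (Suc i) xs) @ drop (j - i) (drop (Suc i) xs)"
      by (rule append_take_drop_id[symmetric])
    also have "drop (j - i) (drop (Suc i) xs) = drop (Suc j) xs" using ij by (simp add: drop_drop)
    finally show ?thesis unfolding ys_def zs_def ws_def by (metis append_take_drop_id)
  qed
  let ?x = "xs ! i" and ?y = "xs ! j"
  define M where "M = rev (I ?x) @ w # I ?y"
  have xy: "?x \<noteq> ?y" using ij xs(1) by (simp add: nth_eq_iff_index_eq)
  note Ix = I[OF ij(3)] and Iy = I[OF ij(4)]
  have sx: "successively A (?x # rev (I ?x) @ [w])"
  proof -
    have "successively (\<lambda>x y. A y x) (w # I ?x @ [?x])"
      by (rule successively_mono[of A]) (use Ix symA in \<open>auto simp: symp_def\<close>)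
    then have "successively A (rev (w # I ?x @ [?x]))" by (simp only: successively_rev)
    then show ?thesis by simp
  qed
  have sM: "successively A (?x # M @ [?y])"
  proof -
    have "successively A ((?x # rev (I ?x)) @ [w])" using sx by simp
    then have "successively A (?x # rev (I ?x))" "A (last (?x # rev (I ?x))) w"
      unfolding successively_append_iff by auto
    moreover have "successively A (w # I ?y @ [?y])" using Iy by blast
    ultimately have "successively A ((?x # rev (I ?x)) @ (w # I ?y @ [?y]))"
      unfolding successively_append_iff by simp
    then show ?thesis unfolding M_def by simp
  qed
  moreover have "M \<noteq> []" unfolding M_def by simp
  ultimately have "successively A M" "A ?x (hd M)" "A (last M) ?y"
    by (auto simp: successively_append_iff successively_Cons)
  have dM: "distinct M" using Ix Iy dis[OF ij(3,4) xy] unfolding M_def by auto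
  have dxs: "set M \<inter> set xs = {}" "set M \<subseteq> V - Res" using Ix Iy w unfolding M_def by auto
  have "path_in E (V - Res) q (ys @ M @ rev zs @ ws) v"
  proof (rule path_in_reroute)
    show "path_in E (V - Res) q (ys @ zs @ ws) v" using path xs_eq by simp
    show "successively E M" by (rule successively_mono[OF \<open>successively A M\<close>]) (rule AE)
    show "E (last ys) (hd M)" "E (last M) (last zs)" "E (hd zs) (hd ws)"
      using ends ij(5) \<open>A ?x (hd M)\<close> \<open>A (last M) ?y\<close> AE by auto
    show "M \<noteq> []" unfolding M_def by simp
    show "set M \<inter> set (ys @ zs @ ws) = {}" using dxs xs_eq by simp
  qed (use ne symE dM dxs in auto)
  moreover have "visits (ys @ M @ rev zs @ ws)"
    unfolding visits_def
  proof
    fix k assume "k \<in> c ` V"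
    then have "a + 2 \<le> card {x \<in> set xs. c x = k}" by (rule large)
    also have "\<dots> \<le> card {x \<in> set (ys @ M @ rev zs @ ws). c x = k}"
      by (rule class_card_mono) (subst xs_eq, auto)
    finally show "a + 2 \<le> card {x \<in> set (ys @ M @ rev zs @ ws). c x = k} \<or> consec k (ys @ M @ rev zs @ ws)" ..
  qed
  moreover have "length (ys @ M @ rev zs @ ws) = length xs + length M"
    using arg_cong[OF xs_eq, of length] by simp
  moreover have "0 < length M" "length M \<le> 2 * l" using Ix Iy unfolding M_def by auto
  ultimately show ?thesis unfolding extendable_def
    by (metis less_add_same_cancel1 nat_add_left_cancel_le)
qed

lemma grow:
  assumes path: "path_in E (V - Res) q xs v" and vis: "visits xs"
    and Res: "finite Res" "card Res \<le> 2 * l" and w: "w \<in> V" "w \<notin> set xs" "w \<notin> Res"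
  shows "extendable Res q xs v"
proof (cases "\<exists>k\<in>c ` V. card {x \<in> set xs. c x = k} < a + 2")
  case True
  then show ?thesis using grow_small_class[OF path vis Res] by blast
next
  case False
  then show ?thesis using grow_large_classes[OF path Res _ w] by (meson not_less)
qed

text \<open>\<open>v\<close> is the hub of a wheel with rim path \<open>q # rs\<close>. A path from
  \<open>q\<close> to \<open>v\<close> off \<open>rs\<close> can be closed through any initial
  segment of \<open>rs\<close>, traversed backwards to \<open>q\<close>, so up to \<open>2 l\<close>
  missing vertices can be supplied exactly.\<close>

lemma cycles_from_path:
  assumes path: "path_in E (V - set rs) q xs0 v" "visits xs0"
    and rs: "distinct rs" "length rs = 2 * l" "set rs \<subseteq> V" "successively A (q # rs)" "\<And>x. x \<in> set (q # rs) \<Longrightarrow> A v x"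
    and N: "length xs0 \<le> N" "N \<le> card V"
  shows "has_cycle E V N"
proof -
  define ok where "ok xs \<longleftrightarrow> path_in E (V - set rs) q xs v \<and> visits xs \<and> length xs \<le> N" for xs
  have "ok xs0" unfolding ok_def using path N by auto
  then obtain xs where xs: "ok xs" and max: "\<And>ys. ok ys \<Longrightarrow> length ys \<le> length xs"
    using ex_has_greatest_nat[of ok xs0 length "Suc N"] unfolding ok_def by (auto simp: less_Suc_eq_le)
  have Res: "finite (set rs)" "card (set rs) \<le> 2 * l" using rs(1,2) by (auto simp: distinct_card)
  have p: "xs \<noteq> []" "hd xs = q" "last xs = v" "distinct xs" "successively E xs" "set xs \<subseteq> V - set rs"
    using xs unfolding ok_def path_in_def by auto
  \<comment> \<open>A longest admissible path either exhausts the vertices off the rim, or its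
    extension by at most \<open>2 l\<close> vertices overshoots \<open>N\<close>.\<close>
  have "N - length xs \<le> 2 * l"
  proof (cases "V \<subseteq> set xs \<union> set rs")
    case True
    then have "card V \<le> card (set xs \<union> set rs)" by (intro card_mono) auto
    also have "\<dots> \<le> length xs + 2 * l"
      using card_Un_le[of "set xs" "set rs"] card_length[of xs] Res by linarith
    finally show ?thesis using N by simp
  next
    case False
    then obtain w where "w \<in> V" "w \<notin> set xs" "w \<notin> set rs" by auto
    then obtain ys where ys: "path_in E (V - set rs) q ys v" "visits ys" "length xs < length ys" "length ys \<le> length xs + 2 * l"
      using grow[of "set rs" q xs v w] xs Res unfolding ok_def extendable_def by blast
    then have "\<not> ok ys" using max by fastforce
    then show ?thesis using ys unfolding ok_def by linarith
  qed
  define j where "j = N - length xs"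
  define ts where "ts = take j rs"
  have j: "length ts = j" "length xs + j = N" using \<open>N - length xs \<le> 2 * l\<close> rs(2) xs unfolding ok_def ts_def j_def by auto
  have tsR: "set ts \<subseteq> set rs" unfolding ts_def by (rule set_take_subset)
  have dt: "distinct ts" unfolding ts_def using rs(1) by simp
  have "successively A (q # ts)"
    using rs(4) unfolding ts_def
    by (metis append_Cons append_take_drop_id successively_append_iff)
  then have "successively E (q # ts)" by (rule successively_mono) (rule AE)
  then have "successively (\<lambda>x y. E y x) (q # ts)"
    by (rule successively_mono) (use symE in \<open>auto simp: symp_def\<close>)
  then have "successively E (rev (q # ts))" by (simp only: successively_rev)
  then have sr: "successively E (rev ts @ [q])" by simp
  show ?thesis
    unfolding has_cycle_def
  proof (intro exI[of _ "xs @ rev ts"] conjI)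
    show "distinct (xs @ rev ts)" using p dt tsR by auto
    show "set (xs @ rev ts) \<subseteq> V" using p(6) tsR rs(3) by auto
    show "successively E (xs @ rev ts)"
    proof -
      have "E (last xs) (hd (rev ts))" if "ts \<noteq> []"
      proof -
        have "hd (rev ts) \<in> set rs" using that tsR by (metis hd_in_set rev_is_Nil_conv set_rev subsetD)
        then show ?thesis using rs(5) AE p(3) by auto
      qed
      then show ?thesis using p(5) sr by (auto simp: successively_append_iff)
    qed
    show "E (last (xs @ rev ts)) (hd (xs @ rev ts))"
    proof (cases "ts = []")
      case True
      then show ?thesis using p(1-3) rs(5)[of q] AE by simp
    next
      case False
      then show ?thesis using sr p(1,2) by (auto simp: successively_append_iff)
    qed
  qed (use p j in auto)
qed

text \<open>Each link has to avoid the links already made and the darts of later visits. A visit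
  thus costs \<open>l\<close> vertices for its link and 2 for its darts. A link lies in its class
  and has at least two vertices, whence the consecutive pair.\<close>

lemma link_pairs:
  assumes "ps \<noteq> []" "distinct (darts ps)" "set (darts ps) \<subseteq> V - U" "\<forall>p\<in>set ps. c (fst p) = c (snd p)"
    "successively (\<lambda>p q. E (snd p) (fst q)) ps" "finite U" "card U + (l + 2) * length ps \<le> s"
  shows "\<exists>xs. path_in E (V - U) (fst (hd ps)) xs (snd (last ps)) \<and> length xs \<le> l * length ps \<and>
    (\<forall>p\<in>set ps. consec (c (fst p)) xs)"
  using assms
proof (induction ps arbitrary: U rule: darts.induct)
  case (2 x y ps)
  let ?U = "U \<union> set (darts ps)"
  have "card ?U \<le> card U + 2 * length ps"
    using card_Un_le[of U "set (darts ps)"] card_length[of "darts ps"] by (simp add: length_darts)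
  also have "\<dots> \<le> s"
  proof -
    have "2 * length ps \<le> (l + 2) * length ((x, y) # ps)" by (intro mult_le_mono) auto
    then show ?thesis using 2(8) by linarith
  qed
  finally have cU: "card ?U \<le> s" "finite ?U" using 2(7) by auto
  have xy: "x \<in> cls (c x)" "y \<in> cls (c x)" "x \<notin> ?U" "y \<notin> ?U" "x \<noteq> y" using 2(3,4,5) by auto
  obtain P where P: "path_in A (cls (c x) - ?U) x P y" "length P \<le> l"
    using class_path[OF xy(1,2) cU(2,1) xy(3,4)] .
  have P': "P \<noteq> []" "hd P = x" "last P = y" "distinct P" "successively A P" "set P \<subseteq> cls (c x) - ?U"
    using P(1) unfolding path_in_def by auto
  have EP: "successively E P" by (rule successively_mono[OF P'(5)]) (rule AE)
  obtain u us where Pu: "P = x # u # us" using P' xy(5) by (cases P; cases "tl P") auto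
  have con: "consec (c x) P" unfolding consec_def
    by (intro exI[of _ "[x]"] exI[of _ "u # us"]) (use Pu P'(6) in auto)
  show ?case
  proof (cases "ps = []")
    case True
    have "path_in E (V - U) x P y" unfolding path_in_def using P' EP by auto
    then show ?thesis using True P(2) con by auto
  next
    case False
    have "card (U \<union> set P) \<le> card U + l" using card_Un_le[of U "set P"] card_length[of P] P(2) by linarith
    then have "card (U \<union> set P) + (l + 2) * length ps \<le> s" using 2(8) by simp
    moreover have "set (darts ps) \<subseteq> V - (U \<union> set P)" using 2(4) P'(6) by auto
    moreover have "successively (\<lambda>p q. E (snd p) (fst q)) ps" "E y (fst (hd ps))"
      using 2(6) False by (auto simp: successively_Cons)
    ultimately obtain R where R: "path_in E (V - (U \<union> set P)) (fst (hd ps)) R (snd (last ps))"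
      "length R \<le> l * length ps" "\<forall>p\<in>set ps. consec (c (fst p)) R"
      using 2(1)[of "U \<union> set P"] False 2(3,5,7) by auto
    have "path_in E (V - U) x (P @ R) (snd (last ps))"
      using R(1) P' EP \<open>E y (fst (hd ps))\<close> unfolding path_in_def by (auto simp: successively_append_iff)
    moreover have "length (P @ R) \<le> l * length ((x, y) # ps)" using R(2) P(2) by simp
    moreover have "\<forall>p\<in>set ((x, y) # ps). consec (c (fst p)) (P @ R)"
      using con R(3) consec_append by auto
    ultimately show ?thesis using False by auto
  qed
qed simp

text \<open>A wheel with hub \<open>v\<close> and first rim vertex \<open>q\<close> is reserved off
  both matchings. The edge between \<open>q\<close> and \<open>v\<close> joins the Eulerian system
  as a loop at their common class: parities are unchanged, and a closed trail started at
  \<open>q\<close> makes its last exit at \<open>v\<close>. Linking its visits gives a path from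
  \<open>q\<close> to \<open>v\<close> through all classes, even if there is only one class.\<close>

theorem long_cycles:
  assumes V: "V \<noteq> {}"
    and X1: "pairing E X1 \<phi>1" "X1 \<subseteq> V" "card X1 \<le> 4 * a" "linked c X1 \<phi>1 (c ` V)"
    and X2: "pairing E X2 \<phi>2" "X2 \<subseteq> V" "card X2 \<le> 4 * a" "linked c X2 \<phi>2 (c ` V)"
    and dis: "X1 \<inter> X2 = {}" and N: "5 * a * l \<le> N" "N \<le> card V"
  shows "has_cycle E V N"
proof -
  obtain v0 where v0: "v0 \<in> V" using V by blast
  define k where "k = c v0"
  have kV: "k \<in> c ` V" using v0 k_def by auto
  have f12: "finite (X1 \<union> X2)" using X1 X2 unfolding pairing_def by auto
  have c12: "card (X1 \<union> X2) \<le> 8 * a" using card_Un_le[of X1 X2] X1(3) X2(3) by linarith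
  have "8 * a \<le> s" using al unfolding s by linarith
  then have "card (X1 \<union> X2) < card (cls k)" using big[OF kV] c12 by linarith
  then obtain v where v: "v \<in> cls k" "v \<notin> X1 \<union> X2" using many_not_in[OF f12] by blast
  define S where "S = {u \<in> cls k. A v u} - (X1 \<union> X2)"
  have "card {u \<in> cls k. A v u} \<le> card (S \<union> (X1 \<union> X2))"
    by (rule card_mono) (use f12 fin S_def in auto)
  then have "s < card S + 8 * a" using class_degree[OF v(1)] c12 card_Un_le[of S "X1 \<union> X2"] by linarith
  moreover have "a * (2 * l) + 8 * a \<le> s" using al unfolding s by simp
  ultimately have "a * (2 * l) < card S" by linarith
  then obtain qs where qs: "length qs = Suc (2 * l)" "set qs \<subseteq> S" "sorted_wrt (<) qs" "successively A qs"
    using increasing_path[of S A a "2 * l"] fin symA irreflA indep S_def by (metis (no_types, lifting) Diff_subset finite_Diff finite_subset mem_Collect_eq subsetI subset_trans)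
  then obtain q rs where q: "qs = q # rs" by (cases qs) auto
  have rs: "distinct (q # rs)" "length rs = 2 * l" "set (q # rs) \<subseteq> S"
    using qs q strict_sorted_iff by auto
  have SV: "S \<subseteq> V" and Sc: "\<And>x. x \<in> S \<Longrightarrow> c x = k" and SA: "\<And>x. x \<in> S \<Longrightarrow> A v x"
    and SX: "S \<inter> (X1 \<union> X2) = {}" unfolding S_def by auto
  have vS: "v \<notin> S" using SA irreflA by (auto simp: irreflp_def)
  have cX: "c ` X1 \<subseteq> c ` V" "c ` X2 \<subseteq> c ` V" using X1(2) X2(2) by auto
  obtain D where D: "D \<subseteq> X2" "\<phi>2 ` D \<subseteq> D" and ev: "\<And>j. even (card {x \<in> X1 \<union> D. c x = j})"
    using even_fibers[OF X1(1) cX(1) X2(1) cX(2) X2(4) dis] fin by blast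
  define X where "X = X1 \<union> D \<union> {q, v}"
  define \<phi> where "\<phi> x = (if x \<in> X1 then \<phi>1 x else if x \<in> X2 then \<phi>2 x else if x = q then v else q)" for x
  have qS: "q \<in> S" using rs by auto
  have qv: "q \<noteq> v" "q \<notin> X1" "q \<notin> X2" "v \<notin> X1" "v \<notin> X2" using qS vS SX v(2) by auto
  have Evq: "E v q" "E q v" using SA[OF qS] AE symE by (auto simp: symp_def)
  have \<phi>1: "\<phi>1 x \<in> X1" "\<phi>1 (\<phi>1 x) = x" "\<phi>1 x \<noteq> x" "E x (\<phi>1 x)" if "x \<in> X1" for x
    using X1(1) that unfolding pairing_def by auto
  have \<phi>2: "\<phi>2 x \<in> X2" "\<phi>2 (\<phi>2 x) = x" "\<phi>2 x \<noteq> x" "E x (\<phi>2 x)" if "x \<in> X2" for x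
    using X2(1) that unfolding pairing_def by auto
  have n12: "x \<notin> X1" if "x \<in> X2" for x using dis that by auto
  have pX: "pairing E X \<phi>"
    unfolding pairing_def
  proof (intro conjI ballI)
    show "finite X" unfolding X_def using f12 D(1) finite_subset by auto
    fix x assume "x \<in> X"
    then consider "x \<in> X1" | "x \<in> D" | "x = q" | "x = v" unfolding X_def by auto
    then have "\<phi> x \<in> X \<and> \<phi> (\<phi> x) = x \<and> \<phi> x \<noteq> x \<and> E x (\<phi> x)"
    proof cases
      case 1
      then show ?thesis using \<phi>1[OF 1] unfolding X_def \<phi>_def by auto
    next
      case 2
      then have "x \<in> X2" "x \<notin> X1" "\<phi>2 x \<in> D" "\<phi>2 x \<notin> X1" using D n12 by auto
      then show ?thesis using \<phi>2[of x] unfolding X_def \<phi>_def by auto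
    next
      case 3
      then show ?thesis using qv Evq unfolding X_def \<phi>_def by auto
    next
      case 4
      then show ?thesis using qv Evq unfolding X_def \<phi>_def by auto
    qed
    then show "\<phi> x \<in> X" "\<phi> (\<phi> x) = x" "\<phi> x \<noteq> x" "E x (\<phi> x)" by auto
  qed
  have cq: "c q = k" "c v = k" using Sc qS v by auto
  have evX: "even (card {x \<in> X. c x = j})" for j
  proof -
    have "{x \<in> X. c x = j} = {x \<in> X1 \<union> D. c x = j} \<union> (if j = k then {q, v} else {})"
      unfolding X_def using cq by auto
    moreover have "card \<dots> = card {x \<in> X1 \<union> D. c x = j} + card (if j = k then {q, v} else {})"
      by (rule card_Un_disjoint) (use f12 D(1) qv finite_subset[OF D(1)] in auto)
    ultimately show ?thesis using ev[of j] qv(1) by auto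
  qed
  have XV: "X \<subseteq> V" unfolding X_def using X1(2) X2(2) D(1) qS SV v by auto
  have cover: "c ` V \<subseteq> c ` X"
  proof
    fix j assume j: "j \<in> c ` V"
    show "j \<in> c ` X"
    proof (cases "j = k")
      case True
      then show ?thesis using cq unfolding X_def by auto
    next
      case False
      then have "{j} \<inter> c ` V \<noteq> {}" "\<not> c ` V \<subseteq> {j}" using j kV by auto
      then obtain x where "x \<in> X1" "c x \<in> {j}" using X1(4)[unfolded linked_def, rule_format, of "{j}"] by blast
      then show ?thesis unfolding X_def by auto
    qed
  qed
  then have cXV: "c ` X = c ` V" using XV by auto
  have "linked c X \<phi> (c ` X)"
    unfolding linked_def cXV
  proof (intro allI impI)
    fix S assume "S \<inter> c ` V \<noteq> {} \<and> \<not> c ` V \<subseteq> S"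
    then obtain x where "x \<in> X1" "c x \<in> S" "c (\<phi>1 x) \<notin> S" using X1(4)[unfolded linked_def, rule_format, of S] by blast
    then show "\<exists>x\<in>X. c x \<in> S \<and> c (\<phi> x) \<notin> S" unfolding X_def \<phi>_def by (intro bexI[of _ x]) auto
  qed
  moreover have "q \<in> X" unfolding X_def by simp
  ultimately obtain ps where ps: "trail c \<phi> X q ps" "snd (last ps) = \<phi> q" "c ` set (darts ps) = c ` X"
    using euler_trail[OF pX evX] by metis
  have tr: "ps \<noteq> []" "fst (hd ps) = q" "distinct (darts ps)" "set (darts ps) \<subseteq> X"
    "\<forall>p\<in>set ps. c (fst p) = c (snd p)" "successively (\<lambda>p q. fst q = \<phi> (snd p)) ps"
    using ps(1) unfolding trail_def by auto
  have lastv: "snd (last ps) = v" using ps(2) qv unfolding \<phi>_def by simp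
  have "2 * length ps = card (set (darts ps))" using tr(3) by (simp add: distinct_card length_darts)
  also have "\<dots> \<le> card X" using tr(4) pX unfolding pairing_def by (intro card_mono) auto
  also have "\<dots> \<le> card (X1 \<union> X2 \<union> {q, v})"
    by (rule card_mono) (use f12 D(1) X_def in auto)
  also have "\<dots> \<le> 8 * a + 2" using card_Un_le[of "X1 \<union> X2" "{q, v}"] c12 qv(1) by simp
  \<comment> \<open>At most \<open>4 a + 1\<close> visits, and \<open>1 \<le> a\<close>. With links
    of at most \<open>l\<close> vertices this is the origin of the bound
    \<open>5 * a * l\<close>.\<close>
  finally have lps: "length ps \<le> 5 * a" using a by linarith
  have sE: "successively (\<lambda>p q. E (snd p) (fst q)) ps"
  proof (rule successively_mono[OF tr(6)])
    fix p q' assume p: "p \<in> set ps" "fst q' = \<phi> (snd p)"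
    then have "snd p \<in> X" using tr(4) unfolding set_darts by auto
    then show "E (snd p) (fst q')" using p(2) pX unfolding pairing_def by auto
  qed
  have av: "set (darts ps) \<subseteq> V - set rs"
  proof -
    have "X \<inter> set rs = {}" unfolding X_def using rs SX D(1) vS by auto
    then show ?thesis using tr(4) XV by auto
  qed
  have "(l + 2) * length ps \<le> (l + 2) * (5 * a)" using lps by (rule mult_le_mono2)
  moreover have "card (set rs) = 2 * l" using rs by (simp add: distinct_card)
  moreover have "2 * l + (l + 2) * (5 * a) = 2 * l + 5 * (a * l) + 10 * a" by (simp add: algebra_simps)
  then have "2 * l + (l + 2) * (5 * a) \<le> s" using al unfolding s by linarith
  ultimately have "card (set rs) + (l + 2) * length ps \<le> s" by linarith
  then obtain xs0 where xs0: "path_in E (V - set rs) q xs0 v" "length xs0 \<le> l * length ps"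
    "\<forall>p\<in>set ps. consec (c (fst p)) xs0"
    using link_pairs[OF tr(1,3) av tr(5) sE, of ] tr(2) lastv by auto
  have "visits xs0"
    unfolding visits_def
  proof
    fix j assume "j \<in> c ` V"
    then have "j \<in> c ` set (darts ps)" using ps(3) cXV by simp
    then obtain p where "p \<in> set ps" "c (fst p) = j" using tr(5) unfolding set_darts by auto
    then show "a + 2 \<le> card {x \<in> set xs0. c x = j} \<or> consec j xs0" using xs0(3) by auto
  qed
  moreover have "length xs0 \<le> N"
  proof -
    have "l * length ps \<le> l * (5 * a)" using lps by (rule mult_le_mono2)
    also have "\<dots> = 5 * a * l" by simp
    finally show ?thesis using xs0(2) N(1) by linarith
  qed
  moreover have "set rs \<subseteq> V" using rs SV by auto
  moreover have "successively A (q # rs)" using qs q by simp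
  moreover have "A v x" if "x \<in> set (q # rs)" for x using that rs SA by blast
  ultimately show ?thesis using cycles_from_path[OF xs0(1)] rs N by auto
qed

end

section \<open>From matchings between pieces to matchings between classes\<close>

lemma pairing_mono:
  assumes "pairing E X \<phi>" "\<And>x y. x \<in> X \<Longrightarrow> E x y \<Longrightarrow> E' x y" shows "pairing E' X \<phi>"
  using assms unfolding pairing_def by blast

lemma has_cycle_mono:
  assumes "has_cycle A V N" "\<And>x y. A x y \<Longrightarrow> E x y" shows "has_cycle E V N"
proof -
  obtain vs where vs: "vs \<noteq> []" "length vs = N" "distinct vs" "set vs \<subseteq> V" "successively A vs"
    "A (last vs) (hd vs)"
    using assms(1) unfolding has_cycle_def by blast
  have "successively E vs" by (rule successively_mono[OF vs(5)]) (rule assms(2))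
  then show ?thesis unfolding has_cycle_def using vs assms(2) by blast
qed

text \<open>If the inner end of a crossing edge were used, its unique partner would be used too and
  lie in a reached class. Hence every crossing edge of a matching is available to the tree.\<close>

lemma coarse_tree:
  assumes "finite J" "j0 \<in> J" "symp M"
    and matching: "\<And>x y z. M x y \<Longrightarrow> M x z \<Longrightarrow> y = z"
    and cross: "\<And>S. S \<inter> J \<noteq> {} \<Longrightarrow> \<not> J \<subseteq> S \<Longrightarrow> \<exists>x y. M x y \<and> h x \<in> S \<and> h y \<in> J - S"
  obtains F \<psi> where "pairing M F \<psi>" "card F \<le> 2 * card J" "linked h F \<psi> J"
proof -
  have step: "\<exists>x y. M x y \<and> h x \<in> Y \<and> h y \<in> J - Y \<and> x \<notin> U"
    if Y: "j0 \<in> Y" "Y \<subset> J" and U: "h ` U \<subseteq> Y" "\<forall>x\<in>U. \<exists>z\<in>U. M x z" for Y U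
  proof -
    have "Y \<inter> J \<noteq> {}" "\<not> J \<subseteq> Y" using Y assms(2) by auto
    then obtain x y where xy: "M x y" "h x \<in> Y" "h y \<in> J - Y" using cross by blast
    have "x \<notin> U"
    proof
      assume "x \<in> U"
      then obtain z where "z \<in> U" "M x z" using U(2) by blast
      then have "y \<in> U" using matching[OF xy(1)] by blast
      then show False using U(1) xy(3) by blast
    qed
    then show ?thesis using xy by blast
  qed
  obtain F \<psi> where "pairing M F \<psi>" "card F \<le> 2 * card J" "h ` F \<subseteq> J" "linked h F \<psi> J"
    by (rule spanning_tree_matching[OF assms(1-3), of h]) (use step in auto)
  then show ?thesis using that by blast
qed

context robust_partition
begin

text \<open>If a coarse piece is only partly reached, its connectivity gives an edge of
  \<open>A\<close> that avoids \<open>W\<close> and all used vertices, at most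
  \<open>8 a + 4 a < 20 a\<close> in number. Otherwise the reached classes make up whole pieces, and
  an edge of \<open>F\<close> leaves them.\<close>

lemma fine_tree:
  assumes g: "\<And>j. j \<in> g ` c ` V \<Longrightarrow> unsplittable A (20 * a) {v \<in> V. g (c v) = j}"
    and K: "card (c ` V) \<le> 2 * a" and V: "V \<noteq> {}"
    and F: "pairing E F \<psi>" "F \<subseteq> V" "linked (\<lambda>x. g (c x)) F \<psi> (g ` c ` V)"
    and W: "finite W" "card W \<le> 8 * a" "F \<subseteq> W"
  obtains X \<phi> where "pairing E X \<phi>" "X \<subseteq> V" "card X \<le> 4 * a" "linked c X \<phi> (c ` V)" "X \<inter> W \<subseteq> F"
proof -
  define E' where "E' x y \<longleftrightarrow> (A x y \<and> x \<in> V \<and> y \<in> V \<and> x \<notin> W \<and> y \<notin> W) \<or> (x \<in> F \<and> y = \<psi> x)" for x y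
  have inv: "\<psi> x \<in> F" "\<psi> (\<psi> x) = x" if "x \<in> F" for x using F(1) that unfolding pairing_def by auto
  have sym': "symp E'" using symA inv unfolding E'_def symp_def by auto
  obtain k0 where k0: "k0 \<in> c ` V" using V by blast
  have step: "\<exists>x y. E' x y \<and> c x \<in> Y \<and> c y \<in> c ` V - Y \<and> x \<notin> U"
    if Y: "k0 \<in> Y" "Y \<subset> c ` V" and U: "finite U" "card U \<le> 2 * card (c ` V)" "c ` U \<subseteq> Y" "\<forall>x\<in>U. \<exists>z\<in>U. E' x z"
    for Y U
  proof (cases "\<exists>k1\<in>Y. \<exists>k2\<in>c ` V - Y. g k1 = g k2")
    case True
    then obtain k1 k2 where k: "k1 \<in> Y" "k2 \<in> c ` V - Y" "g k1 = g k2" by blast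
    have kV: "k1 \<in> c ` V" "k2 \<in> c ` V" using k Y by auto
    define B where "B = W \<union> U"
    have cB: "card B \<le> 12 * a" unfolding B_def using card_Un_le[of W U] W(2) U(2) K by linarith
    have fB: "finite B" unfolding B_def using W U by simp
    let ?P = "{v \<in> V. g (c v) = g k1}"
    let ?X = "{v \<in> ?P - B. c v \<in> Y}" and ?Z = "{v \<in> ?P - B. c v \<notin> Y}"
    have "12 * a \<le> s" using al unfolding s by linarith
    then have lt: "card B < card (cls k1)" "card B < card (cls k2)" using big[OF kV(1)] big[OF kV(2)] cB by linarith+
    obtain u1 where "u1 \<in> cls k1" "u1 \<notin> B" using many_not_in[OF fB lt(1)] by blast
    then have Xne: "?X \<noteq> {}" using k(1) by blast
    obtain u2 where "u2 \<in> cls k2" "u2 \<notin> B" using many_not_in[OF fB lt(2)] by blast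
    then have Zne: "?Z \<noteq> {}" using k(2,3) by fastforce
    have us: "unsplittable A (20 * a) ?P" using g kV(1) by blast
    have "card B < 20 * a" using cB a by linarith
    then have "\<not> nonadj A ?X ?Z" by (rule unsplittableD[OF us fB _ Xne Zne]) auto
    then obtain x y where xy: "x \<in> ?X" "y \<in> ?Z" "A x y" unfolding nonadj_def by blast
    then have "E' x y" "x \<notin> U" "c x \<in> Y" "c y \<in> c ` V - Y" unfolding E'_def B_def by auto
    then show ?thesis by blast
  next
    case False
    let ?S = "g ` Y"
    have "?S \<inter> g ` c ` V \<noteq> {}" using Y k0 by blast
    moreover have "\<not> g ` c ` V \<subseteq> ?S"
    proof -
      obtain k where "k \<in> c ` V - Y" using Y(2) by blast
      then have "g k \<in> g ` c ` V" "g k \<notin> ?S" using False by (blast, metis imageE)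
      then show ?thesis by blast
    qed
    ultimately obtain x where x: "x \<in> F" "g (c x) \<in> ?S" "g (c (\<psi> x)) \<notin> ?S"
      using F(3)[unfolded linked_def, rule_format, of ?S] by blast
    have V': "x \<in> V" "\<psi> x \<in> V" using x(1) inv F(2) by auto
    have cx: "c x \<in> Y"
    proof (rule ccontr)
      assume "c x \<notin> Y"
      then have "c x \<in> c ` V - Y" using V' by blast
      then show False using False x(2) by (metis imageE)
    qed
    have cy: "c (\<psi> x) \<in> c ` V - Y" using x(3) V' by blast
    have "x \<notin> U"
    proof
      assume "x \<in> U"
      then obtain z where z: "z \<in> U" "E' x z" using U(4) by blast
      then have "z = \<psi> x" using x(1) W(3) unfolding E'_def by blast
      then show False using z(1) U(3) cy by blast
    qed
    moreover have "E' x (\<psi> x)" using x(1) unfolding E'_def by simp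
    ultimately show ?thesis using cx cy by blast
  qed
  obtain X \<phi> where X: "pairing E' X \<phi>" "card X \<le> 2 * card (c ` V)" "c ` X \<subseteq> c ` V" "linked c X \<phi> (c ` V)"
    by (rule spanning_tree_matching[OF finite_imageI[OF fin] k0 sym', of c]) (use step in auto)
  have "E x y" if "E' x y" for x y
    using that AE F(1) unfolding E'_def pairing_def by blast
  then have "pairing E X \<phi>" using pairing_mono[OF X(1)] by blast
  moreover have "x \<in> V \<and> (x \<in> W \<longrightarrow> x \<in> F)" if "x \<in> X" for x
  proof -
    have "E' x (\<phi> x)" using X(1) that unfolding pairing_def by blast
    then show ?thesis using F(2) unfolding E'_def by blast
  qed
  ultimately show ?thesis using that[of X \<phi>] X(2,4) K by fastforce
qed

text \<open>Thinning both matchings to trees on the pieces leaves only O(a) vertices to be avoided.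
  Either completion avoids the tree of the other, and the second also avoids the first completion,
  so the two systems stay disjoint. Lengths below \<open>5 * a * l\<close> come from a
  wheel.\<close>

theorem all_cycles:
  assumes g: "\<And>j. j \<in> g ` c ` V \<Longrightarrow> unsplittable A (20 * a) {v \<in> V. g (c v) = j}"
    and K: "card (c ` V) \<le> 2 * a" "card (g ` c ` V) \<le> a" and V: "V \<noteq> {}"
    and deg: "\<And>v. v \<in> V \<Longrightarrow> 5 * a * a * l < card {u \<in> V. A v u}"
    and M: "symp M1" "symp M2" "\<And>x y. M1 x y \<or> M2 x y \<Longrightarrow> E x y \<and> x \<in> V"
      "\<And>x y z. M1 x y \<Longrightarrow> M1 x z \<Longrightarrow> y = z" "\<And>x y z. M2 x y \<Longrightarrow> M2 x z \<Longrightarrow> y = z"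
      "\<And>x y z. M1 x y \<Longrightarrow> M2 x z \<Longrightarrow> False"
    and cross1: "\<And>S. S \<inter> g ` c ` V \<noteq> {} \<Longrightarrow> \<not> g ` c ` V \<subseteq> S \<Longrightarrow> \<exists>x y. M1 x y \<and> g (c x) \<in> S \<and> g (c y) \<notin> S"
    and cross2: "\<And>S. S \<inter> g ` c ` V \<noteq> {} \<Longrightarrow> \<not> g ` c ` V \<subseteq> S \<Longrightarrow> \<exists>x y. M2 x y \<and> g (c x) \<in> S \<and> g (c y) \<notin> S"
    and N: "3 \<le> N" "N \<le> card V"
  shows "has_cycle E V N"
proof -
  let ?J = "g ` c ` V" and ?h = "\<lambda>x. g (c x)"
  obtain j0 where j0: "j0 \<in> ?J" using V by blast
  have MV: "x \<in> V" "y \<in> V" if "M1 x y \<or> M2 x y" for x y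
    using that M(1-3) unfolding symp_def by blast+
  have fJ: "finite ?J" using fin by simp
  obtain F1 \<psi>1 where F1: "pairing M1 F1 \<psi>1" "card F1 \<le> 2 * card ?J" "linked ?h F1 \<psi>1 ?J"
  proof (rule coarse_tree[OF fJ j0 M(1) M(4), where h = ?h])
    fix S assume "S \<inter> ?J \<noteq> {}" "\<not> ?J \<subseteq> S"
    then obtain x y where "M1 x y" "?h x \<in> S" "?h y \<notin> S" using cross1 by blast
    then show "\<exists>x y. M1 x y \<and> ?h x \<in> S \<and> ?h y \<in> ?J - S" using MV by blast
  qed
  obtain F2 \<psi>2 where F2: "pairing M2 F2 \<psi>2" "card F2 \<le> 2 * card ?J" "linked ?h F2 \<psi>2 ?J"
  proof (rule coarse_tree[OF fJ j0 M(2) M(5), where h = ?h])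
    fix S assume "S \<inter> ?J \<noteq> {}" "\<not> ?J \<subseteq> S"
    then obtain x y where "M2 x y" "?h x \<in> S" "?h y \<notin> S" using cross2 by blast
    then show "\<exists>x y. M2 x y \<and> ?h x \<in> S \<and> ?h y \<in> ?J - S" using MV by blast
  qed
  have E1: "pairing E F1 \<psi>1" by (rule pairing_mono[OF F1(1)]) (use M(3) in blast)
  have E2: "pairing E F2 \<psi>2" by (rule pairing_mono[OF F2(1)]) (use M(3) in blast)
  have FV: "F1 \<subseteq> V" "F2 \<subseteq> V" using F1(1) F2(1) MV unfolding pairing_def by blast+
  have F12: "F1 \<inter> F2 = {}" using F1(1) F2(1) M(6) unfolding pairing_def by blast
  have fF: "finite F1" "finite F2" using F1 F2 unfolding pairing_def by auto
  have cF: "card (F1 \<union> F2) \<le> 4 * a" using card_Un_le[of F1 F2] F1(2) F2(2) K(2) by linarith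
  obtain X1 \<phi>1 where X1: "pairing E X1 \<phi>1" "X1 \<subseteq> V" "card X1 \<le> 4 * a" "linked c X1 \<phi>1 (c ` V)"
    "X1 \<inter> (F1 \<union> F2) \<subseteq> F1"
    by (rule fine_tree[OF g K(1) V E1 FV(1) F1(3), of "F1 \<union> F2"]) (use fF cF in auto)
  have "card (F1 \<union> F2 \<union> X1) \<le> 8 * a" using card_Un_le[of "F1 \<union> F2" X1] cF X1(3) by linarith
  moreover have "finite X1" using X1(1) unfolding pairing_def by simp
  ultimately obtain X2 \<phi>2 where X2: "pairing E X2 \<phi>2" "X2 \<subseteq> V" "card X2 \<le> 4 * a" "linked c X2 \<phi>2 (c ` V)"
    "X2 \<inter> (F1 \<union> F2 \<union> X1) \<subseteq> F2"
    using fine_tree[OF g K(1) V E2 FV(2) F2(3), of "F1 \<union> F2 \<union> X1"] fF by auto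
  have dis: "X1 \<inter> X2 = {}" using X1(5) X2(5) F12 by blast
  show ?thesis
  proof (cases "5 * a * l \<le> N")
    case True
    then show ?thesis using long_cycles[OF V X1(1-4) X2(1-4) dis _ N(2)] by simp
  next
    case False
    obtain v where v: "v \<in> V" using V by blast
    have "a * (5 * a * l) < card {u \<in> V. A v u}" using deg[OF v] by (simp add: algebra_simps)
    then have "has_cycle A V N"
      using wheel_cycle[OF fin symA irreflA indep v _ N(1)] False by simp
    then show ?thesis using has_cycle_mono AE by blast
  qed
qed

end

section \<open>Random graphs\<close>

lemma finite_all_pairs [simp]: "finite (all_pairs n)"
  by (rule finite_subset[of _ "Pow {0..<n}"]) (auto simp: all_pairs_def)

lemma pair_in_all_pairs: "{x, y} \<in> all_pairs n \<longleftrightarrow> x < n \<and> y < n \<and> x \<noteq> y"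
  unfolding all_pairs_def by (auto simp: card_2_iff')

lemma prob_random_graph:
  "measure_pmf.prob (random_graph n p) {R. P R} =
   measure_pmf.prob (Pi_pmf (all_pairs n) False (\<lambda>_. bernoulli_pmf p)) {f. P {e \<in> all_pairs n. f e}}"
  unfolding random_graph_def by (simp add: vimage_def)

lemma prob_avoid:
  assumes "0 \<le> p" "p \<le> 1" "K \<subseteq> all_pairs n"
  shows "measure_pmf.prob (random_graph n p) {R. R \<inter> K = {}} = (1 - p) ^ card K"
proof -
  have "{f. {e \<in> all_pairs n. f e} \<inter> K = {}} = Pi (all_pairs n) (\<lambda>e. if e \<in> K then {False} else UNIV)"
    using assms(3) by (auto simp: Pi_def split: if_splits)
  then have "measure_pmf.prob (random_graph n p) {R. R \<inter> K = {}} =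
      (\<Prod>e\<in>all_pairs n. measure_pmf.prob (bernoulli_pmf p) (if e \<in> K then {False} else UNIV))"
    unfolding prob_random_graph by (simp add: measure_Pi_pmf_Pi)
  also have "\<dots> = (\<Prod>e\<in>all_pairs n. if e \<in> K then 1 - p else 1)"
    using assms by (intro prod.cong) (auto simp: measure_pmf_single)
  also have "\<dots> = (\<Prod>e\<in>K. 1 - p)"
    using assms(3) by (subst prod.inter_restrict[symmetric]) (auto simp: Int_absorb1)
  finally show ?thesis by simp
qed

lemma prob_contain:
  assumes "0 \<le> p" "p \<le> 1" "K \<subseteq> all_pairs n"
  shows "measure_pmf.prob (random_graph n p) {R. K \<subseteq> R} = p ^ card K"
proof -
  have "{f. K \<subseteq> {e \<in> all_pairs n. f e}} = Pi (all_pairs n) (\<lambda>e. if e \<in> K then {True} else UNIV)"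
    using assms(3) by (auto simp: Pi_def split: if_splits)
  then have "measure_pmf.prob (random_graph n p) {R. K \<subseteq> R} =
      (\<Prod>e\<in>all_pairs n. measure_pmf.prob (bernoulli_pmf p) (if e \<in> K then {True} else UNIV))"
    unfolding prob_random_graph by (simp add: measure_Pi_pmf_Pi)
  also have "\<dots> = (\<Prod>e\<in>all_pairs n. if e \<in> K then p else 1)"
    using assms by (intro prod.cong) (auto simp: measure_pmf_single)
  also have "\<dots> = (\<Prod>e\<in>K. p)"
    using assms(3) by (subst prod.inter_restrict[symmetric]) (auto simp: Int_absorb1)
  finally show ?thesis by simp
qed

lemma bernoulli_thinning:
  assumes "0 \<le> p" "p \<le> q" "q \<le> 1"
  shows "bernoulli_pmf p =
    bind_pmf (bernoulli_pmf q) (\<lambda>b. if b then bernoulli_pmf (p / q) else return_pmf False)"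
proof (cases "q = 0")
  case True
  then have "p = 0" using assms by simp
  then show ?thesis using True by (intro pmf_eqI) (auto simp: pmf_bind indicator_def)
next
  case False
  then have q: "0 < q" using assms by simp
  have r: "0 \<le> p / q" "p / q \<le> 1" using assms q by auto
  show ?thesis
  proof (rule pmf_eqI)
    fix b
    show "pmf (bernoulli_pmf p) b =
      pmf (bind_pmf (bernoulli_pmf q) (\<lambda>b. if b then bernoulli_pmf (p / q) else return_pmf False)) b"
      using assms q r by (cases b) (auto simp: pmf_bind field_simps)
  qed
qed

text \<open>Coupling by thinning: keeping each edge of a \<open>q\<close>-random graph with
  probability \<open>p / q\<close> yields a \<open>p\<close>-random subgraph, and deleting edges
  cannot create an upward closed property.\<close>

lemma prob_upward_closed_mono:
  assumes "0 \<le> p" "p \<le> q" "q \<le> 1" and up: "\<And>R R'. P R \<Longrightarrow> R \<subseteq> R' \<Longrightarrow> P R'"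
  shows "measure_pmf.prob (random_graph n p) {R. P R} \<le> measure_pmf.prob (random_graph n q) {R. P R}"
proof -
  define Bq where "Bq = Pi_pmf (all_pairs n) False (\<lambda>_. bernoulli_pmf q)"
  define Th where "Th f = Pi_pmf (all_pairs n) False (\<lambda>e. if f e then bernoulli_pmf (p / q) else return_pmf False)" for f
  define X where "X = {f. P {e \<in> all_pairs n. f e}}"
  have eq: "Pi_pmf (all_pairs n) False (\<lambda>_. bernoulli_pmf p) = bind_pmf Bq Th"
    unfolding Bq_def Th_def bernoulli_thinning[OF assms(1-3)] by (rule Pi_pmf_bind) simp
  have le: "measure_pmf.prob (Th f) X \<le> indicator X f" for f
  proof (cases "f \<in> X")
    case False
    have "g \<notin> X" if "g \<in> set_pmf (Th f)" for g
    proof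
      assume gX: "g \<in> X"
      have "g e \<longrightarrow> f e" if "e \<in> all_pairs n" for e
        using \<open>g \<in> set_pmf (Th f)\<close> that unfolding Th_def
        by (subst (asm) set_Pi_pmf) (auto simp: PiE_dflt_def split: if_splits dest!: bspec)
      then have "{e \<in> all_pairs n. g e} \<subseteq> {e \<in> all_pairs n. f e}" by auto
      then have "f \<in> X" using gX up unfolding X_def by blast
      then show False using False by simp
    qed
    then have "measure_pmf.prob (Th f) X = 0" by (subst measure_pmf_zero_iff) auto
    then show ?thesis by simp
  qed simp
  have "measure_pmf.prob (bind_pmf Bq Th) X = measure_pmf.expectation Bq (\<lambda>f. measure_pmf.prob (Th f) X)"
    unfolding measure_pmf_bind
    by (rule measure_pmf.measure_bind[where N = "count_space UNIV"])
      (auto simp: space_subprob_algebra intro: prob_space_imp_subprob_space measure_pmf.prob_space_axioms)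
  also have "\<dots> \<le> measure_pmf.expectation Bq (indicator X)"
    by (intro integral_mono measure_pmf.integrable_const_bound[where B = 1] le) auto
  also have "\<dots> = measure_pmf.prob Bq X" by simp
  finally show ?thesis unfolding prob_random_graph eq Bq_def X_def .
qed

text \<open>Hitting \<open>K j\<close> is the complement of avoiding it as well, so the induction
  reduces everything to avoidance, with \<open>K0\<close> growing.\<close>

lemma prob_avoid_hit:
  assumes "0 \<le> p" "p \<le> 1" "finite I" "K0 \<subseteq> all_pairs n" "\<And>i. i \<in> I \<Longrightarrow> K i \<subseteq> all_pairs n"
    "\<And>i. i \<in> I \<Longrightarrow> K0 \<inter> K i = {}" "\<And>i j. i \<in> I \<Longrightarrow> j \<in> I \<Longrightarrow> i \<noteq> j \<Longrightarrow> K i \<inter> K j = {}"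
  shows "measure_pmf.prob (random_graph n p) {R. R \<inter> K0 = {} \<and> (\<forall>i\<in>I. R \<inter> K i \<noteq> {})} =
    (1 - p) ^ card K0 * (\<Prod>i\<in>I. 1 - (1 - p) ^ card (K i))"
  using assms(3-)
proof (induction I arbitrary: K0 rule: finite_induct)
  case empty
  then show ?case using prob_avoid[OF assms(1,2)] by simp
next
  case (insert j I)
  let ?E = "\<lambda>K0. {R. R \<inter> K0 = {} \<and> (\<forall>i\<in>I. R \<inter> K i \<noteq> {})}"
  have "{R. R \<inter> K0 = {} \<and> (\<forall>i\<in>insert j I. R \<inter> K i \<noteq> {})} = ?E K0 - ?E (K0 \<union> K j)" by auto
  then have "measure_pmf.prob (random_graph n p) {R. R \<inter> K0 = {} \<and> (\<forall>i\<in>insert j I. R \<inter> K i \<noteq> {})} =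
      measure_pmf.prob (random_graph n p) (?E K0) - measure_pmf.prob (random_graph n p) (?E (K0 \<union> K j))"
    by (simp only:) (rule measure_pmf.finite_measure_Diff, auto)
  also have "measure_pmf.prob (random_graph n p) (?E K0) = (1 - p) ^ card K0 * (\<Prod>i\<in>I. 1 - (1 - p) ^ card (K i))"
    by (rule insert.IH) (use insert.prems in auto)
  also have "measure_pmf.prob (random_graph n p) (?E (K0 \<union> K j)) =
      (1 - p) ^ card (K0 \<union> K j) * (\<Prod>i\<in>I. 1 - (1 - p) ^ card (K i))"
  proof (rule insert.IH)
    show "K0 \<union> K j \<subseteq> all_pairs n" using insert.prems by auto
    show "(K0 \<union> K j) \<inter> K i = {}" if "i \<in> I" for i
    proof -
      have "i \<noteq> j" using that insert.hyps by auto
      then show ?thesis using insert.prems(3)[of i] insert.prems(4)[of j i] that by auto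
    qed
  qed (use insert.prems in auto)
  also have "card (K0 \<union> K j) = card K0 + card (K j)"
  proof (rule card_Un_disjoint)
    show "finite K0" "finite (K j)" using insert.prems(1) insert.prems(2)[of j] by (auto intro: finite_subset)
    show "K0 \<inter> K j = {}" using insert.prems(3) by simp
  qed
  finally show ?case using insert.hyps by (simp add: power_add algebra_simps)
qed

lemma prob_union_bound:
  assumes "finite I" "\<And>R. P R \<Longrightarrow> \<exists>i\<in>I. F i R"
  shows "measure_pmf.prob M {R. P R} \<le> (\<Sum>i\<in>I. measure_pmf.prob M {R. F i R})"
proof -
  have "measure_pmf.prob M {R. P R} \<le> measure_pmf.prob M (\<Union>i\<in>I. {R. F i R})"
    using assms(2) by (intro measure_pmf.finite_measure_mono) auto
  also have "\<dots> \<le> (\<Sum>i\<in>I. measure_pmf.prob M {R. F i R})"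
    by (rule measure_pmf.finite_measure_subadditive_finite) (use assms(1) in auto)
  finally show ?thesis .
qed

section \<open>Random edges across all cuts between the pieces\<close>

lemma sum_Pow_power_card:
  fixes y :: real
  assumes "finite J" shows "(\<Sum>S\<in>Pow J. y ^ card S) = (1 + y) ^ card J"
  using assms
proof (induction J rule: finite_induct)
  case (insert j J)
  have "(\<Sum>S\<in>Pow (insert j J). y ^ card S) = (\<Sum>S\<in>Pow J. y ^ card S) + (\<Sum>S\<in>insert j ` Pow J. y ^ card S)"
    unfolding Pow_insert by (rule sum.union_disjoint) (use insert.hyps in auto)
  also have "(\<Sum>S\<in>insert j ` Pow J. y ^ card S) = (\<Sum>S\<in>Pow J. y ^ card (insert j S))"
    by (rule sum.reindex_cong[of "insert j"]) (use insert.hyps in \<open>auto simp: inj_on_def\<close>)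
  also have "\<dots> = (\<Sum>S\<in>Pow J. y * y ^ card S)"
  proof (rule sum.cong)
    fix S assume "S \<in> Pow J"
    then have "finite S" "j \<notin> S" using insert.hyps finite_subset by auto
    then show "y ^ card (insert j S) = y * y ^ card S" by simp
  qed simp
  finally show ?case using insert by (simp add: sum_distrib_left[symmetric] algebra_simps)
qed simp


text \<open>For a set \<open>S\<close> of pieces with at most half of the vertices there are at
  least \<open>n / 4\<close> vertices off \<open>S\<close> and \<open>W\<close>, hence at least
  \<open>card S * b * n / 4\<close> candidate pairs. Failure for \<open>S\<close> has probability at
  most \<open>y ^ card S\<close>, and all non-empty \<open>S\<close> together contribute
  \<open>(1 + y) ^ card J - 1\<close>. Grouping by pieces is what puts \<open>card J\<close>, not
  \<open>n\<close>, in front of \<open>y\<close>.\<close>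

lemma prob_cut:
  fixes h :: "nat \<Rightarrow> 'j" and p y :: real and n b :: nat
  defines "V \<equiv> {0..<n}"
  defines "J \<equiv> h ` V"
  defines "y \<equiv> exp (- (p * real b * real n / 4))"
  assumes p: "0 \<le> p" "p \<le> 1"
    and B: "\<And>j. j \<in> J \<Longrightarrow> B j \<subseteq> {v \<in> V. h v = j} \<and> card (B j) = b"
    and W: "W \<subseteq> V" "4 * card W \<le> n" and small: "real (card J) * y \<le> 1"
  shows "measure_pmf.prob (random_graph n p)
      {R. \<exists>S. S \<noteq> {} \<and> S \<subseteq> J \<and> 2 * card {v \<in> V. h v \<in> S} \<le> n \<and>
         \<not> (\<exists>u w. {u, w} \<in> R \<and> u \<in> (\<Union>j\<in>S. B j) \<and> w \<in> V - W \<and> h w \<notin> S)}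
    \<le> 2 * real (card J) * y"
proof -
  have fV: "finite V" and fJ: "finite J" unfolding V_def J_def by auto
  define K where "K S = (\<lambda>(u, w). {u, w}) ` ((\<Union>j\<in>S. B j) \<times> {w \<in> V - W. h w \<notin> S})" for S
  define I where "I = {S \<in> Pow J - {{}}. 2 * card {v \<in> V. h v \<in> S} \<le> n}"
  have BV: "u \<in> V" "h u = j" if "u \<in> B j" "j \<in> J" for u j using B[OF that(2)] that(1) by auto
  have fB: "finite (B j)" if "j \<in> J" for j using B[OF that] fV by (metis (no_types, lifting) finite_subset mem_Collect_eq subsetI subset_trans)
  have K_sub: "K S \<subseteq> all_pairs n" if "S \<subseteq> J" for S
    unfolding K_def using BV that by (auto simp: pair_in_all_pairs V_def) blast+
  have bound: "measure_pmf.prob (random_graph n p) {R. R \<inter> K S = {}} \<le> y ^ card S" if S: "S \<in> I" for S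
  proof -
    have SJ: "S \<subseteq> J" and half: "2 * card {v \<in> V. h v \<in> S} \<le> n" using S unfolding I_def by auto
    have "inj_on (\<lambda>(u, w). {u, w}) ((\<Union>j\<in>S. B j) \<times> {w \<in> V - W. h w \<notin> S})"
    proof (rule inj_onI, clarify)
      fix u w u' w' j j'
      assume a: "{u, w} = {u', w'}" "u \<in> B j" "j \<in> S" "h w \<notin> S" "u' \<in> B j'" "j' \<in> S" "h w' \<notin> S"
      then have "h u \<in> S" "h u' \<in> S" using BV SJ by auto
      then show "u = u' \<and> w = w'" using a by (auto simp: doubleton_eq_iff)
    qed
    then have "card (K S) = card (\<Union>j\<in>S. B j) * card {w \<in> V - W. h w \<notin> S}"
      unfolding K_def by (simp add: card_image card_cartesian_product)
    also have "card (\<Union>j\<in>S. B j) = (\<Sum>j\<in>S. card (B j))"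
    proof (rule card_UN_disjoint)
      show "\<forall>i\<in>S. \<forall>j\<in>S. i \<noteq> j \<longrightarrow> B i \<inter> B j = {}" using BV SJ by blast
    qed (use SJ fJ fB finite_subset in auto)
    also have "\<dots> = card S * b" using B SJ by (simp add: subset_iff)
    finally have cK: "card (K S) = card S * b * card {w \<in> V - W. h w \<notin> S}" .
    have "V \<subseteq> {v \<in> V. h v \<in> S} \<union> (W \<union> {w \<in> V - W. h w \<notin> S})" by auto
    then have "card V \<le> card ({v \<in> V. h v \<in> S} \<union> (W \<union> {w \<in> V - W. h w \<notin> S}))"
      by (rule card_mono[rotated]) (use fV W finite_subset in auto)
    also have "\<dots> \<le> card {v \<in> V. h v \<in> S} + (card W + card {w \<in> V - W. h w \<notin> S})"
      by (meson add_left_mono card_Un_le le_trans)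
    finally have "n \<le> 4 * card {w \<in> V - W. h w \<notin> S}" using half W(2) unfolding V_def by simp
    then have "card S * b * n \<le> card S * b * (4 * card {w \<in> V - W. h w \<notin> S})" by (rule mult_le_mono2)
    then have "card S * b * n \<le> 4 * card (K S)" unfolding cK by (simp add: algebra_simps)
    then have "real (card S * b * n) \<le> real (4 * card (K S))" by (rule of_nat_mono)
    then have k4: "real (card S) * real b * real n / 4 \<le> real (card (K S))" by simp
    have "measure_pmf.prob (random_graph n p) {R. R \<inter> K S = {}} = (1 - p) ^ card (K S)"
      by (rule prob_avoid[OF p K_sub[OF SJ]])
    also have "\<dots> \<le> exp (- p) ^ card (K S)" using p exp_ge_add_one_self[of "- p"] by (intro power_mono) auto
    also have "\<dots> = exp (- (p * real (card (K S))))" by (simp add: exp_of_nat_mult[symmetric] mult.commute)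
    also have "\<dots> \<le> exp (- (p * (real (card S) * real b * real n / 4)))"
      using mult_left_mono[OF k4 p(1)] by simp
    also have "\<dots> = y ^ card S" unfolding y_def by (simp add: exp_of_nat_mult[symmetric] algebra_simps)
    finally show ?thesis .
  qed
  have y0: "0 \<le> y" unfolding y_def by simp
  have "measure_pmf.prob (random_graph n p)
      {R. \<exists>S. S \<noteq> {} \<and> S \<subseteq> J \<and> 2 * card {v \<in> V. h v \<in> S} \<le> n \<and>
         \<not> (\<exists>u w. {u, w} \<in> R \<and> u \<in> (\<Union>j\<in>S. B j) \<and> w \<in> V - W \<and> h w \<notin> S)}
    \<le> (\<Sum>S\<in>I. measure_pmf.prob (random_graph n p) {R. R \<inter> K S = {}})"
  proof (rule prob_union_bound)
    show "finite I" unfolding I_def using fJ by simp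
    fix R assume "\<exists>S. S \<noteq> {} \<and> S \<subseteq> J \<and> 2 * card {v \<in> V. h v \<in> S} \<le> n \<and>
         \<not> (\<exists>u w. {u, w} \<in> R \<and> u \<in> (\<Union>j\<in>S. B j) \<and> w \<in> V - W \<and> h w \<notin> S)"
    then obtain S where S: "S \<noteq> {}" "S \<subseteq> J" "2 * card {v \<in> V. h v \<in> S} \<le> n"
      "\<not> (\<exists>u w. {u, w} \<in> R \<and> u \<in> (\<Union>j\<in>S. B j) \<and> w \<in> V - W \<and> h w \<notin> S)" by blast
    have "e \<notin> R" if "e \<in> K S" for e
      using that S(4) unfolding K_def by (clarify) blast
    then have "R \<inter> K S = {}" by blast
    moreover have "S \<in> I" unfolding I_def using S(1-3) by simp
    ultimately show "\<exists>S\<in>I. R \<inter> K S = {}" by blast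
  qed
  also have "\<dots> \<le> (\<Sum>S\<in>I. y ^ card S)" by (intro sum_mono bound)
  also have "\<dots> \<le> (\<Sum>S\<in>Pow J - {{}}. y ^ card S)"
    by (rule sum_mono2) (use fJ y0 in \<open>auto simp: I_def\<close>)
  also have "\<dots> = (1 + y) ^ card J - 1"
    using sum_Pow_power_card[OF fJ, of y] fJ by (subst sum_diff) auto
  also have "\<dots> \<le> exp y ^ card J - 1" using y0 exp_ge_add_one_self[of y] by (simp add: power_mono)
  also have "\<dots> = exp (real (card J) * y) - 1" by (simp add: exp_of_nat_mult)
  also have "\<dots> \<le> real (card J) * y + (real (card J) * y)\<^sup>2"
    using exp_bound[of "real (card J) * y"] small y0 by simp
  also have "\<dots> \<le> 2 * real (card J) * y"
    using small y0 mult_mono[of "real (card J) * y" 1 "real (card J) * y" "real (card J) * y"]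
    by (simp add: power2_eq_square mult.commute)
  finally show ?thesis .
qed

text \<open>The interface between the random and the deterministic part. The matchings are symmetric
  relations, vertex-disjoint, and each connects the pieces after contraction.\<close>

definition linking :: "nat set \<Rightarrow> (nat \<Rightarrow> 'j) \<Rightarrow> nat set set \<Rightarrow> bool" where
  "linking V h R \<longleftrightarrow> (\<exists>M1 M2. symp M1 \<and> symp M2 \<and> (\<forall>x y. M1 x y \<or> M2 x y \<longrightarrow> {x, y} \<in> R \<and> x \<in> V) \<and>
     (\<forall>x y z. M1 x y \<longrightarrow> M1 x z \<longrightarrow> y = z) \<and> (\<forall>x y z. M2 x y \<longrightarrow> M2 x z \<longrightarrow> y = z) \<and>
     (\<forall>x y z. M1 x y \<longrightarrow> M2 x z \<longrightarrow> False) \<and>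
     (\<forall>S. S \<inter> h ` V \<noteq> {} \<longrightarrow> \<not> h ` V \<subseteq> S \<longrightarrow>
        (\<exists>x y. M1 x y \<and> h x \<in> S \<and> h y \<notin> S) \<and> (\<exists>x y. M2 x y \<and> h x \<in> S \<and> h y \<notin> S)))"

lemma linking_witness:
  assumes "symp M1" "symp M2" "\<And>x y. M1 x y \<or> M2 x y \<Longrightarrow> {x, y} \<in> R" "\<And>x y. M1 x y \<or> M2 x y \<Longrightarrow> x \<in> V"
    "\<And>x y z. M1 x y \<Longrightarrow> M1 x z \<Longrightarrow> y = z" "\<And>x y z. M2 x y \<Longrightarrow> M2 x z \<Longrightarrow> y = z"
    "\<And>x y z. M1 x y \<Longrightarrow> M2 x z \<Longrightarrow> False"
    "\<And>S. S \<inter> h ` V \<noteq> {} \<Longrightarrow> \<not> h ` V \<subseteq> S \<Longrightarrow> \<exists>x y. M1 x y \<and> h x \<in> S \<and> h y \<notin> S"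
    "\<And>S. S \<inter> h ` V \<noteq> {} \<Longrightarrow> \<not> h ` V \<subseteq> S \<Longrightarrow> \<exists>x y. M2 x y \<and> h x \<in> S \<and> h y \<notin> S"
  shows "linking V h R"
  unfolding linking_def
  by (rule exI[of _ M1], rule exI[of _ M2], intro conjI allI impI) (fact assms)+

text \<open>\<open>M1\<close> takes the edges with one end in \<open>V1\<close> and the other off
  \<open>V2\<close>, and \<open>M2\<close> does so with the roles exchanged. Each chosen edge has an
  end in \<open>V1 \<union> V2\<close>, so two chosen edges at \<open>x\<close> form a cherry whose
  centre or both of whose leaves lie there. Excluding such cherries makes the systems matchings and
  keeps them disjoint.\<close>

lemma linkingI:
  fixes V :: "nat set" and h :: "nat \<Rightarrow> 'j" and R :: "nat set set"
  assumes fV: "finite V" and dis: "(\<Union>j\<in>h ` V. B1 j) \<inter> (\<Union>j\<in>h ` V. B2 j) = {}"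
    and B: "\<And>j. j \<in> h ` V \<Longrightarrow> B1 j \<subseteq> {v \<in> V. h v = j} \<and> B2 j \<subseteq> {v \<in> V. h v = j}"
    and cherry: "\<And>x y z. {x, y, z} \<subseteq> V \<Longrightarrow> y \<noteq> z \<Longrightarrow> x \<noteq> y \<Longrightarrow> x \<noteq> z \<Longrightarrow>
       x \<in> (\<Union>j\<in>h ` V. B1 j \<union> B2 j) \<or> {y, z} \<subseteq> (\<Union>j\<in>h ` V. B1 j \<union> B2 j) \<Longrightarrow> {x, y} \<in> R \<Longrightarrow> {x, z} \<in> R \<Longrightarrow> False"
    and cut1: "\<And>S. S \<noteq> {} \<Longrightarrow> S \<subseteq> h ` V \<Longrightarrow> 2 * card {v \<in> V. h v \<in> S} \<le> card V \<Longrightarrow>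
       \<exists>u w. {u, w} \<in> R \<and> u \<in> (\<Union>j\<in>S. B1 j) \<and> w \<in> V - (\<Union>j\<in>h ` V. B2 j) \<and> h w \<notin> S"
    and cut2: "\<And>S. S \<noteq> {} \<Longrightarrow> S \<subseteq> h ` V \<Longrightarrow> 2 * card {v \<in> V. h v \<in> S} \<le> card V \<Longrightarrow>
       \<exists>u w. {u, w} \<in> R \<and> u \<in> (\<Union>j\<in>S. B2 j) \<and> w \<in> V - (\<Union>j\<in>h ` V. B1 j) \<and> h w \<notin> S"
  shows "linking V h R"
proof -
  define V1 where "V1 = (\<Union>j\<in>h ` V. B1 j)"
  define V2 where "V2 = (\<Union>j\<in>h ` V. B2 j)"
  have V12: "V1 \<subseteq> V" "V2 \<subseteq> V" unfolding V1_def V2_def using B by blast+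
  have d: "V1 \<inter> V2 = {}" using dis unfolding V1_def V2_def .
  define M where "M P Q x y \<longleftrightarrow> {x, y} \<in> R \<and> x \<in> V \<and> y \<in> V \<and> x \<noteq> y \<and> ((x \<in> P \<and> y \<notin> Q) \<or> (y \<in> P \<and> x \<notin> Q))"
    for P Q :: "nat set" and x y
  have sym: "symp (M P Q)" for P Q unfolding M_def symp_def by (auto simp: insert_commute)
  have V': "(\<Union>j\<in>h ` V. B1 j \<union> B2 j) = V1 \<union> V2" unfolding V1_def V2_def by auto
  have ch: "y = z" if "M P Q x y" "M P' Q' x z" "P \<in> {V1, V2}" "P' \<in> {V1, V2}" for x y z P Q P' Q'
  proof (rule ccontr)
    assume "y \<noteq> z"
    moreover have "x \<in> V1 \<union> V2 \<or> y \<in> V1 \<union> V2" "x \<in> V1 \<union> V2 \<or> z \<in> V1 \<union> V2"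
      using that unfolding M_def by blast+
    then have "x \<in> V1 \<union> V2 \<or> {y, z} \<subseteq> V1 \<union> V2" by blast
    moreover have "{x, y} \<in> R" "{x, z} \<in> R" "x \<in> V" "y \<in> V" "z \<in> V" "x \<noteq> y" "x \<noteq> z"
      using that(1,2) unfolding M_def by blast+
    ultimately show False using cherry[of x y z] unfolding V' by simp
  qed
  have cross: "\<exists>x y. M P Q x y \<and> h x \<in> S \<and> h y \<notin> S"
    if S: "S \<inter> h ` V \<noteq> {}" "\<not> h ` V \<subseteq> S" and P: "P = (\<Union>j\<in>h ` V. C j)"
      and C: "\<And>j. j \<in> h ` V \<Longrightarrow> C j \<subseteq> {v \<in> V. h v = j}"
      and cut: "\<And>S. S \<noteq> {} \<Longrightarrow> S \<subseteq> h ` V \<Longrightarrow> 2 * card {v \<in> V. h v \<in> S} \<le> card V \<Longrightarrow>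
        \<exists>u w. {u, w} \<in> R \<and> u \<in> (\<Union>j\<in>S. C j) \<and> w \<in> V - Q \<and> h w \<notin> S" for S P Q and C :: "'j \<Rightarrow> nat set"
  proof -
    have inC: "u \<in> V" "h u \<in> S'" "u \<in> P" if u: "u \<in> (\<Union>j\<in>S'. C j)" and S': "S' \<subseteq> h ` V" for u S'
    proof -
      obtain j where j: "j \<in> S'" "u \<in> C j" using u by blast
      then have "j \<in> h ` V" using S' by blast
      then show "u \<in> V" "h u \<in> S'" "u \<in> P" using C[of j] j P by auto
    qed
    \<comment> \<open>One side of the cut has at most half of the vertices. \<open>cut\<close> is
      applied to that side, and the edge is read in the required direction.\<close>
    let ?S1 = "S \<inter> h ` V" and ?S2 = "h ` V - S"
    have "card V = card {v \<in> V. h v \<in> ?S1} + card {v \<in> V. h v \<in> ?S2}"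
      by (subst card_Un_disjoint[symmetric]) (use fV in \<open>auto intro: arg_cong[of _ _ card]\<close>)
    then consider "2 * card {v \<in> V. h v \<in> ?S1} \<le> card V" | "2 * card {v \<in> V. h v \<in> ?S2} \<le> card V" by linarith
    then show ?thesis
    proof cases
      case 1
      then obtain u w where uw: "{u, w} \<in> R" "u \<in> (\<Union>j\<in>?S1. C j)" "w \<in> V - Q" "h w \<notin> ?S1"
        using cut[of ?S1] S by blast
      have u: "u \<in> V" "h u \<in> ?S1" "u \<in> P" using inC[OF uw(2)] by auto
      have w: "w \<in> V" "w \<notin> Q" "h w \<notin> S" using uw(3,4) by auto
      have "u \<noteq> w" using u(2) w(3) by auto
      then have "M P Q u w \<and> h u \<in> S \<and> h w \<notin> S" using uw(1) u w unfolding M_def by simp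
      then show ?thesis by blast
    next
      case 2
      moreover have "?S2 \<noteq> {}" using S by blast
      ultimately obtain u w where uw: "{u, w} \<in> R" "u \<in> (\<Union>j\<in>?S2. C j)" "w \<in> V - Q" "h w \<notin> ?S2"
        using cut[of ?S2] by blast
      have u: "u \<in> V" "h u \<in> ?S2" "u \<in> P" using inC[OF uw(2)] by auto
      have w: "w \<in> V" "w \<notin> Q" "h w \<in> S" using uw(3,4) by auto
      have "u \<noteq> w" using u(2) w(3) by auto
      moreover have "{w, u} \<in> R" using uw(1) by (simp add: insert_commute)
      ultimately have "M P Q w u \<and> h w \<in> S \<and> h u \<notin> S" using u w unfolding M_def by simp
      then show ?thesis by blast
    qed
  qed
  have c1: "\<exists>x y. M V1 V2 x y \<and> h x \<in> S \<and> h y \<notin> S" if "S \<inter> h ` V \<noteq> {}" "\<not> h ` V \<subseteq> S" for S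
    by (rule cross[OF that V1_def]) (use B cut1 V2_def in auto)
  have c2: "\<exists>x y. M V2 V1 x y \<and> h x \<in> S \<and> h y \<notin> S" if "S \<inter> h ` V \<noteq> {}" "\<not> h ` V \<subseteq> S" for S
    by (rule cross[OF that V2_def]) (use B cut2 V1_def in auto)
  have cl: "False" if "M V1 V2 x y" "M V2 V1 x z" for x y z
  proof -
    have "y = z" by (rule ch[OF that]) auto
    then show False using that d unfolding M_def by auto
  qed
  have m1: "y = z" if "M V1 V2 x y" "M V1 V2 x z" for x y z by (rule ch[OF that]) auto
  have m2: "y = z" if "M V2 V1 x y" "M V2 V1 x z" for x y z by (rule ch[OF that]) auto
  have RV: "{x, y} \<in> R" "x \<in> V" if "M V1 V2 x y \<or> M V2 V1 x y" for x y using that unfolding M_def by auto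
  show ?thesis
  proof (rule linking_witness[where ?M1.0 = "M V1 V2" and ?M2.0 = "M V2 V1"])
    show "symp (M V1 V2)" "symp (M V2 V1)" by (rule sym)+
  qed (fact RV m1 m2 cl c1 c2)+
qed

lemma prob_linking:
  fixes h :: "nat \<Rightarrow> 'j" and p y :: real and n a dl :: nat
  defines "V \<equiv> {0..<n}"
  defines "y \<equiv> exp (- (p * real (dl div 8) * real n / 4))"
  assumes p: "0 \<le> p" "p \<le> 1" and J: "card (h ` V) \<le> a"
    and piece: "\<And>j. j \<in> h ` V \<Longrightarrow> dl \<le> 2 * card {v \<in> V. h v = j}" and small: "real a * y \<le> 1"
  shows "1 - (real (a * dl) * (real n)\<^sup>2 + real n * (real (a * dl))\<^sup>2) * p\<^sup>2 - 4 * real a * y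
    \<le> measure_pmf.prob (random_graph n p) {R. linking V h R}"
proof -
  let ?pr = "measure_pmf.prob (random_graph n p)"
  define b where "b = dl div 8"
  have b8: "8 * b \<le> dl" unfolding b_def by simp
  have fV: "finite V" unfolding V_def by simp
  have "\<exists>B. fst B \<subseteq> {v \<in> V. h v = j} \<and> snd B \<subseteq> {v \<in> V. h v = j} \<and> fst B \<inter> snd B = {} \<and> card (fst B) = b \<and> card (snd B) = b"
    if j: "j \<in> h ` V" for j
  proof -
    have 2: "2 * b \<le> card {v \<in> V. h v = j}" using piece[OF j] b8 by linarith
    obtain C where C: "C \<subseteq> {v \<in> V. h v = j}" "card C = b" "finite C"
      using obtain_subset_with_card_n[of b "{v \<in> V. h v = j}"] 2 by auto
    have "b \<le> card ({v \<in> V. h v = j} - C)" using 2 C by (simp add: card_Diff_subset)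
    then obtain D where "D \<subseteq> {v \<in> V. h v = j} - C" "card D = b"
      using obtain_subset_with_card_n[of b "{v \<in> V. h v = j} - C"] by auto
    then show ?thesis using C by (intro exI[of _ "(C, D)"]) auto
  qed
  then obtain B where B: "\<And>j. j \<in> h ` V \<Longrightarrow> fst (B j) \<subseteq> {v \<in> V. h v = j} \<and> snd (B j) \<subseteq> {v \<in> V. h v = j} \<and>
      fst (B j) \<inter> snd (B j) = {} \<and> card (fst (B j)) = b \<and> card (snd (B j)) = b"
    using bchoice[of "h ` V" "\<lambda>j B. fst B \<subseteq> {v \<in> V. h v = j} \<and> snd B \<subseteq> {v \<in> V. h v = j} \<and> fst B \<inter> snd B = {} \<and>
      card (fst B) = b \<and> card (snd B) = b"] by blast
  define B1 B2 where "B1 j = fst (B j)" and "B2 j = snd (B j)" for j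
  have B1: "B1 j \<subseteq> {v \<in> V. h v = j}" "card (B1 j) = b" and B2: "B2 j \<subseteq> {v \<in> V. h v = j}" "card (B2 j) = b"
    and B12: "B1 j \<inter> B2 j = {}" if "j \<in> h ` V" for j
    using B[OF that] unfolding B1_def B2_def by auto
  define V1 V2 where "V1 = (\<Union>j\<in>h ` V. B1 j)" and "V2 = (\<Union>j\<in>h ` V. B2 j)"
  have V12: "V1 \<subseteq> V" "V2 \<subseteq> V" unfolding V1_def V2_def using B1 B2 by blast+
  have dis: "V1 \<inter> V2 = {}"
  proof -
    have False if "x \<in> B1 j" "j \<in> h ` V" "x \<in> B2 i" "i \<in> h ` V" for x i j
    proof -
      have "h x = j" "h x = i" using that B1(1)[of j] B2(1)[of i] by auto
      then show False using that B12[of i] by auto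
    qed
    then show ?thesis unfolding V1_def V2_def by blast
  qed
  have cV: "card V1 \<le> card (h ` V) * b" "card V2 \<le> card (h ` V) * b"
  proof -
    have 1: "card (B1 ` (h ` V)) \<le> card (h ` V)" "card (B2 ` (h ` V)) \<le> card (h ` V)"
      using fV by (auto intro!: card_image_le)
    have "card V1 \<le> card (B1 ` (h ` V)) * b" unfolding V1_def by (rule card_Union_le_mult) (use fV B1 in auto)
    then show "card V1 \<le> card (h ` V) * b" using 1(1) by (meson le_trans mult_le_mono1)
    have "card V2 \<le> card (B2 ` (h ` V)) * b" unfolding V2_def by (rule card_Union_le_mult) (use fV B2 in auto)
    then show "card V2 \<le> card (h ` V) * b" using 1(2) by (meson le_trans mult_le_mono1)
  qed
  have "card V = card (\<Union>j\<in>h ` V. {v \<in> V. h v = j})" by (rule arg_cong[of _ _ card]) auto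
  also have "\<dots> = (\<Sum>j\<in>h ` V. card {v \<in> V. h v = j})" by (rule card_UN_disjoint) (use fV in auto)
  finally have "2 * card V = (\<Sum>j\<in>h ` V. 2 * card {v \<in> V. h v = j})" by (simp add: sum_distrib_left)
  also have "\<dots> \<ge> (\<Sum>j\<in>h ` V. 8 * b)" by (rule sum_mono) (use piece b8 le_trans in blast)
  finally have 4: "4 * (card (h ` V) * b) \<le> n" unfolding V_def by (simp add: mult.commute)
  have sm: "real (card (h ` V)) * y \<le> 1"
  proof -
    have "real (card (h ` V)) * y \<le> real a * y" using J unfolding y_def by (intro mult_right_mono) auto
    then show ?thesis using small by simp
  qed
  have Jy: "2 * real (card (h ` V)) * y \<le> 2 * real a * y" using J unfolding y_def by (intro mult_right_mono) auto
  define bad where "bad C W R \<longleftrightarrow> (\<exists>S. S \<noteq> {} \<and> S \<subseteq> h ` V \<and> 2 * card {v \<in> V. h v \<in> S} \<le> n \<and>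
         \<not> (\<exists>u w. {u, w} \<in> R \<and> u \<in> (\<Union>j\<in>S. C j) \<and> w \<in> V - W \<and> h w \<notin> S))"
    for C :: "'j \<Rightarrow> nat set" and W R
  have bad1: "?pr {R. bad B1 V2 R} \<le> 2 * real a * y"
  proof -
    have "?pr {R. bad B1 V2 R} \<le> 2 * real (card (h ` V)) * y"
      unfolding bad_def y_def V_def b_def[symmetric]
      by (rule prob_cut[OF p]) (use B1 V12 cV 4 sm in \<open>auto simp: V_def y_def b_def\<close>)
    then show ?thesis using Jy by linarith
  qed
  have bad2: "?pr {R. bad B2 V1 R} \<le> 2 * real a * y"
  proof -
    have "?pr {R. bad B2 V1 R} \<le> 2 * real (card (h ` V)) * y"
      unfolding bad_def y_def V_def b_def[symmetric]
      by (rule prob_cut[OF p]) (use B2 V12 cV 4 sm in \<open>auto simp: V_def y_def b_def\<close>)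
    then show ?thesis using Jy by linarith
  qed
  define V' where "V' = V1 \<union> V2"
  define Tr where "Tr = {(x, y, z). {x, y, z} \<subseteq> V \<and> y \<noteq> z \<and> x \<noteq> y \<and> x \<noteq> z \<and> (x \<in> V' \<or> {y, z} \<subseteq> V')}"
  define cherry where "cherry t R \<longleftrightarrow> (case t of (x, y, z) \<Rightarrow> {x, y} \<in> R \<and> {x, z} \<in> R)" for t :: "nat \<times> nat \<times> nat" and R
  have TrS: "Tr \<subseteq> V' \<times> V \<times> V \<union> V \<times> V' \<times> V'" unfolding Tr_def by auto
  have fV': "finite V'" "V' \<subseteq> V" unfolding V'_def using V12 fV finite_subset by auto
  have fTr: "finite Tr" by (rule finite_subset[OF TrS]) (use fV fV' in auto)
  have "card V' \<le> card V1 + card V2" unfolding V'_def by (rule card_Un_le)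
  also have "\<dots> \<le> card (h ` V) * (2 * b)" using cV by simp
  also have "\<dots> \<le> a * dl" using J b8 by (intro mult_le_mono) auto
  finally have cV': "card V' \<le> a * dl" .
  have "card Tr \<le> card (V' \<times> V \<times> V \<union> V \<times> V' \<times> V')" by (rule card_mono[OF _ TrS]) (use fV fV' in auto)
  also have "\<dots> \<le> card (V' \<times> V \<times> V) + card (V \<times> V' \<times> V')" by (rule card_Un_le)
  also have "\<dots> = card V' * (n * n) + n * (card V' * card V')" unfolding V_def by (simp add: card_cartesian_product)
  also have "\<dots> \<le> a * dl * (n * n) + n * ((a * dl) * (a * dl))"
    using cV' by (intro add_mono mult_le_mono) auto
  finally have "real (card Tr) \<le> real (a * dl * (n * n) + n * ((a * dl) * (a * dl)))" by (rule of_nat_mono)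
  then have cTr: "real (card Tr) \<le> real (a * dl) * (real n)\<^sup>2 + real n * (real (a * dl))\<^sup>2"
    by (simp add: power2_eq_square)
  have "?pr {R. \<exists>t\<in>Tr. cherry t R} \<le> (\<Sum>t\<in>Tr. ?pr {R. cherry t R})"
    by (rule prob_union_bound[OF fTr])
  also have "\<dots> \<le> (\<Sum>t\<in>Tr. p\<^sup>2)"
  proof (rule sum_mono)
    fix t assume "t \<in> Tr"
    then obtain x y z where t: "t = (x, y, z)" "{x, y, z} \<subseteq> V" "y \<noteq> z" "x \<noteq> y" "x \<noteq> z" unfolding Tr_def by auto
    have "{{x, y}, {x, z}} \<subseteq> all_pairs n" using t by (auto simp: pair_in_all_pairs V_def)
    moreover have "{R. cherry t R} = {R. {{x, y}, {x, z}} \<subseteq> R}" unfolding cherry_def t(1) by auto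
    moreover have "card {{x, y}, {x, z}} = 2" using t by (auto simp: doubleton_eq_iff)
    ultimately show "?pr {R. cherry t R} \<le> p\<^sup>2"
      using prob_contain[OF p, of "{{x, y}, {x, z}}" n] by (simp only: order_refl)
  qed
  also have "\<dots> = real (card Tr) * p\<^sup>2" by simp
  also have "\<dots> \<le> (real (a * dl) * (real n)\<^sup>2 + real n * (real (a * dl))\<^sup>2) * p\<^sup>2"
    using cTr by (rule mult_right_mono) simp
  finally have bad3: "?pr {R. \<exists>t\<in>Tr. cherry t R} \<le> (real (a * dl) * (real n)\<^sup>2 + real n * (real (a * dl))\<^sup>2) * p\<^sup>2" .
  have good: "linking V h R" if n1: "\<not> bad B1 V2 R" and n2: "\<not> bad B2 V1 R" and n3: "\<not> (\<exists>t\<in>Tr. cherry t R)" for R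
  proof (rule linkingI[OF fV dis[unfolded V1_def V2_def]])
    show "B1 j \<subseteq> {v \<in> V. h v = j} \<and> B2 j \<subseteq> {v \<in> V. h v = j}" if "j \<in> h ` V" for j using B1 B2 that by auto
    fix S assume S: "S \<noteq> {}" "S \<subseteq> h ` V" "2 * card {v \<in> V. h v \<in> S} \<le> card V"
    then have S3: "2 * card {v \<in> V. h v \<in> S} \<le> n" unfolding V_def by simp
    show "\<exists>u w. {u, w} \<in> R \<and> u \<in> (\<Union>j\<in>S. B1 j) \<and> w \<in> V - (\<Union>j\<in>h ` V. B2 j) \<and> h w \<notin> S"
      using n1 S(1,2) S3 unfolding bad_def V2_def by blast
    show "\<exists>u w. {u, w} \<in> R \<and> u \<in> (\<Union>j\<in>S. B2 j) \<and> w \<in> V - (\<Union>j\<in>h ` V. B1 j) \<and> h w \<notin> S"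
      using n2 S(1,2) S3 unfolding bad_def V1_def by blast
  next
    fix x y z assume t: "{x, y, z} \<subseteq> V" "y \<noteq> z" "x \<noteq> y" "x \<noteq> z"
      "x \<in> (\<Union>j\<in>h ` V. B1 j \<union> B2 j) \<or> {y, z} \<subseteq> (\<Union>j\<in>h ` V. B1 j \<union> B2 j)" and R: "{x, y} \<in> R" "{x, z} \<in> R"
    have "(\<Union>j\<in>h ` V. B1 j \<union> B2 j) = V'" unfolding V'_def V1_def V2_def by auto
    then have "(x, y, z) \<in> Tr" unfolding Tr_def using t by simp
    then show False using n3 R unfolding cherry_def by auto
  qed
  have "1 - ?pr {R. linking V h R} = ?pr (UNIV - {R. linking V h R})"
    by (subst measure_pmf.finite_measure_Diff) auto
  also have "\<dots> \<le> ?pr ({R. bad B1 V2 R} \<union> ({R. bad B2 V1 R} \<union> {R. \<exists>t\<in>Tr. cherry t R}))"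
    by (rule measure_pmf.finite_measure_mono) (use good in auto)
  also have "\<dots> \<le> ?pr {R. bad B1 V2 R} + (?pr {R. bad B2 V1 R} + ?pr {R. \<exists>t\<in>Tr. cherry t R})"
    by (rule order_trans[OF measure_Un_le add_left_mono[OF measure_Un_le]]) auto
  finally show ?thesis using bad1 bad2 bad3 by linarith
qed

section \<open>Randomly perturbed graphs are pancyclic\<close>

lemma successively_nth:
  "successively P xs \<Longrightarrow> Suc i < length xs \<Longrightarrow> P (xs ! i) (xs ! Suc i)"
  by (induction P xs arbitrary: i rule: successively.induct) (auto simp: nth_Cons split: nat.splits)

lemma has_cycle_imp_cycle_of_length:
  assumes "has_cycle (\<lambda>u v. {u, v} \<in> E) {0..<n} N" "3 \<le> N"
  shows "has_cycle_of_length n E N"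
proof -
  obtain vs where vs: "vs \<noteq> []" "length vs = N" "distinct vs" "set vs \<subseteq> {0..<n}"
    "successively (\<lambda>u v. {u, v} \<in> E) vs" "{last vs, hd vs} \<in> E"
    using assms(1) unfolding has_cycle_def by blast
  have "{vs ! i, vs ! ((i + 1) mod N)} \<in> E" if "i < N" for i
  proof (cases "Suc i < N")
    case True
    then show ?thesis using successively_nth[OF vs(5), of i] vs(2) by simp
  next
    case False
    then have N: "N = i + 1" using that by simp
    then have "i = N - 1" "(i + 1) mod N = 0" by simp_all
    then show ?thesis using vs by (simp add: last_conv_nth hd_conv_nth)
  qed
  then show ?thesis unfolding has_cycle_of_length_def using assms(2) vs by blast
qed

lemma cycle_of_length_mono:
  "has_cycle_of_length n E N \<Longrightarrow> E \<subseteq> E' \<Longrightarrow> has_cycle_of_length n E' N"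
  unfolding has_cycle_of_length_def by blast

lemma pancyclic_mono: "pancyclic n E \<Longrightarrow> E \<subseteq> E' \<Longrightarrow> pancyclic n E'"
  unfolding pancyclic_def using cycle_of_length_mono by blast

lemma independence_number_eq_ind:
  "independence_number n E = ind (\<lambda>u v. {u, v} \<in> E) {0..<n}"
  unfolding independence_number_def ind_def independent_set_def nonadj_def by simp

lemma is_graph_edge:
  assumes "is_graph n E" "{u, v} \<in> E" shows "u < n" "v < n" "u \<noteq> v"
  using assms pair_in_all_pairs[of u v n] unfolding is_graph_def by auto

lemma min_degree_le:
  assumes "is_graph n E" "v < n" shows "min_degree n E \<le> card {u \<in> {0..<n}. {v, u} \<in> E}"
proof -
  have "min_degree n E \<le> degree E v" unfolding min_degree_def using assms(2) by (intro Min_le) auto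
  also have "{u. {u, v} \<in> E} = {u \<in> {0..<n}. {v, u} \<in> E}"
    using is_graph_edge[OF assms(1)] by (auto simp: insert_commute)
  then have "degree E v = card {u \<in> {0..<n}. {v, u} \<in> E}" unfolding degree_def by simp
  finally show ?thesis .
qed

lemma independence_number_bounds:
  assumes "is_graph n E" "1 \<le> n" shows "1 \<le> independence_number n E" "independence_number n E \<le> n"
proof -
  have "irreflp (\<lambda>u v. {u, v} \<in> E)" using is_graph_edge(3)[OF assms(1)] unfolding irreflp_def by blast
  then show "1 \<le> independence_number n E"
    unfolding independence_number_eq_ind using assms(2) by (intro ind_pos) auto
  obtain I where I: "I \<subseteq> {0..<n}" "card I = independence_number n E"
    unfolding independence_number_eq_ind by (rule ind_witness[of "{0..<n}" "\<lambda>u v. {u, v} \<in> E"]) auto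
  then show "independence_number n E \<le> n" using card_mono[OF _ I(1)] by simp
qed

theorem pieces_for_linking:
  assumes G: "is_graph n G" and n: "1 \<le> n" and Q: "1 \<le> Q" "independence_number n G \<le> 2 ^ Q"
  defines "a \<equiv> independence_number n G"
  assumes dl: "20 * a * (20 * a * (4 * Q * (Q + 1) + 4) + 20 * a + 1) \<le> min_degree n G"
  obtains h :: "nat \<Rightarrow> nat set" where "card (h ` {0..<n}) \<le> a"
    "\<And>j. j \<in> h ` {0..<n} \<Longrightarrow> min_degree n G \<le> 2 * card {v \<in> {0..<n}. h v = j}"
    "\<And>R. linking {0..<n} h R \<Longrightarrow> pancyclic n (G \<union> R)"
proof -
  define V where "V = {0..<n}"
  define A where "A u v \<longleftrightarrow> {u, v} \<in> G" for u v
  define l where "l = 4 * Q * (Q + 1) + 4"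
  have V: "finite V" "V \<noteq> {}" unfolding V_def using n by auto
  have sA: "symp A" unfolding A_def symp_def by (simp add: insert_commute)
  have iA: "irreflp A" unfolding A_def irreflp_def using is_graph_edge(3)[OF G] by blast
  have ind: "ind A V \<le> a" unfolding a_def independence_number_eq_ind A_def V_def by simp
  have a1: "1 \<le> a" unfolding a_def by (rule independence_number_bounds[OF G n])
  have deg: "min_degree n G \<le> card {u \<in> V. A v u}" if "v \<in> V" for v
    using min_degree_le[OF G, of v] that unfolding V_def A_def by simp
  have aQ: "a \<le> 2 ^ Q" using Q(2) unfolding a_def .
  have dl': "20 * a * (20 * a * l + 20 * a + 1) \<le> min_degree n G" using dl unfolding l_def .
  obtain c :: "nat \<Rightarrow> nat set" and g :: "nat set \<Rightarrow> nat set" where cg: "card (c ` V) \<le> 2 * a" "card (g ` c ` V) \<le> a"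
    "\<And>k. k \<in> c ` V \<Longrightarrow> robust A (20 * a * l) l {v \<in> V. c v = k}"
    "\<And>k. k \<in> c ` V \<Longrightarrow> 20 * a * l + 2 \<le> card {v \<in> V. c v = k}"
    "\<And>j. j \<in> g ` c ` V \<Longrightarrow> unsplittable A (20 * a) {v \<in> V. g (c v) = j}"
    "\<And>j. j \<in> g ` c ` V \<Longrightarrow> min_degree n G \<le> 2 * card {v \<in> V. g (c v) = j}"
    using two_level_partition[OF V sA iA ind aQ Q(1) deg dl'] unfolding l_def by blast
  define h where "h = (\<lambda>v. g (c v))"
  have hV: "h ` V = g ` c ` V" unfolding h_def by auto
  have deg5: "5 * a * a * l < card {u \<in> V. A v u}" if v: "v \<in> V" for v
  proof -
    have "1 \<le> a * a * l" using a1 unfolding l_def by simp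
    then have "5 * a * a * l < 400 * (a * a * l)" by simp
    also have "\<dots> \<le> 20 * a * (20 * a * l + 20 * a + 1)" by (simp add: algebra_simps)
    finally show ?thesis using dl' deg[OF v] by linarith
  qed
  have pan: "pancyclic n (G \<union> R)" if link: "linking V h R" for R
    unfolding pancyclic_def
  proof (intro allI impI)
    fix N assume N: "3 \<le> N \<and> N \<le> n"
    define E where "E u v \<longleftrightarrow> {u, v} \<in> G \<union> R" for u v
    have "robust_partition V A E c a (20 * a * l) l"
    proof
      show "symp E" unfolding E_def symp_def by (simp add: insert_commute)
      show "card I \<le> a" if "I \<subseteq> V" "nonadj A I I" for I using ind_ge[OF V(1) that] ind by linarith
      show "E u v" if "A u v" for u v using that unfolding A_def E_def by simp
      show "2 \<le> l" unfolding l_def by simp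
    qed (use V sA iA cg a1 in auto)
    then interpret rp: robust_partition V A E c a "20 * a * l" l .
    obtain M1 M2 where M: "symp M1" "symp M2" "\<forall>x y. M1 x y \<or> M2 x y \<longrightarrow> {x, y} \<in> R \<and> x \<in> V"
      "\<forall>x y z. M1 x y \<longrightarrow> M1 x z \<longrightarrow> y = z" "\<forall>x y z. M2 x y \<longrightarrow> M2 x z \<longrightarrow> y = z"
      "\<forall>x y z. M1 x y \<longrightarrow> M2 x z \<longrightarrow> False"
      "\<forall>S. S \<inter> h ` V \<noteq> {} \<longrightarrow> \<not> h ` V \<subseteq> S \<longrightarrow>
        (\<exists>x y. M1 x y \<and> h x \<in> S \<and> h y \<notin> S) \<and> (\<exists>x y. M2 x y \<and> h x \<in> S \<and> h y \<notin> S)"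
      using link unfolding linking_def by (elim exE conjE)
    have "has_cycle E V N"
    proof (rule rp.all_cycles[OF cg(5,1,2) V(2) deg5 M(1,2)])
      show "E x y \<and> x \<in> V" if "M1 x y \<or> M2 x y" for x y using M(3) that unfolding E_def by blast
      show "y = z" if "M1 x y" "M1 x z" for x y z using M(4) that by blast
      show "y = z" if "M2 x y" "M2 x z" for x y z using M(5) that by blast
      show False if "M1 x y" "M2 x z" for x y z using M(6) that by blast
      show "\<exists>x y. M1 x y \<and> g (c x) \<in> S \<and> g (c y) \<notin> S"
        "\<exists>x y. M2 x y \<and> g (c x) \<in> S \<and> g (c y) \<notin> S" if "S \<inter> g ` c ` V \<noteq> {}" "\<not> g ` c ` V \<subseteq> S" for S
        using M(7)[unfolded hV, rule_format, OF that] unfolding h_def by auto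
      show "3 \<le> N" "N \<le> card V" using N unfolding V_def by auto
    qed
    then show "has_cycle_of_length n (G \<union> R) N"
      using N has_cycle_imp_cycle_of_length unfolding E_def V_def by blast
  qed
  show ?thesis
  proof (rule that[of h])
    show "card (h ` {0..<n}) \<le> a" using cg(2) hV unfolding V_def by simp
    show "min_degree n G \<le> 2 * card {v \<in> {0..<n}. h v = j}" if "j \<in> h ` {0..<n}" for j
      using cg(6) that hV unfolding V_def h_def by auto
    show "pancyclic n (G \<union> R)" if "linking {0..<n} h R" for R using pan that unfolding V_def by simp
  qed
qed

lemma ln_squared_le:
  assumes "1 \<le> (x::real)" shows "(ln x)\<^sup>2 \<le> 4 * x"
proof -
  have "ln x = 2 * ln (sqrt x)" using assms by (simp add: ln_sqrt)
  also have "\<dots> \<le> 2 * sqrt x" using assms ln_bound[of "sqrt x"] by auto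
  finally have "(ln x)\<^sup>2 \<le> (2 * sqrt x)\<^sup>2" using assms by (intro power_mono) auto
  also have "\<dots> = 4 * x" using assms by (simp add: power_mult_distrib)
  finally show ?thesis .
qed

theorem prob_pancyclic:
  fixes p C :: real
  assumes G: "is_graph n G" and L: "1 \<le> ln (real n)"
  defines "a \<equiv> independence_number n G" and "dl \<equiv> min_degree n G" and "L \<equiv> ln (real n)"
  assumes C: "real (a * dl) \<le> C * real n" and dl: "50000 * (real a * L)\<^sup>2 < real dl"
    and p: "0 \<le> p" "p \<le> 1" "128 * L * ln (real a * L) / (real n * real dl) \<le> p"
  shows "1 - 6 * (1 + C) / L - 4 / L\<^sup>2 \<le> measure_pmf.prob (random_graph n p) {R. pancyclic n (G \<union> R)}"
proof -
  have L1: "1 \<le> L" using L unfolding L_def .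
  have n: "1 \<le> n" using L by (cases n) auto
  have a1: "1 \<le> a" "a \<le> n" unfolding a_def using independence_number_bounds[OF G n] by auto
  define Q where "Q = nat \<lceil>2 * L\<rceil>"
  have Q: "2 * L \<le> real Q" "real Q \<le> 3 * L" "1 \<le> Q"
    using L1 unfolding Q_def by linarith+
  have "real n = exp L" unfolding L_def using n by simp
  also have "\<dots> \<le> exp (real Q * ln 2)"
  proof -
    have "L * 1 \<le> L * (2 * ln 2)" using L1 ln2_ge_two_thirds by (intro mult_left_mono) auto
    also have "\<dots> = 2 * L * ln 2" by simp
    also have "\<dots> \<le> real Q * ln 2" using Q(1) by (intro mult_right_mono) auto
    finally show ?thesis by simp
  qed
  also have "\<dots> = 2 ^ Q" by (simp add: exp_of_nat_mult)
  finally have "real n \<le> real (2 ^ Q)" by simp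
  then have "n \<le> 2 ^ Q" by (simp only: of_nat_le_iff)
  then have aQ: "a \<le> 2 ^ Q" using a1 by linarith
  have "20 * a * (20 * a * (4 * Q * (Q + 1) + 4) + 20 * a + 1) \<le> dl"
  proof -
    have QQ: "Q \<le> Q * Q" "1 \<le> Q * Q" using Q(3) by auto
    have "20 * a * (4 * Q * (Q + 1) + 4) + 20 * a + 1 \<le> 20 * a * (12 * (Q * Q)) + 20 * a * (Q * Q) + a * (Q * Q)"
    proof (intro add_mono)
      show "20 * a * (4 * Q * (Q + 1) + 4) \<le> 20 * a * (12 * (Q * Q))"
      proof (intro mult_le_mono2)
        have "4 * Q * (Q + 1) + 4 = 4 * (Q * Q) + 4 * Q + 4" by (simp add: algebra_simps)
        then show "4 * Q * (Q + 1) + 4 \<le> 12 * (Q * Q)" using QQ by linarith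
      qed
      show "20 * a \<le> 20 * a * (Q * Q)" using QQ(2) mult_le_mono2[of 1 "Q * Q" "20 * a"] by simp
      show "1 \<le> a * (Q * Q)" using QQ(2) a1(1) by simp
    qed
    also have "\<dots> = 261 * (a * (Q * Q))" by (simp add: algebra_simps)
    finally have "20 * a * (20 * a * (4 * Q * (Q + 1) + 4) + 20 * a + 1) \<le> 20 * a * (261 * (a * (Q * Q)))"
      by (rule mult_le_mono2)
    also have "\<dots> = 5220 * (a * Q) * (a * Q)" by (simp add: algebra_simps)
    finally have 1: "20 * a * (20 * a * (4 * Q * (Q + 1) + 4) + 20 * a + 1) \<le> 5220 * (a * Q) * (a * Q)" .
    have "real a * real Q \<le> real a * (3 * L)" using Q(2) by (intro mult_left_mono) auto
    then have "(real a * real Q)\<^sup>2 \<le> (real a * (3 * L))\<^sup>2" by (intro power_mono) auto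
    also have "(real a * (3 * L))\<^sup>2 = 9 * (real a * L)\<^sup>2" by (simp add: power_mult_distrib)
    finally have "5220 * (real a * real Q)\<^sup>2 \<le> 50000 * (real a * L)\<^sup>2"
      using zero_le_power2[of "real a * L"] by linarith
    moreover have "real (5220 * (a * Q) * (a * Q)) = 5220 * (real a * real Q)\<^sup>2" by (simp add: power2_eq_square)
    ultimately have "real (5220 * (a * Q) * (a * Q)) \<le> real dl" using dl by linarith
    then have "5220 * (a * Q) * (a * Q) \<le> dl" by (simp only: of_nat_le_iff)
    then show ?thesis using 1 by linarith
  qed
  then obtain h :: "nat \<Rightarrow> nat set" where h: "card (h ` {0..<n}) \<le> a"
    "\<And>j. j \<in> h ` {0..<n} \<Longrightarrow> dl \<le> 2 * card {v \<in> {0..<n}. h v = j}"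
    "\<And>R. linking {0..<n} h R \<Longrightarrow> pancyclic n (G \<union> R)"
    using pieces_for_linking[OF G n Q(3)] aQ unfolding a_def dl_def by metis
  define x where "x = real a * L"
  have x1: "1 \<le> x" unfolding x_def using a1 L1 mult_mono[of 1 "real a" 1 L] by simp
  have xx: "x \<le> x\<^sup>2" using x1 by (simp add: power2_eq_square)
  have dlx: "50000 * x\<^sup>2 < real dl" using dl unfolding x_def .
  then have dl8: "50000 \<le> real dl" using x1 xx by linarith
  have lnx: "0 \<le> ln x" using x1 by simp
  define p0 where "p0 = 128 * ln x / (real n * real dl)"
  have np: "0 < real n" "0 < real dl" using n dl8 by auto
  have "128 * 1 * ln x \<le> 128 * L * ln x" using lnx L1 by (intro mult_right_mono) auto
  then have "p0 \<le> 128 * L * ln x / (real n * real dl)" unfolding p0_def using np by (intro divide_right_mono) auto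
  then have p0: "0 \<le> p0" "p0 \<le> p" using p(3) lnx np unfolding x_def[symmetric] by (auto simp: p0_def)
  have p01: "p0 \<le> 1" using p0 p by linarith
  define y where "y = exp (- (p0 * real (dl div 8) * real n / 4))"
  have b: "real dl / 16 \<le> real (dl div 8)"
  proof -
    have "dl < 8 * (dl div 8) + 8" by linarith
    then have "real dl < 8 * real (dl div 8) + 8" by linarith
    then show ?thesis using dl8 by linarith
  qed
  have "2 * ln x = p0 * (real dl / 16) * real n / 4" unfolding p0_def using np by (simp add: field_simps)
  also have "\<dots> \<le> p0 * real (dl div 8) * real n / 4"
    using b p0 np by (intro divide_right_mono mult_right_mono mult_left_mono) auto
  finally have "y \<le> exp (- (2 * ln x))" unfolding y_def by simp
  also have "\<dots> = 1 / x\<^sup>2" using x1 by (simp add: exp_minus exp_double inverse_eq_divide)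
  finally have y: "y \<le> 1 / x\<^sup>2" .
  have "real a * y \<le> real a * (1 / x\<^sup>2)" using y by (intro mult_left_mono) auto
  also have "\<dots> = 1 / (real a * L\<^sup>2)" unfolding x_def using a1 by (simp add: power2_eq_square)
  also have "\<dots> \<le> 1 / L\<^sup>2"
    using a1 L1 mult_mono[of 1 "real a" "L\<^sup>2" "L\<^sup>2"] by (intro divide_left_mono) auto
  finally have ay: "real a * y \<le> 1 / L\<^sup>2" .
  also have "\<dots> \<le> 1" using L1 by simp
  finally have small: "real a * y \<le> 1" .
  have cherries: "(real (a * dl) * (real n)\<^sup>2 + real n * (real (a * dl))\<^sup>2) * p0\<^sup>2 \<le> 6 * (1 + C) / L"
  proof -
    have "(real (a * dl) * (real n)\<^sup>2 + real n * (real (a * dl))\<^sup>2) * p0\<^sup>2 =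
        16384 * (ln x)\<^sup>2 * (real a / real dl + (real a)\<^sup>2 / real n)"
      unfolding p0_def using np by (simp add: field_simps power2_eq_square)
    also have "\<dots> \<le> 16384 * (4 * x) * ((1 + C) / (50000 * (real a * L\<^sup>2)))"
    proof (intro mult_mono)
      show "(ln x)\<^sup>2 \<le> 4 * x" by (rule ln_squared_le[OF x1])
      have "real a / real dl \<le> real a / (50000 * x\<^sup>2)" using dlx x1 np by (intro divide_left_mono) auto
      also have "\<dots> = 1 / (50000 * (real a * L\<^sup>2))" unfolding x_def using a1 by (simp add: power2_eq_square)
      finally have t1: "real a / real dl \<le> 1 / (50000 * (real a * L\<^sup>2))" .
      have "real a * (50000 * x\<^sup>2) \<le> real a * real dl" using dlx by (intro mult_left_mono) auto
      also have "\<dots> \<le> C * real n" using C by simp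
      finally have "(real a)\<^sup>2 * (50000 * (real a * L\<^sup>2)) \<le> C * real n"
        unfolding x_def by (simp add: power2_eq_square algebra_simps)
      then have t2: "(real a)\<^sup>2 / real n \<le> C / (50000 * (real a * L\<^sup>2))"
        using np a1 L1 by (simp add: field_simps)
      show "real a / real dl + (real a)\<^sup>2 / real n \<le> (1 + C) / (50000 * (real a * L\<^sup>2))"
        using t1 t2 by (simp add: add_divide_distrib)
    qed (use x1 in auto)
    also have "\<dots> = (16384 * 4 / 50000) * (1 + C) / L"
      unfolding x_def using a1 L1 by (simp add: field_simps power2_eq_square)
    also have "\<dots> \<le> 6 * (1 + C) / L"
    proof -
      have "0 \<le> C * real n" using C by (meson of_nat_0_le_iff order_trans)
      then have "0 \<le> C" using np by (simp add: zero_le_mult_iff)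
      then show ?thesis using L1 by (intro divide_right_mono mult_right_mono) auto
    qed
    finally show ?thesis .
  qed
  have "1 - 6 * (1 + C) / L - 4 / L\<^sup>2 \<le>
      1 - (real (a * dl) * (real n)\<^sup>2 + real n * (real (a * dl))\<^sup>2) * p0\<^sup>2 - 4 * real a * y"
    using cherries ay by (simp add: mult.assoc)
  also have "\<dots> \<le> measure_pmf.prob (random_graph n p0) {R. linking {0..<n} h R}"
    unfolding y_def by (rule prob_linking[OF p0(1) p01]) (use h small y_def in auto)
  also have "\<dots> \<le> measure_pmf.prob (random_graph n p0) {R. pancyclic n (G \<union> R)}"
    by (rule measure_pmf.finite_measure_mono) (use h(3) in auto)
  also have "\<dots> \<le> measure_pmf.prob (random_graph n p) {R. pancyclic n (G \<union> R)}"
    by (rule prob_upward_closed_mono[OF p0 p(2)]) (use pancyclic_mono in blast)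
  finally show ?thesis .
qed

section \<open>Disjoint cliques\<close>

text \<open>Blocks \<open>0, \<dots>, k - 2\<close> consist of \<open>d + 1\<close> consecutive numbers, block \<open>k - 1\<close> of all the
  remaining ones.\<close>

definition block :: "nat \<Rightarrow> nat \<Rightarrow> nat \<Rightarrow> nat" where
  "block d k v = min (v div (d + 1)) (k - 1)"

definition block_graph :: "nat \<Rightarrow> nat \<Rightarrow> nat \<Rightarrow> nat set set" where
  "block_graph d k n = {{u, v} | u v. u < n \<and> v < n \<and> u \<noteq> v \<and> block d k u = block d k v}"

lemma block_graph_edge:
  "{u, v} \<in> block_graph d k n \<longleftrightarrow> u < n \<and> v < n \<and> u \<noteq> v \<and> block d k u = block d k v"
  unfolding block_graph_def by (auto simp: doubleton_eq_iff)

lemma is_graph_block_graph: "is_graph n (block_graph d k n)"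
  unfolding is_graph_def block_graph_def by (auto simp: pair_in_all_pairs)

lemma not_hamiltonian_if_isolated:
  assumes u: "u \<in> B" "u < n" and v: "v \<notin> B" "v < n"
    and iso: "\<And>x y. {x, y} \<in> E \<Longrightarrow> x < n \<Longrightarrow> y < n \<Longrightarrow> x \<in> B \<Longrightarrow> y \<in> B"
  shows "\<not> hamiltonian n E"
proof
  assume "hamiltonian n E"
  then obtain vs where vs: "length vs = n" "distinct vs" "set vs \<subseteq> {0..<n}"
    "\<forall>i<n. {vs ! i, vs ! ((i + 1) mod n)} \<in> E"
    unfolding hamiltonian_def has_cycle_of_length_def by blast
  have "set vs = {0..<n}" using vs by (intro card_subset_eq) (auto simp: distinct_card)
  then obtain i j where i: "i < n" "vs ! i = u" and j: "j < n" "vs ! j = v"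
    using u(2) v(2) vs(1) by (metis atLeastLessThan_iff in_set_conv_nth le0)
  have lt: "vs ! (m mod n) < n" for m
    using vs(1,3) i(1) by (metis atLeastLessThan_iff mod_less_divisor not_gr_zero not_less_zero nth_mem subset_iff)
  have "vs ! ((i + m) mod n) \<in> B" for m
  proof (induction m)
    case 0
    then show ?case using i u by simp
  next
    case (Suc m)
    have "(i + m) mod n < n" using i(1) by simp
    then have "{vs ! ((i + m) mod n), vs ! (((i + m) mod n + 1) mod n)} \<in> E" using vs(4) by blast
    moreover have "((i + m) mod n + 1) mod n = (i + Suc m) mod n" by (simp add: mod_Suc_eq)
    ultimately show ?case using iso[of "vs ! ((i + m) mod n)" "vs ! ((i + Suc m) mod n)"] lt Suc by simp
  qed
  from this[of "j + n - i"] have "vs ! j \<in> B" using i j by simp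
  then show False using j v by simp
qed

context
  fixes d k n :: nat
  assumes k2: "2 \<le> k" and kn: "k * (d + 1) \<le> n"
begin

lemma block_less: "block d k v < k"
  unfolding block_def using k2 by simp

lemma block_start: "i < k \<Longrightarrow> block d k (i * (d + 1)) = i" "i < k \<Longrightarrow> i * (d + 1) + d < n"
proof -
  assume i: "i < k"
  have "i * (d + 1) div (d + 1) = i" by (rule nonzero_mult_div_cancel_right) simp
  then show "block d k (i * (d + 1)) = i" unfolding block_def using i by simp
  have "(i + 1) * (d + 1) \<le> k * (d + 1)" using i by (intro mult_le_mono1) simp
  then show "i * (d + 1) + d < n" using kn by simp
qed

lemma block_superset:
  assumes "i < k" shows "{i * (d + 1)..<i * (d + 1) + (d + 1)} \<subseteq> {v \<in> {0..<n}. block d k v = i}"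
proof
  fix v assume v: "v \<in> {i * (d + 1)..<i * (d + 1) + (d + 1)}"
  then have "v div (d + 1) = i" by (intro div_nat_eqI) (auto simp: algebra_simps)
  then show "v \<in> {v \<in> {0..<n}. block d k v = i}"
    using v block_start(2)[OF assms] assms unfolding block_def by auto
qed

lemma block_eq:
  assumes "i < k - 1" shows "{v \<in> {0..<n}. block d k v = i} = {i * (d + 1)..<i * (d + 1) + (d + 1)}"
proof
  show "{v \<in> {0..<n}. block d k v = i} \<subseteq> {i * (d + 1)..<i * (d + 1) + (d + 1)}"
  proof
    fix v assume "v \<in> {v \<in> {0..<n}. block d k v = i}"
    then have "v div (d + 1) = i" using assms unfolding block_def by (auto simp: min_def split: if_splits)
    moreover have "v div (d + 1) * (d + 1) + v mod (d + 1) = v" "v mod (d + 1) < (d + 1)" by (simp_all only: div_mult_mod_eq) simp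
    ultimately have "i * (d + 1) + v mod (d + 1) = v" "v mod (d + 1) < (d + 1)" by blast+
    then show "v \<in> {i * (d + 1)..<i * (d + 1) + (d + 1)}" unfolding atLeastLessThan_iff by linarith
  qed
qed (rule block_superset, use assms in simp)

lemma independence_number_block_graph: "independence_number n (block_graph d k n) = k"
proof (rule antisym)
  let ?A = "\<lambda>u v. {u, v} \<in> block_graph d k n"
  obtain I where I: "I \<subseteq> {0..<n}" "nonadj ?A I I" "card I = independence_number n (block_graph d k n)"
    unfolding independence_number_eq_ind by (rule ind_witness[of "{0..<n}" ?A]) auto
  have "inj_on (block d k) I"
  proof (rule inj_onI, rule ccontr)
    fix u v assume "u \<in> I" "v \<in> I" "block d k u = block d k v" "u \<noteq> v"
    then have "?A u v" using I(1) by (auto simp: block_graph_edge)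
    then show False using I(2) \<open>u \<in> I\<close> \<open>v \<in> I\<close> unfolding nonadj_def by blast
  qed
  then have "card I = card (block d k ` I)" by (simp add: card_image)
  also have "\<dots> \<le> card {..<k}" by (rule card_mono) (use block_less in auto)
  finally show "independence_number n (block_graph d k n) \<le> k" using I(3) by simp
  have "inj_on (\<lambda>i. i * (d + 1)) {..<k}" by (rule inj_onI) (metis block_start(1) lessThan_iff)
  then have "k = card ((\<lambda>i. i * (d + 1)) ` {..<k})" by (simp add: card_image)
  also have "\<dots> \<le> ind ?A {0..<n}"
  proof (rule ind_ge)
    show "(\<lambda>i. i * (d + 1)) ` {..<k} \<subseteq> {0..<n}" using block_start(2) by fastforce
    show "nonadj ?A ((\<lambda>i. i * (d + 1)) ` {..<k}) ((\<lambda>i. i * (d + 1)) ` {..<k})"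
      unfolding nonadj_def using block_start(1) by (auto simp: block_graph_edge simp del: mult_Suc_right)
  qed simp
  finally show "k \<le> independence_number n (block_graph d k n)" unfolding independence_number_eq_ind .
qed

lemma degree_block_graph:
  assumes "v < n" shows "degree (block_graph d k n) v + 1 = card {u \<in> {0..<n}. block d k u = block d k v}"
proof -
  have "{u. {u, v} \<in> block_graph d k n} = {u \<in> {0..<n}. block d k u = block d k v} - {v}"
    using assms by (auto simp: block_graph_edge)
  then have "degree (block_graph d k n) v = card ({u \<in> {0..<n}. block d k u = block d k v} - {v})"
    unfolding degree_def by simp
  moreover have "v \<in> {u \<in> {0..<n}. block d k u = block d k v}" using assms by simp
  ultimately show ?thesis using card_Suc_Diff1[of "{u \<in> {0..<n}. block d k u = block d k v}" v] by simp
qed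

lemma min_degree_block_graph: "min_degree n (block_graph d k n) = d"
  unfolding min_degree_def
proof (rule Min_eqI)
  fix x assume "x \<in> degree (block_graph d k n) ` {0..<n}"
  then obtain v where v: "v < n" "x = degree (block_graph d k n) v" by auto
  have "card {block d k v * (d + 1)..<block d k v * (d + 1) + (d + 1)} \<le> card {u \<in> {0..<n}. block d k u = block d k v}"
    by (rule card_mono[OF _ block_superset]) (auto simp: block_less)
  then show "d \<le> x" using degree_block_graph[OF v(1)] v(2) by simp
next
  have 0: "0 < n" "block d k 0 = 0" using block_start(2)[of 0] k2 by (auto simp: block_def)
  have "degree (block_graph d k n) 0 + 1 = (d + 1)"
    using degree_block_graph[OF 0(1)] block_eq[of 0] k2 unfolding 0(2) by simp
  then show "d \<in> degree (block_graph d k n) ` {0..<n}" using 0(1) by force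
qed simp

lemma prob_block_graph:
  fixes p :: real
  assumes p: "0 \<le> p" "p \<le> 1" and m: "m < k"
  shows "1 - p * (real m * real (d + 1))\<^sup>2 - exp (- (real m * (1 - p) ^ ((d + 1) * n)))
    \<le> measure_pmf.prob (random_graph n p) {R. \<not> hamiltonian n (block_graph d k n \<union> R)}"
proof -
  let ?pr = "measure_pmf.prob (random_graph n p)"
  let ?b = "block d k"
  define K0 where "K0 = {e \<in> all_pairs n. \<exists>u v. e = {u, v} \<and> ?b u < m \<and> ?b v < m \<and> ?b u \<noteq> ?b v}"
  define K where "K i = {e \<in> all_pairs n. \<exists>u v. e = {u, v} \<and> ?b u = i \<and> m \<le> ?b v}" for i
  have Bc: "card {v \<in> {0..<n}. ?b v = i} = (d + 1)" if "i < m" for i using block_eq[of i] that m by simp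
  have sub: "K0 \<subseteq> all_pairs n" "\<And>i. K i \<subseteq> all_pairs n" unfolding K0_def K_def by auto
  define U where "U = (\<Union>i\<in>{..<m}. {v \<in> {0..<n}. ?b v = i})"
  have fU: "finite U" unfolding U_def by auto
  have "card U \<le> card ((\<lambda>i. {v \<in> {0..<n}. ?b v = i}) ` {..<m}) * (d + 1)"
    unfolding U_def by (rule card_Union_le_mult) (use Bc in auto)
  also have "\<dots> \<le> m * (d + 1)" by (rule mult_le_mono1) (use card_image_le[of "{..<m}"] in force)
  finally have cU: "card U \<le> m * (d + 1)" .
  have "K0 \<subseteq> (\<lambda>(u, v). {u, v}) ` (U \<times> U)"
    unfolding K0_def U_def by (auto simp: pair_in_all_pairs)
  then have "card K0 \<le> card (U \<times> U)" by (rule surj_card_le[rotated]) (use fU in simp)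
  also have "\<dots> \<le> (m * (d + 1)) * (m * (d + 1))" using cU by (simp add: card_cartesian_product mult_le_mono)
  finally have "real (card K0) \<le> real ((m * (d + 1)) * (m * (d + 1)))" by (rule of_nat_mono)
  then have cK0: "real (card K0) \<le> (real m * real (d + 1))\<^sup>2" by (simp only: power2_eq_square of_nat_mult)
  have "?pr {R. R \<inter> K0 = {}} = (1 - p) ^ card K0" by (rule prob_avoid[OF p sub(1)])
  moreover have "1 + real (card K0) * (- p) \<le> (1 + (- p)) ^ card K0" by (rule Bernoulli_inequality) (use p in simp)
  moreover have "real (card K0) * p \<le> (real m * real (d + 1))\<^sup>2 * p" using cK0 p(1) by (rule mult_right_mono)
  ultimately have P0: "1 - p * (real m * real (d + 1))\<^sup>2 \<le> ?pr {R. R \<inter> K0 = {}}" by (simp add: mult.commute)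
  have disK: "K i \<inter> K j = {}" if "i < m" "j < m" "i \<noteq> j" for i j
    using that unfolding K_def by (auto simp: doubleton_eq_iff)
  have "?pr {R. R \<inter> {} = {} \<and> (\<forall>i\<in>{..<m}. R \<inter> K i \<noteq> {})} =
      (1 - p) ^ card ({} :: nat set set) * (\<Prod>i\<in>{..<m}. 1 - (1 - p) ^ card (K i))"
    by (rule prob_avoid_hit[OF p]) (use sub disK in auto)
  then have "?pr {R. \<forall>i\<in>{..<m}. R \<inter> K i \<noteq> {}} = (\<Prod>i\<in>{..<m}. 1 - (1 - p) ^ card (K i))" by simp
  also have "\<dots> \<le> (\<Prod>i\<in>{..<m}. exp (- ((1 - p) ^ ((d + 1) * n))))"
  proof (rule prod_mono)
    fix i assume i: "i \<in> {..<m}"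
    let ?B = "{v \<in> {0..<n}. ?b v = i}"
    have "K i \<subseteq> (\<lambda>(u, v). {u, v}) ` (?B \<times> {0..<n})" unfolding K_def by (auto simp: pair_in_all_pairs)
    then have "card (K i) \<le> card (?B \<times> {0..<n})"
      by (rule surj_card_le[rotated]) simp
    also have "\<dots> = (d + 1) * n" using Bc[of i] i by (simp add: card_cartesian_product)
    finally have "(1 - p) ^ ((d + 1) * n) \<le> (1 - p) ^ card (K i)" using p by (intro power_decreasing) auto
    moreover have "1 - (1 - p) ^ ((d + 1) * n) \<le> exp (- ((1 - p) ^ ((d + 1) * n)))"
      using exp_ge_add_one_self[of "- ((1 - p) ^ ((d + 1) * n))"] by simp
    moreover have "(1 - p) ^ card (K i) \<le> 1" using p by (intro power_le_one) auto
    ultimately show "0 \<le> 1 - (1 - p) ^ card (K i) \<and> 1 - (1 - p) ^ card (K i) \<le> exp (- ((1 - p) ^ ((d + 1) * n)))"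
      by linarith
  qed
  also have "\<dots> = exp (- (real m * (1 - p) ^ ((d + 1) * n)))" by (simp add: exp_of_nat_mult[symmetric])
  finally have P1: "?pr {R. \<forall>i\<in>{..<m}. R \<inter> K i \<noteq> {}} \<le> exp (- (real m * (1 - p) ^ ((d + 1) * n)))" .
  have good: "\<not> hamiltonian n (block_graph d k n \<union> R)" if R0: "R \<inter> K0 = {}" and i: "i < m" "R \<inter> K i = {}" for R i
  proof (rule not_hamiltonian_if_isolated[of "i * (d + 1)" "{v. ?b v = i}" n "(k - 1) * (d + 1)"])
    show "i * (d + 1) \<in> {v. ?b v = i}" "i * (d + 1) < n" using block_start[of i] i m by auto
    show "(k - 1) * (d + 1) \<notin> {v. ?b v = i}" "(k - 1) * (d + 1) < n" using block_start[of "k - 1"] i m by auto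
    fix x y assume e: "{x, y} \<in> block_graph d k n \<union> R" "x < n" "y < n" "x \<in> {v. ?b v = i}"
    show "y \<in> {v. ?b v = i}"
    proof (rule ccontr)
      assume ny: "y \<notin> {v. ?b v = i}"
      then have "{x, y} \<notin> block_graph d k n" using e(4) by (auto simp: block_graph_edge)
      then have xyR: "{x, y} \<in> R" using e(1) by simp
      have xy: "{x, y} \<in> all_pairs n" using e ny by (auto simp: pair_in_all_pairs)
      have "{x, y} \<in> K0 \<or> {x, y} \<in> K i"
      proof (cases "?b y < m")
        case True
        then have "{x, y} \<in> K0" unfolding K0_def using xy e(4) ny i(1)
          by (intro CollectI conjI exI[of _ x] exI[of _ y]) auto
        then show ?thesis ..
      next
        case False
        then have "{x, y} \<in> K i" unfolding K_def using xy e(4)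
          by (intro CollectI conjI exI[of _ x] exI[of _ y]) auto
        then show ?thesis ..
      qed
      then show False using xyR R0 i(2) by blast
    qed
  qed
  have "?pr {R. R \<inter> K0 = {}} \<le> ?pr ({R. \<not> hamiltonian n (block_graph d k n \<union> R)} \<union> {R. \<forall>i\<in>{..<m}. R \<inter> K i \<noteq> {}})"
    by (rule measure_pmf.finite_measure_mono) (use good in auto)
  also have "\<dots> \<le> ?pr {R. \<not> hamiltonian n (block_graph d k n \<union> R)} + ?pr {R. \<forall>i\<in>{..<m}. R \<inter> K i \<noteq> {}}"
    by (rule measure_Un_le) auto
  finally show ?thesis using P0 P1 by linarith
qed

theorem prob_not_hamiltonian:
  fixes p :: real
  assumes p: "0 \<le> p" "p \<le> 1 / 32 * ln (real k) / (real d * real n)" and d: "1 \<le> d" and k16: "16 \<le> k"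
  shows "1 - ln (real k) / (8 * sqrt (real k)) - exp (- (real k powr (1 / 8) / 2))
    \<le> measure_pmf.prob (random_graph n p) {R. \<not> hamiltonian n (block_graph d k n \<union> R)}"
proof -
  have k0: "0 < real k" "1 < real k" using k16 by auto
  have n0: "0 < real n" "0 < real d" using kn k16 d by auto
  have kdn: "real k * real d \<le> real n"
  proof -
    have "k * d \<le> n" using kn by (simp add: algebra_simps)
    then show ?thesis by (metis of_nat_le_iff of_nat_mult)
  qed
  have lnk: "0 \<le> ln (real k)" using k0 by simp
  have pdn: "p * (real d * real n) \<le> ln (real k) / 32" using p(2) n0 by (simp add: field_simps)
  have "ln (real k) \<le> real k" using k0 ln_bound[of "real k"] by simp
  also have "\<dots> \<le> real d * real n"
  proof -
    have "real k * 1 \<le> real k * real d" using d by (intro mult_left_mono) auto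
    also have "\<dots> \<le> real n" by (rule kdn)
    also have "\<dots> \<le> real d * real n" using d n0 by simp
    finally show ?thesis by simp
  qed
  finally have "ln (real k) / (real d * real n) \<le> 1" using n0 by (simp add: field_simps)
  then have "1 / 32 * ln (real k) / (real d * real n) \<le> 1 / 2" by simp
  then have p2: "p \<le> 1 / 2" using p(2) by linarith
  define m where "m = nat \<lfloor>real k powr (1 / 4)\<rfloor>"
  have q2: "2 \<le> real k powr (1 / 4)"
  proof -
    have "(2::real) = (2 powr 4) powr (1 / 4)" by (subst powr_powr) simp
    also have "\<dots> \<le> real k powr (1 / 4)" using k16 by (intro powr_mono2) auto
    finally show ?thesis .
  qed
  have m: "real k powr (1 / 4) / 2 \<le> real m" "real m \<le> real k powr (1 / 4)"
    using q2 unfolding m_def by linarith+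
  have "real k powr (1 / 4) < real k powr 1" using k0 by (intro powr_less_mono) auto
  then have mk: "m < k" using m(2) k0 by simp
  have D2: "real (d + 1) \<le> 2 * real d" using d by simp
  have "real ((d + 1) * n) \<le> 2 * real d * real n" unfolding of_nat_mult using D2 by (rule mult_right_mono) simp
  then have "2 * p * real ((d + 1) * n) \<le> 2 * p * (2 * real d * real n)"
    by (rule mult_left_mono) (use p(1) in simp)
  also have "\<dots> = 4 * (p * (real d * real n))" by simp
  also have "\<dots> \<le> ln (real k) / 8" using pdn by simp
  finally have e: "- (ln (real k) / 8) \<le> real ((d + 1) * n) * (- 2 * p)" by (simp add: algebra_simps)
  have "- 2 * p \<le> ln (1 - p)"
  proof -
    have "p * p \<le> p * (1 / 2)" using p(1) p2 by (intro mult_left_mono) auto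
    then show ?thesis using ln_one_minus_pos_lower_bound[OF p(1) p2] by (simp add: power2_eq_square)
  qed
  then have "real ((d + 1) * n) * (- 2 * p) \<le> real ((d + 1) * n) * ln (1 - p)" by (intro mult_left_mono) auto
  then have "exp (- (ln (real k) / 8)) \<le> exp (real ((d + 1) * n) * ln (1 - p))" using e by simp
  also have "\<dots> = (1 - p) ^ ((d + 1) * n)" using p2 by (subst exp_of_nat_mult) simp
  finally have "real k powr (- (1 / 8)) \<le> (1 - p) ^ ((d + 1) * n)" using k0 by (simp add: powr_def)
  then have "real k powr (1 / 4) / 2 * real k powr (- (1 / 8)) \<le> real m * (1 - p) ^ ((d + 1) * n)"
    using m(1) by (intro mult_mono) auto
  moreover have "real k powr (1 / 4) * real k powr (- (1 / 8)) = real k powr (1 / 8)"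
    by (subst powr_add[symmetric]) simp
  ultimately have "real k powr (1 / 8) / 2 \<le> real m * (1 - p) ^ ((d + 1) * n)" by simp
  then have 1: "exp (- (real m * (1 - p) ^ ((d + 1) * n))) \<le> exp (- (real k powr (1 / 8) / 2))" by simp
  have "(real m * real (d + 1))\<^sup>2 \<le> (real k powr (1 / 4) * (2 * real d))\<^sup>2"
    using m(2) D2 by (intro power_mono mult_mono) auto
  also have "\<dots> = 4 * (real k powr (1 / 4))\<^sup>2 * (real d)\<^sup>2" by (simp add: power_mult_distrib)
  also have "(real k powr (1 / 4))\<^sup>2 = sqrt (real k)"
    using k0 by (simp add: power2_eq_square powr_add[symmetric] powr_half_sqrt)
  finally have "p * (real m * real (d + 1))\<^sup>2 \<le> p * (4 * sqrt (real k) * (real d)\<^sup>2)"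
    using p(1) by (rule mult_left_mono)
  also have "\<dots> \<le> (1 / 32 * ln (real k) / (real d * real n)) * (4 * sqrt (real k) * (real d)\<^sup>2)"
    using p(2) by (intro mult_right_mono) auto
  also have "\<dots> = ln (real k) / 8 * (sqrt (real k) * real d / real n)"
    using n0 by (simp add: field_simps power2_eq_square)
  also have "\<dots> \<le> ln (real k) / 8 * (1 / sqrt (real k))"
  proof (intro mult_left_mono)
    have "sqrt (real k) * (sqrt (real k) * real d) \<le> real n" using kdn k0 by (simp add: mult.assoc[symmetric])
    then show "sqrt (real k) * real d / real n \<le> 1 / sqrt (real k)" using n0 k0 by (simp add: field_simps)
  qed (use lnk in simp)
  finally have 2: "p * (real m * real (d + 1))\<^sup>2 \<le> ln (real k) / (8 * sqrt (real k))" by simp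
  have "p \<le> 1" using p2 by simp
  from prob_block_graph[OF p(1) this mk] show ?thesis using 1 2 by linarith
qed

end

lemma not_hamiltonian_limit:
  assumes d: "\<And>n. d n \<ge> 1" and k: "filterlim k at_top sequentially" and kd: "\<And>n. k n * (d n + 1) \<le> n"
    and p: "\<And>n. 0 \<le> p n \<and> p n \<le> (1::real)"
      "\<forall>\<^sub>F n in sequentially. p n \<le> 1 / 32 * ln (real (k n)) / (real (d n) * real n)"
  shows "(\<lambda>n. measure_pmf.prob (random_graph n (p n))
    {R. \<not> hamiltonian n (block_graph (d n) (k n) n \<union> R)}) \<longlonglongrightarrow> 1"
proof (rule tendsto_sandwich)
  have "((\<lambda>x::real. 1 - ln x / (8 * sqrt x) - exp (- (x powr (1 / 8) / 2))) \<longlongrightarrow> 1) at_top" by real_asymp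
  moreover have "filterlim (\<lambda>n. real (k n)) at_top sequentially"
    using k by (rule filterlim_compose[OF filterlim_real_sequentially])
  ultimately show "(\<lambda>n. 1 - ln (real (k n)) / (8 * sqrt (real (k n))) - exp (- (real (k n) powr (1 / 8) / 2))) \<longlonglongrightarrow> 1"
    by (rule filterlim_compose)
  have "\<forall>\<^sub>F n in sequentially. 16 \<le> k n" using k by (simp add: filterlim_at_top)
  then show "\<forall>\<^sub>F n in sequentially. 1 - ln (real (k n)) / (8 * sqrt (real (k n))) - exp (- (real (k n) powr (1 / 8) / 2))
      \<le> measure_pmf.prob (random_graph n (p n)) {R. \<not> hamiltonian n (block_graph (d n) (k n) n \<union> R)}"
    using p(2)
  proof eventually_elim
    case (elim n)
    then show ?case using prob_not_hamiltonian[of "k n" "d n" n "p n"] kd d p(1) by simp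
  qed
qed (auto simp: measure_pmf.prob_le_1)

lemma pancyclic_limit:
  assumes G: "\<And>n. is_graph n (G n)"
    and C: "\<forall>\<^sub>F n in sequentially. real (independence_number n (G n) * min_degree n (G n)) \<le> C * real n"
    and dl: "\<forall>\<^sub>F n in sequentially.
      50000 * (real (independence_number n (G n)) * ln (real n))\<^sup>2 < real (min_degree n (G n))"
    and p: "\<And>n. 0 \<le> p n \<and> p n \<le> (1::real)"
    and p0: "\<forall>\<^sub>F n in sequentially. 128 * ln (real n) * ln (real (independence_number n (G n)) * ln (real n))
      / (real n * real (min_degree n (G n))) \<le> p n"
  shows "(\<lambda>n. measure_pmf.prob (random_graph n (p n)) {R. pancyclic n (G n \<union> R)}) \<longlonglongrightarrow> 1"
proof (rule tendsto_sandwich)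
  show "(\<lambda>n. 1 - 6 * (1 + C) / ln (real n) - 4 / (ln (real n))\<^sup>2) \<longlonglongrightarrow> 1" by real_asymp
  have "\<forall>\<^sub>F n in sequentially. 1 \<le> ln (real n)" by real_asymp
  then show "\<forall>\<^sub>F n in sequentially. 1 - 6 * (1 + C) / ln (real n) - 4 / (ln (real n))\<^sup>2
      \<le> measure_pmf.prob (random_graph n (p n)) {R. pancyclic n (G n \<union> R)}"
    using C dl p0
  proof eventually_elim
    case (elim n)
    then show ?case using prob_pancyclic[OF G, of n C "p n"] p by simp
  qed
qed (auto simp: measure_pmf.prob_le_1)

theorem theorem1p3:
  shows "\<exists>c1 c2 c3 :: real. c1 > 0 \<and> c2 > 0 \<and> c3 > 0 \<and>
    (\<forall>(G :: nat \<Rightarrow> nat set set) (p :: nat \<Rightarrow> real).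
       (\<forall>n. is_graph n (G n)) \<longrightarrow>
       (\<exists>C. \<forall>\<^sub>F n in sequentially.
           real (independence_number n (G n) * min_degree n (G n)) \<le> C * real n) \<longrightarrow>
       (\<forall>\<^sub>F n in sequentially.
           real (min_degree n (G n)) > c1 * (real (independence_number n (G n)) * ln (real n))^2) \<longrightarrow>
       (\<forall>n. 0 \<le> p n \<and> p n \<le> 1) \<longrightarrow>
       (\<forall>\<^sub>F n in sequentially.
           p n \<ge> c2 * ln (real n) * ln (real (independence_number n (G n)) * ln (real n))
                  / (real n * real (min_degree n (G n)))) \<longrightarrow>
       ((\<lambda>n. measure_pmf.prob (random_graph n (p n)) {R. pancyclic n (G n \<union> R)})
          \<longlonglongrightarrow> 1)) \<and>
    (\<forall>(d :: nat \<Rightarrow> nat) (k :: nat \<Rightarrow> nat).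
       (\<forall>n. d n \<ge> 1) \<longrightarrow> filterlim k at_top sequentially \<longrightarrow>
       (\<forall>n. k n * (d n + 1) \<le> n) \<longrightarrow>
       (\<exists>H :: nat \<Rightarrow> nat set set.
          (\<forall>n. is_graph n (H n)) \<and>
          (\<forall>\<^sub>F n in sequentially.
             independence_number n (H n) = k n \<and> min_degree n (H n) = d n) \<and>
          (\<forall>p :: nat \<Rightarrow> real.
             (\<forall>n. 0 \<le> p n \<and> p n \<le> 1) \<longrightarrow>
             (\<forall>\<^sub>F n in sequentially.
                p n \<le> c3 * ln (real (k n)) / (real (d n) * real n)) \<longrightarrow>
             ((\<lambda>n. measure_pmf.prob (random_graph n (p n)) {R. \<not> hamiltonian n (H n \<union> R)})
                \<longlonglongrightarrow> 1))))"
proof (rule exI[of _ 50000], rule exI[of _ 128], rule exI[of _ "1 / 32"],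
    intro conjI allI impI)
  fix G :: "nat \<Rightarrow> nat set set" and p :: "nat \<Rightarrow> real"
  assume "\<forall>n. is_graph n (G n)"
    "\<exists>C. \<forall>\<^sub>F n in sequentially. real (independence_number n (G n) * min_degree n (G n)) \<le> C * real n"
    "\<forall>\<^sub>F n in sequentially. real (min_degree n (G n)) > 50000 * (real (independence_number n (G n)) * ln (real n))^2"
    "\<forall>n. 0 \<le> p n \<and> p n \<le> 1"
    "\<forall>\<^sub>F n in sequentially. p n \<ge> 128 * ln (real n) * ln (real (independence_number n (G n)) * ln (real n))
      / (real n * real (min_degree n (G n)))"
  then show "(\<lambda>n. measure_pmf.prob (random_graph n (p n)) {R. pancyclic n (G n \<union> R)}) \<longlonglongrightarrow> 1"
    using pancyclic_limit[of G _ p] by blast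
next
  fix d k :: "nat \<Rightarrow> nat"
  assume d: "\<forall>n. d n \<ge> 1" and k: "filterlim k at_top sequentially" and kd: "\<forall>n. k n * (d n + 1) \<le> n"
  have ev: "\<forall>\<^sub>F n in sequentially. 2 \<le> k n" using k by (simp add: filterlim_at_top)
  show "\<exists>H :: nat \<Rightarrow> nat set set.
          (\<forall>n. is_graph n (H n)) \<and>
          (\<forall>\<^sub>F n in sequentially.
             independence_number n (H n) = k n \<and> min_degree n (H n) = d n) \<and>
          (\<forall>p :: nat \<Rightarrow> real.
             (\<forall>n. 0 \<le> p n \<and> p n \<le> 1) \<longrightarrow>
             (\<forall>\<^sub>F n in sequentially.
                p n \<le> 1 / 32 * ln (real (k n)) / (real (d n) * real n)) \<longrightarrow>
             ((\<lambda>n. measure_pmf.prob (random_graph n (p n)) {R. \<not> hamiltonian n (H n \<union> R)})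
                \<longlonglongrightarrow> 1))"
  proof (rule exI[of _ "\<lambda>n. block_graph (d n) (k n) n"], intro conjI allI impI)
    show "is_graph n (block_graph (d n) (k n) n)" for n by (rule is_graph_block_graph)
    show "\<forall>\<^sub>F n in sequentially. independence_number n (block_graph (d n) (k n) n) = k n \<and>
        min_degree n (block_graph (d n) (k n) n) = d n"
      using ev
    proof eventually_elim
      case (elim n)
      then show ?case using independence_number_block_graph min_degree_block_graph kd by simp
    qed
    fix p :: "nat \<Rightarrow> real"
    assume "\<forall>n. 0 \<le> p n \<and> p n \<le> 1"
      "\<forall>\<^sub>F n in sequentially. p n \<le> 1 / 32 * ln (real (k n)) / (real (d n) * real n)"
    then show "(\<lambda>n. measure_pmf.prob (random_graph n (p n)) {R. \<not> hamiltonian n (block_graph (d n) (k n) n \<union> R)})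
        \<longlonglongrightarrow> 1"
      using not_hamiltonian_limit[of d k p] d k kd by simp
  qed
qed simp_all

end
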